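(* Let $n\ge 1$ and let $0<\alpha\le 2$. For any real number $0<\eta<5$ and any function $V\in\mathcal L_{og}(\mathbb C^n)$, the lower bound $$V(z)\ \ge\ -\log(5e/\eta)$$ holds for all $z\in\mathbb C^n$ outside the union of a countable family of Euclidean balls $(\mathbb B(z_j,r_j))$ of radii $r_j$ less than $\eta$ satisfying the condition $$\sum_{\mathbb B(z_j,r_j)\cap\mathbb B_R\ne\emptyset} r_j^{2n-2+\alpha}\ <\ 5^{2n-2}(R+\eta)^{2n-2}\,\eta^{\alpha}/\alpha,\qquad \forall R>0.$$ In particular, the exceptional set $E_\eta\subset\mathbb C^n$ of points where the lower estimate $V(z)\ge-\log(5e/\eta)$ is not satisfied is a Borel set for which $$h^{2n-2+\alpha}_{\eta}(E_\eta\cap\mathbb B_R)\ <\ 5^{2n-2}(R+\eta)^{2n-2}\,\eta^{\alpha}/\alpha,\qquad \forall R>0.$$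
   Context: $|\cdot|$ is the Euclidean norm on $\mathbb C^n$; $\mathbb B(a,r)$ is the Euclidean ball of center $a$ and radius $r$, and $\mathbb B_R$ is the Euclidean ball of radius $R$ centered at the origin. $PSH(\mathbb C^n)$ is the set of plurisubharmonic functions on $\mathbb C^n$ that are not identically $-\infty$. Lelong class: $\mathcal L(\mathbb C^n):=\{v\in PSH(\mathbb C^n):\ v(z)\le\log^+|z|+O(1)\ \forall z\in\mathbb C^n\}$. Robin function: for $V\in\mathcal L(\mathbb C^n)$ and $z\in\mathbb C^n\setminus\{0\}$, $\rho_V(z):=\limsup_{\lambda\in\mathbb C,\ \lambda\to\infty}\bigl(V(\lambda z)-\log|\lambda z|\bigr)$. It is constant on complex lines through the origin, hence is regarded as a function on $\mathbb P^{n-1}$. $\mathcal L_\star(\mathbb C^n):=\{V\in\mathcal L(\mathbb C^n):\rho_V\not\equiv-\infty\}$. Let $\omega_0$ be the Fubini–Study form on $\mathbb P^{n-1}$ normalized by $\int_{\mathbb P^{n-1}}\omega_0^{n-1}=1$. The class of logarithmic potentials is $$\mathcal L_{og}(\mathbb C^n):=\Bigl\{V\in\mathcal L_\star(\mathbb C^n):\ \int_{\mathbb P^{n-1}}\rho_V\,\omega_0^{n-1}=0\Bigr\}.$$ Hausdorff content: for $p>0$, $\delta\in(0,+\infty]$ and a subset $E$ of a metric space, $h^p_\delta(E)$ is the infimum of $\sum_j r(B_j)^p$ over all countable coverings $(B_j)$ of $E$ by balls of radii $r(B_j)\le\delta$. Here the metric is the Euclidean one on $\mathbb C^n$. *)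

theory Defs
  imports "HOL-Analysis.Analysis"
begin

section \<open>Plurisubharmonic functions\<close>

text \<open>
  Integral of a function with values in \<open>[-\<infinity>, \<infinity>)\<close>. It is only used for functions that are bounded
  above on a finite measure space, so the positive part has finite integral and no
  \<open>\<infinity> - \<infinity>\<close> arises.
\<close>

definition ereal_integral :: "'a measure \<Rightarrow> ('a \<Rightarrow> ereal) \<Rightarrow> ereal" where
  "ereal_integral M f =
     enn2ereal (\<integral>\<^sup>+ x. e2ennreal (f x) \<partial>M) - enn2ereal (\<integral>\<^sup>+ x. e2ennreal (- f x) \<partial>M)"

text \<open>
  Upper semicontinuous, and on every complex line the sub-mean value inequality holds for every
  circle (\<open>b\<close> carries both the direction and the radius).
\<close>

definition plurisubharmonic :: "(complex ^ 'n \<Rightarrow> ereal) \<Rightarrow> bool" where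
  "plurisubharmonic u \<longleftrightarrow>
     (\<forall>z. u z < \<infinity>) \<and>
     (\<forall>c. open {z. u z < c}) \<and>
     (\<forall>a b. u a \<le>
        ereal_integral (uniform_measure lborel {0..2 * pi}) (\<lambda>\<theta>. u (a + cis \<theta> *s b)))"

definition PSH :: "(complex ^ 'n \<Rightarrow> ereal) set" where
  "PSH = {u. plurisubharmonic u \<and> (\<exists>z. u z \<noteq> -\<infinity>)}"

text \<open>\<open>ln (max 1 t)\<close> is \<open>log\<^sup>+ t\<close>.\<close>

definition Lelong :: "(complex ^ 'n \<Rightarrow> ereal) set" where
  "Lelong = {v. v \<in> PSH \<and> (\<exists>C::real. \<forall>z. v z \<le> ereal (ln (max 1 (norm z)) + C))}"


section \<open>Complex projective space\<close>

text \<open>For index type \<open>'n\<close> the type \<open>'n cproj\<close> is the projective space of complex dimension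
  \<open>CARD('n) - 1\<close>.\<close>

definition same_line :: "complex ^ 'n \<Rightarrow> complex ^ 'n \<Rightarrow> bool" where
  "same_line x y \<longleftrightarrow> x \<noteq> 0 \<and> y \<noteq> 0 \<and> (\<exists>c. c \<noteq> 0 \<and> y = c *s x)"

quotient_type 'n cproj = "complex ^ 'n" / partial: "same_line :: complex ^ 'n::finite \<Rightarrow> _"
proof (rule part_equivpI)
  show "\<exists>x::complex ^ 'n. same_line x x"
    by (rule exI[of _ "axis undefined 1"])
       (auto simp: same_line_def intro!: exI[of _ 1])
  show "symp (same_line :: complex ^ 'n \<Rightarrow> _)"
  proof (rule sympI)
    fix x y :: "complex ^ 'n"
    assume "same_line x y"
    then obtain c where c: "x \<noteq> 0" "y \<noteq> 0" "c \<noteq> 0" "y = c *s x"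
      unfolding same_line_def by blast
    then have "x = inverse c *s y"
      by (simp add: vector_smult_assoc)
    with c show "same_line y x"
      unfolding same_line_def by (metis nonzero_imp_inverse_nonzero)
  qed
  show "transp (same_line :: complex ^ 'n \<Rightarrow> _)"
  proof (rule transpI)
    fix x y z :: "complex ^ 'n"
    assume "same_line x y" "same_line y z"
    then obtain c d where "x \<noteq> 0" "z \<noteq> 0" "c \<noteq> 0" "d \<noteq> 0" "y = c *s x" "z = d *s y"
      unfolding same_line_def by blast
    then show "same_line x z"
      unfolding same_line_def by (metis mult_eq_0_iff vector_smult_assoc)
  qed
qed

definition proj :: "complex ^ 'n \<Rightarrow> 'n cproj" where
  "proj = abs_cproj"

text \<open>Quotient topology from the nonzero vectors.\<close>

instantiation cproj :: (finite) topological_space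
begin

definition open_cproj :: "'a cproj set \<Rightarrow> bool" where
  "open_cproj U \<longleftrightarrow> open {z::complex ^ 'a. z \<noteq> 0 \<and> proj z \<in> U}"

instance
proof
  have "{z::complex ^ 'a. z \<noteq> 0 \<and> proj z \<in> UNIV} = - {0}"
    by auto
  then show "open (UNIV :: 'a cproj set)"
    unfolding open_cproj_def by (metis open_Compl closed_singleton)
next
  fix S T :: "'a cproj set"
  assume "open S" "open T"
  moreover have "{z. z \<noteq> 0 \<and> proj z \<in> S \<inter> T} =
      {z. z \<noteq> 0 \<and> proj z \<in> S} \<inter> {z. z \<noteq> 0 \<and> proj z \<in> T}"
    by auto
  ultimately show "open (S \<inter> T)"
    unfolding open_cproj_def by (simp only: open_Int)
next
  fix K :: "'a cproj set set"
  assume "\<forall>S\<in>K. open S"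
  moreover have "{z. z \<noteq> 0 \<and> proj z \<in> \<Union>K} = (\<Union>S\<in>K. {z. z \<noteq> 0 \<and> proj z \<in> S})"
    by auto
  ultimately show "open (\<Union>K)"
    unfolding open_cproj_def by (simp only: open_UN)
qed

end


section \<open>The Fubini--Study volume\<close>

definition partial_z :: "'n \<Rightarrow> (complex ^ 'n \<Rightarrow> complex) \<Rightarrow> complex ^ 'n \<Rightarrow> complex" where
  "partial_z j f z =
     (vector_derivative (\<lambda>t::real. f (z + t *\<^sub>R axis j 1)) (at 0)
      - \<i> * vector_derivative (\<lambda>t::real. f (z + t *\<^sub>R axis j \<i>)) (at 0)) / 2"

definition partial_zbar :: "'n \<Rightarrow> (complex ^ 'n \<Rightarrow> complex) \<Rightarrow> complex ^ 'n \<Rightarrow> complex" where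
  "partial_zbar j f z =
     (vector_derivative (\<lambda>t::real. f (z + t *\<^sub>R axis j 1)) (at 0)
      + \<i> * vector_derivative (\<lambda>t::real. f (z + t *\<^sub>R axis j \<i>)) (at 0)) / 2"

text \<open>
  The Fubini--Study form is
  \<open>\<omega>\<^sub>0 = (i / 2\<pi>) \<partial>\<partial>\<^sup>- log |z|\<^sup>2 = (i / 2\<pi>) \<Sum> h\<^sub>j\<^sub>l dz\<^sub>j \<and> dz\<^sub>l\<^sup>-\<close>
  in homogeneous coordinates \<open>z\<close>.
\<close>

definition FS_coeff :: "complex ^ 'n \<Rightarrow> 'n \<Rightarrow> 'n \<Rightarrow> complex" where
  "FS_coeff z j l =
     partial_z j (partial_zbar l (\<lambda>w. complex_of_real (ln ((norm w)\<^sup>2)))) z"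

text \<open>
  The affine chart \<open>z\<^sub>k \<noteq> 0\<close>, with the coordinates \<open>\<zeta>\<^sub>j\<close>, \<open>j \<noteq> k\<close>, of the point with homogeneous
  coordinates \<open>z\<^sub>k = 1\<close>, \<open>z\<^sub>j = \<zeta>\<^sub>j\<close>.
\<close>

definition affine_chart :: "'n \<Rightarrow> ('n \<Rightarrow> complex) \<Rightarrow> complex ^ 'n" where
  "affine_chart k \<zeta> = (\<chi> j. if j = k then 1 else \<zeta> j)"

text \<open>
  With \<open>m = n - 1\<close> we have \<open>\<omega>\<^sub>0\<^sup>m = (m! / \<pi>\<^sup>m) det (h\<^sub>j\<^sub>l)\<^sub>j\<^sub>,\<^sub>l\<^sub>\<noteq>\<^sub>k d\<lambda>(\<zeta>)\<close> in this chart, \<open>\<lambda>\<close> being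
  Lebesgue measure on the space \<open>\<complex>\<^sup>m\<close> of the \<open>\<zeta>\<close>. The \<open>m \<times> m\<close> determinant is written as an
  \<open>n \<times> n\<close> one by completing row and column \<open>k\<close> by those of the identity. It equals
  \<open>(1 + |\<zeta>|\<^sup>2)\<^sup>-\<^sup>n\<close>, so the total mass is \<open>1\<close>.
\<close>

definition FS_density :: "'n \<Rightarrow> ('n::finite \<Rightarrow> complex) \<Rightarrow> real" where
  "FS_density k \<zeta> =
     fact (CARD('n) - 1) / pi ^ (CARD('n) - 1) *
     Re (det (\<chi> j l. if j \<noteq> k \<and> l \<noteq> k then FS_coeff (affine_chart k \<zeta>) j l
                      else if j = l then 1 else 0))"

text \<open>
  The measure \<open>\<omega>\<^sub>0\<^sup>n\<^sup>-\<^sup>1\<close>, computed in one affine chart. The complement of a chart is a null set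
  and the result does not depend on the chart, so the choice of \<open>k\<close> is immaterial.
\<close>

definition FS_measure_chart :: "'n \<Rightarrow> 'n::finite cproj measure" where
  "FS_measure_chart k =
     distr (density (\<Pi>\<^sub>M j\<in>- {k}. (lborel :: complex measure)) (\<lambda>\<zeta>. ennreal (FS_density k \<zeta>)))
       borel (\<lambda>\<zeta>. proj (affine_chart k \<zeta>))"

definition FS_measure :: "'n::finite cproj measure" where
  "FS_measure = FS_measure_chart (SOME k. True)"


section \<open>Robin functions and logarithmic potentials\<close>

definition Robin :: "(complex ^ 'n \<Rightarrow> ereal) \<Rightarrow> complex ^ 'n \<Rightarrow> ereal" where
  "Robin V z = Limsup at_infinity (\<lambda>t::complex. V (t *s z) - ereal (ln (norm (t *s z))))"

lemma filtermap_mult_at_infinity: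
  fixes c :: complex
  assumes "c \<noteq> 0"
  shows "filtermap (\<lambda>x. x * c) at_infinity = at_infinity"
proof (rule filtermap_fun_inverse[where g = "\<lambda>x. x * inverse c"])
  have *: "filterlim (\<lambda>x. x * d) at_infinity at_infinity" if "d \<noteq> 0" for d :: complex
    using tendsto_mult_filterlim_at_infinity[OF tendsto_const that filterlim_ident]
    by (simp add: mult.commute)
  show "filterlim (\<lambda>x. x * inverse c) at_infinity at_infinity"
    using assms by (intro *) simp
  show "filterlim (\<lambda>x. x * c) at_infinity at_infinity"
    using assms by (rule *)
  show "\<forall>\<^sub>F x in at_infinity. x * inverse c * c = x"
    using assms by simp
qed

lemma Robin_scale:
  assumes "c \<noteq> 0"
  shows "Robin V (c *s z) = Robin V z"
proof -
  define F where "F = (\<lambda>t::complex. V (t *s z) - ereal (ln (norm (t *s z))))"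
  have "Robin V z = Limsup at_infinity F"
    unfolding Robin_def F_def ..
  also have "\<dots> = Limsup (filtermap (\<lambda>t. t * c) at_infinity) F"
    unfolding filtermap_mult_at_infinity[OF assms] ..
  also have "\<dots> = Limsup at_infinity (\<lambda>t. F (t * c))"
    by (rule Limsup_filtermap_eq) (use assms in \<open>simp add: inj_on_def\<close>)
  also have "\<dots> = Robin V (c *s z)"
    unfolding Robin_def F_def vector_smult_assoc ..
  finally show ?thesis ..
qed

lift_definition Robin_proj :: "(complex ^ 'n \<Rightarrow> ereal) \<Rightarrow> 'n::finite cproj \<Rightarrow> ereal" is Robin
  unfolding same_line_def by (metis Robin_scale)

definition Lelong_star :: "(complex ^ 'n::finite \<Rightarrow> ereal) set" where
  "Lelong_star = {V. V \<in> Lelong \<and> (\<exists>p. Robin_proj V p \<noteq> -\<infinity>)}"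

definition Log_potentials :: "(complex ^ 'n::finite \<Rightarrow> ereal) set" where
  "Log_potentials = {V. V \<in> Lelong_star \<and> ereal_integral FS_measure (Robin_proj V) = 0}"


section \<open>Hausdorff content\<close>

definition Hausdorff_content :: "real \<Rightarrow> ereal \<Rightarrow> 'a::metric_space set \<Rightarrow> ennreal" where
  "Hausdorff_content p \<delta> E =
     Inf {(\<Sum>\<^sub>\<infinity>j\<in>J. ennreal (r j powr p)) | (J :: nat set) (c :: nat \<Rightarrow> 'a) (r :: nat \<Rightarrow> real).
            (\<forall>j\<in>J. 0 < r j \<and> ereal (r j) \<le> \<delta>) \<and> E \<subseteq> (\<Union>j\<in>J. ball (c j) (r j))}"

end

theory Submission
  imports Defs "HOL-Complex_Analysis.Complex_Analysis" "HOL-Real_Asymp.Real_Asymp"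
begin

text \<open>
  Fix a point \<open>z\<close> and average \<open>V\<close> over the shell \<open>4 t / 5 \<le> |x - z| \<le> t\<close>, with a smooth radial
  weight of total mass \<open>1\<close>; call the result \<open>M(z, t)\<close>. Plurisubharmonicity on the complex lines
  through \<open>z\<close> makes \<open>M\<close> convex in \<open>log t\<close> (lemma \<open>avg_log_convex\<close>, from the three circles theorem
  \<open>circle_concave\<close>), and the growth of \<open>V\<close> bounds its slope in \<open>log t\<close> by \<open>1\<close>, so that
  \<open>M(z, t) - log t\<close> decreases in \<open>t\<close>.

  The normalization of the Robin function fixes the behaviour at infinity. On a complex line through
  the origin the upper limit of \<open>V(\<lambda> x) - log |\<lambda> x|\<close> is also the limit of the circle means of that
  function (lemma \<open>Limsup_eq_INF\<close>; a Harnack inequality shows that large values cannot be isolated).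
  Integration over the directions, where the Fubini--Study volume is the angular part of Lebesgue
  measure (lemma \<open>nn_integral_homogeneous_FS\<close>), gives that \<open>M(0, t) - log t\<close> stays above
  \<open>log (4 / 5)\<close>. Moving the centre costs nothing in the limit \<open>t \<rightarrow> \<infinity>\<close>, and by monotonicity
  \<open>M(z, t) \<ge> log t + log (4 / 5)\<close> for all \<open>z\<close> and \<open>t\<close> (lemma \<open>avg_ge\<close>).

  Start at \<open>t = \<eta> / 4\<close>, where this lower bound is \<open>log (\<eta> / 5)\<close>, and let \<open>t\<close> run through
  \<open>\<eta> / 2\<^sup>k\<^sup>+\<^sup>2\<close>. Since \<open>M(z, t)\<close> comes down to values at most \<open>V(z)\<close>, an exceptional \<open>z\<close> requires a
  drop of \<open>M\<close> by more than \<open>1\<close>. So at some scale \<open>k\<close> the slope exceeds \<open>c 2\<^sup>-\<^sup>\<alpha>\<^sup>k\<close>, where \<open>c\<close> is chosen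
  so that the drops allowed by these bounds add up to \<open>1\<close>.

  The slope at \<open>(z, t)\<close>, multiplied by \<open>t\<^sup>2\<^sup>n\<^sup>-\<^sup>2\<close>, is the mass that the Riesz measure of \<open>V\<close> gives to a bump
  function supported in the ball of centre \<open>z\<close> and radius \<open>t\<close>, that is, the integral of \<open>V\<close> against
  the Laplacian of the bump. These masses add up over disjoint balls to at most the mass of one large
  bump that dominates them all (lemma \<open>log_slope_superadditive\<close>), and the slope of the latter is at
  most \<open>1\<close>. A greedy choice of disjoint balls, from large to small scales, leaves every bad point in
  the double of a chosen ball (lemma \<open>greedy_disjoint_balls\<close>). Comparing the lower bounds for the
  slopes of the chosen balls with the bound for their total mass yields the estimate; the constant
  \<open>5\<close> leaves room for the doubling, for the ratio \<open>4 / 5\<close> of the shell and for the discrete scales.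
\<close>

section \<open>Isometries and scalings of Lebesgue measure\<close>

lemma nn_integral_lborel_affine:
  fixes t :: "'a::euclidean_space"
  assumes [measurable]: "f \<in> borel_measurable borel" and c: "c \<noteq> 0"
  shows "(\<integral>\<^sup>+x. f x \<partial>lborel) = ennreal (\<bar>c\<bar> ^ DIM('a)) * (\<integral>\<^sup>+x. f (t + c *\<^sub>R x) \<partial>lborel)"
  by (subst lborel_affine[OF c, of t]) (simp add: nn_integral_density nn_integral_distr nn_integral_cmult)

lemma nn_integral_lborel_translate:
  fixes t :: "'a::euclidean_space"
  assumes [measurable]: "f \<in> borel_measurable borel"
  shows "(\<integral>\<^sup>+x. f (t + x) \<partial>lborel) = (\<integral>\<^sup>+x. f x \<partial>lborel)"
  using nn_integral_lborel_affine[OF assms, of 1 t] by simp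

lemma nn_integral_lborel_reflect:
  fixes t :: "'a::euclidean_space"
  assumes [measurable]: "f \<in> borel_measurable borel"
  shows "(\<integral>\<^sup>+x. f (t - x) \<partial>lborel) = (\<integral>\<^sup>+x. f x \<partial>lborel)"
  using nn_integral_lborel_affine[OF assms, of "-1" t] by simp

text \<open>
  The uniqueness argument for Haar measure: evaluate the double integral of
  \<open>1\<^sub>A(f x) 1\<^sub>B(f x + y)\<close> in both orders, where \<open>B\<close> is the unit ball. One order gives the measure of
  \<open>f\<^sup>-\<^sup>1 A\<close>, the other one that of \<open>A\<close>, each times the measure of \<open>B\<close>, because \<open>f\<close> preserves \<open>B\<close>.
\<close>

lemma distr_lborel_isometry:
  fixes f :: "'a::euclidean_space \<Rightarrow> 'a"
  assumes lin: "linear f" and iso: "\<And>x. norm (f x) = norm x"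
  shows "distr lborel borel f = lborel"
proof (rule measure_eqI)
  show "sets (distr lborel borel f) = sets lborel" by simp
next
  fix A :: "'a set" assume "A \<in> sets (distr lborel borel f)"
  then have A[measurable]: "A \<in> sets borel" by simp
  have inj: "inj f"
    using lin iso by (metis linear_injective_0 norm_eq_zero)
  then have surj: "surj f" using lin by (simp add: linear_injective_imp_surjective)
  define g where "g = inv f"
  have fg: "f (g y) = y" for y using surj by (simp add: g_def surj_f_inv_f)
  have cont: "continuous_on UNIV f"
    using lin by (simp add: linear_continuous_on linear_conv_bounded_linear)
  have [measurable]: "f \<in> borel_measurable borel"
    using cont by (rule borel_measurable_continuous_onI)
  define B :: "'a set" where "B = ball 0 1"
  have B[measurable]: "B \<in> sets borel" by (simp add: B_def)
  have fB: "indicator B (f x) = (indicator B x :: ennreal)" for x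
    by (simp add: B_def indicator_def iso)
  have Bfin: "emeasure lborel B < \<infinity>" "emeasure lborel B \<noteq> 0"
    unfolding B_def using emeasure_lborel_ball_finite[of "0::'a" 1] 
    using unit_ball_vol_pos[of "real DIM('a)", THEN less_imp_neq] by (auto simp: emeasure_ball)
  have "emeasure (distr lborel borel f) A * emeasure lborel B
      = (\<integral>\<^sup>+x. indicator A (f x) * emeasure lborel B \<partial>lborel)"
  proof -
    have "emeasure (distr lborel borel f) A = (\<integral>\<^sup>+x. indicator A x \<partial>distr lborel borel f)" by simp
    also have "\<dots> = (\<integral>\<^sup>+x. indicator A (f x) \<partial>lborel)"
      by (subst nn_integral_distr) auto
    finally show ?thesis by (subst nn_integral_multc) auto
  qed
  also have "\<dots> = (\<integral>\<^sup>+x. (\<integral>\<^sup>+y. indicator A (f x) * indicator B (f x + y) \<partial>lborel) \<partial>lborel)"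
    by (subst nn_integral_cmult) (auto simp: nn_integral_lborel_translate)
  also have "\<dots> = (\<integral>\<^sup>+y. (\<integral>\<^sup>+x. indicator A (f x) * indicator B (f x + y) \<partial>lborel) \<partial>lborel)"
    by (rule lborel_pair.Fubini') measurable
  also have "\<dots> = (\<integral>\<^sup>+y. (\<integral>\<^sup>+x. indicator A (f x - y) * indicator B (f x) \<partial>lborel) \<partial>lborel)"
  proof (rule nn_integral_cong)
    fix y
    have *: "f (- g y + x) = f x - y" for x
      using linear_add[OF lin, of "- g y" x] linear_neg[OF lin, of "g y"] fg[of y] by simp
    have "(\<integral>\<^sup>+x. indicator A (f x) * indicator B (f x + y) \<partial>lborel) =
      (\<integral>\<^sup>+x. indicator A (f (- g y + x)) * indicator B (f (- g y + x) + y) \<partial>lborel)"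
      by (rule nn_integral_lborel_translate[where f = "\<lambda>x. indicator A (f x) * indicator B (f x + y)", symmetric])
        measurable
    then show "(\<integral>\<^sup>+x. indicator A (f x) * indicator B (f x + y) \<partial>lborel) =
      (\<integral>\<^sup>+x. indicator A (f x - y) * indicator B (f x) \<partial>lborel)"
      unfolding * by simp
  qed
  also have "\<dots> = (\<integral>\<^sup>+x. (\<integral>\<^sup>+y. indicator A (f x - y) * indicator B (f x) \<partial>lborel) \<partial>lborel)"
    by (rule lborel_pair.Fubini') measurable
  also have "\<dots> = (\<integral>\<^sup>+x. emeasure lborel A * indicator B (f x) \<partial>lborel)"
    by (subst nn_integral_multc) (auto simp: nn_integral_lborel_reflect)
  also have "\<dots> = emeasure lborel A * emeasure lborel B"
    by (simp add: fB nn_integral_cmult)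
  finally show "emeasure (distr lborel borel f) A = emeasure lborel A"
    using Bfin by (metis ennreal_mult_divide_eq infinity_ennreal_def less_irrefl)
qed

lemma nn_integral_lborel_isometry:
  fixes f :: "'a::euclidean_space \<Rightarrow> 'a"
  assumes lin: "linear f" and iso: "\<And>x. norm (f x) = norm x" and [measurable]: "h \<in> borel_measurable borel"
  shows "(\<integral>\<^sup>+x. h (f x) \<partial>lborel) = (\<integral>\<^sup>+x. h x \<partial>lborel)"
proof -
  have "f \<in> borel_measurable lborel"
    using lin by (simp add: borel_measurable_continuous_onI linear_continuous_on linear_conv_bounded_linear)
  then show ?thesis
    by (subst (2) distr_lborel_isometry[OF lin iso, symmetric]) (simp add: nn_integral_distr)
qed

lemma norm_vector_smult:
  fixes x :: "complex ^ 'n::finite"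
  shows "norm (c *s x) = cmod c * norm x"
  by (simp add: norm_vec_def L2_set_def vector_scalar_mult_def norm_mult power_mult_distrib
      sum_distrib_left[symmetric] real_sqrt_mult)

lemma linear_vector_smult: "linear (\<lambda>x::complex ^ 'n::finite. c *s x)"
  by (rule linearI) (simp_all add: vec_eq_iff algebra_simps)

lemma vector_smult_of_real: "complex_of_real r *s x = r *\<^sub>R (x :: complex ^ 'n::finite)"
  unfolding vec_eq_iff by (simp only: vector_smult_component vector_scaleR_component scaleR_conv_of_real[where 'a=complex]) simp

lemma continuous_on_vector_smult [continuous_intros]:
  fixes f :: "'a::topological_space \<Rightarrow> complex" and g :: "'a \<Rightarrow> complex ^ 'n::finite"
  assumes "continuous_on S f" "continuous_on S g"
  shows "continuous_on S (\<lambda>x. f x *s g x)"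
  unfolding vector_scalar_mult_def
  by (intro continuous_on_vec_lambda continuous_intros assms)

lemma measurable_vector_smult [measurable]:
  assumes f[measurable]: "f \<in> borel_measurable M" and g[measurable]: "g \<in> borel_measurable M"
  shows "(\<lambda>x. f x *s (g x :: complex ^ 'n::finite)) \<in> borel_measurable M"
proof -
  have "(\<lambda>p::complex \<times> (complex ^ 'n). fst p *s snd p) \<in> borel_measurable borel"
    by (intro borel_measurable_continuous_onI continuous_intros)
  from measurable_compose[OF borel_measurable_Pair[OF f g] this] show ?thesis by simp
qed

lemma nn_integral_lborel_cis:
  fixes h :: "complex ^ 'n::finite \<Rightarrow> ennreal"
  assumes "h \<in> borel_measurable borel"
  shows "(\<integral>\<^sup>+x. h (cis \<theta> *s x) \<partial>lborel) = (\<integral>\<^sup>+x. h x \<partial>lborel)"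
  by (rule nn_integral_lborel_isometry[OF linear_vector_smult _ assms]) (simp add: norm_vector_smult)

lemma nn_integral_lborel_cis_complex:
  fixes h :: "complex \<Rightarrow> ennreal"
  assumes "h \<in> borel_measurable borel"
  shows "(\<integral>\<^sup>+x. h (cis \<theta> * x) \<partial>lborel) = (\<integral>\<^sup>+x. h x \<partial>lborel)"
  by (rule nn_integral_lborel_isometry[OF _ _ assms]) (auto simp: norm_mult intro!: linear_times)

lemma nn_integral_lborel_mult_complex:
  fixes h :: "complex \<Rightarrow> ennreal"
  assumes [measurable]: "h \<in> borel_measurable borel" and c: "c \<noteq> 0"
  shows "(\<integral>\<^sup>+x. h x \<partial>lborel) = ennreal ((cmod c)\<^sup>2) * (\<integral>\<^sup>+x. h (c * x) \<partial>lborel)"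
proof -
  have "(\<integral>\<^sup>+x. h x \<partial>lborel) = ennreal ((cmod c)\<^sup>2) * (\<integral>\<^sup>+x. h (cmod c *\<^sub>R x) \<partial>lborel)"
    using nn_integral_lborel_affine[of h "cmod c" 0] c by simp
  also have "(\<integral>\<^sup>+x. h (cmod c *\<^sub>R x) \<partial>lborel) = (\<integral>\<^sup>+x. h (cmod c *\<^sub>R (cis (Arg c) * x)) \<partial>lborel)"
    by (rule nn_integral_lborel_cis_complex[symmetric]) measurable
  also have "(\<lambda>x. h (cmod c *\<^sub>R (cis (Arg c) * x))) = (\<lambda>x. h (c * x))"
  proof
    fix x
    have "cmod c *\<^sub>R (cis (Arg c) * x) = c * x"
      using c rcis_cmod_Arg[of c]
      by (simp add: rcis_def scaleR_conv_of_real mult.assoc[symmetric])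
    then show "h (cmod c *\<^sub>R (cis (Arg c) * x)) = h (c * x)" by simp
  qed
  finally show ?thesis .
qed

section \<open>Averages over circles\<close>

abbreviation circ :: "real measure" where
  "circ \<equiv> uniform_measure lborel {0..2 * pi}"

lemma prob_space_circ: "emeasure circ UNIV = 1"
proof -
  have "0 < 2 * pi" by simp
  then have "ennreal (2 * pi) / ennreal (2 * pi) = 1"
    by (simp add: divide_ennreal)
  then show ?thesis by simp
qed

lemma nn_integral_circ:
  assumes [measurable]: "f \<in> borel_measurable borel"
  shows "(\<integral>\<^sup>+\<theta>. f \<theta> \<partial>circ) = (\<integral>\<^sup>+\<theta>. f \<theta> * indicator {0..2*pi} \<theta> \<partial>lborel) / ennreal (2 * pi)"
  by (subst nn_integral_uniform_measure) auto

lemma nn_integral_circ_const [simp]: "(\<integral>\<^sup>+\<theta>. c \<partial>circ) = c"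
  using prob_space_circ by (simp add: space_uniform_measure)

lemma finite_measure_circ: "finite_measure circ"
  by (rule finite_measureI) (use prob_space_circ in \<open>simp add: space_uniform_measure\<close>)

lemma measurable_cis [measurable]: "cis \<in> borel_measurable borel"
  by (intro borel_measurable_continuous_onI continuous_intros)

lemma nn_integral_circ_rotate:
  assumes [measurable]: "h \<in> borel_measurable borel" and c: "cmod c = 1"
  shows "(\<integral>\<^sup>+\<theta>. h (c * cis \<theta>) \<partial>circ) = (\<integral>\<^sup>+\<theta>. h (cis \<theta>) \<partial>circ)"
proof -
  \<comment> \<open>the shifted interval \<open>[p, p + 2 \<pi>]\<close> is cut at \<open>2 \<pi>\<close> and its second part moved back by a period\<close>
  define p where "p = Arg2pi c"
  have p: "0 \<le> p" "p < 2 * pi" "c = cis p"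
    using Arg2pi[of c] c by (auto simp: p_def cis_conv_exp mult.commute is_Arg_def)
  have cp: "cis (t + 2 * pi) = cis t" for t by (simp add: cis.ctr)
  have "(\<integral>\<^sup>+\<theta>. h (c * cis \<theta>) * indicator {0..2*pi} \<theta> \<partial>lborel)
      = (\<integral>\<^sup>+\<theta>. h (cis (p + \<theta>)) * indicator {p..p+2*pi} (p + \<theta>) \<partial>lborel)"
    by (intro nn_integral_cong) (auto simp: p(3) cis_mult split: split_indicator)
  also have "\<dots> = (\<integral>\<^sup>+\<theta>. h (cis \<theta>) * indicator {p..p+2*pi} \<theta> \<partial>lborel)"
    by (rule nn_integral_lborel_translate[where f="\<lambda>\<theta>. h (cis \<theta>) * indicator {p..p+2*pi} \<theta>"]) measurable
  also have "\<dots> = (\<integral>\<^sup>+\<theta>. h (cis \<theta>) * indicator {p..2*pi} \<theta> + h (cis \<theta>) * indicator {2*pi<..p+2*pi} \<theta> \<partial>lborel)"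
    using p by (intro nn_integral_cong) (auto split: split_indicator)
  also have "\<dots> = (\<integral>\<^sup>+\<theta>. h (cis \<theta>) * indicator {p..2*pi} \<theta> \<partial>lborel)
     + (\<integral>\<^sup>+\<theta>. h (cis \<theta>) * indicator {2*pi<..p+2*pi} \<theta> \<partial>lborel)"
    by (rule nn_integral_add) auto
  also have "(\<integral>\<^sup>+\<theta>. h (cis \<theta>) * indicator {2*pi<..p+2*pi} \<theta> \<partial>lborel)
     = (\<integral>\<^sup>+\<theta>. h (cis (2*pi+\<theta>)) * indicator {2*pi<..p+2*pi} (2*pi+\<theta>) \<partial>lborel)"
    by (rule nn_integral_lborel_translate[where f="\<lambda>\<theta>. h (cis \<theta>) * indicator {2*pi<..p+2*pi} \<theta>", symmetric]) measurable
  also have "\<dots> = (\<integral>\<^sup>+\<theta>. h (cis \<theta>) * indicator {0<..p} \<theta> \<partial>lborel)"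
    using cp by (intro nn_integral_cong) (auto simp: add.commute split: split_indicator)
  also have "\<dots> = (\<integral>\<^sup>+\<theta>. h (cis \<theta>) * indicator {0..<p} \<theta> \<partial>lborel)"
  proof (rule nn_integral_cong_AE)
    have "AE \<theta> in lborel. \<theta> \<noteq> (0::real)" "AE \<theta> in lborel. \<theta> \<noteq> p"
      by (simp_all add: AE_lborel_singleton)
    then show "AE \<theta> in lborel. h (cis \<theta>) * indicator {0<..p} \<theta> = h (cis \<theta>) * indicator {0..<p} \<theta>"
      by eventually_elim (auto split: split_indicator)
  qed
  also have "(\<integral>\<^sup>+\<theta>. h (cis \<theta>) * indicator {p..2*pi} \<theta> \<partial>lborel) + (\<integral>\<^sup>+\<theta>. h (cis \<theta>) * indicator {0..<p} \<theta> \<partial>lborel)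
     = (\<integral>\<^sup>+\<theta>. h (cis \<theta>) * indicator {p..2*pi} \<theta> + h (cis \<theta>) * indicator {0..<p} \<theta> \<partial>lborel)"
    by (rule nn_integral_add[symmetric]) auto
  also have "\<dots> = (\<integral>\<^sup>+\<theta>. h (cis \<theta>) * indicator {0..2*pi} \<theta> \<partial>lborel)"
    using p by (intro nn_integral_cong) (auto split: split_indicator)
  finally show ?thesis
    by (simp add: nn_integral_circ)
qed

lemma sigma_finite_circ: "sigma_finite_measure circ"
  by (intro finite_measure.axioms(1) finite_measure_circ)

lemma circ_Tonelli:
  assumes "sigma_finite_measure M"
  assumes f[measurable]: "case_prod f \<in> borel_measurable (borel \<Otimes>\<^sub>M M)"
  shows "(\<integral>\<^sup>+\<theta>. (\<integral>\<^sup>+y. f \<theta> y \<partial>M) \<partial>circ) = (\<integral>\<^sup>+y. (\<integral>\<^sup>+\<theta>. f \<theta> y \<partial>circ) \<partial>M)"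
proof -
  interpret pair_sigma_finite circ M
    by (intro pair_sigma_finite.intro sigma_finite_circ assms)
  have eq: "sets (circ \<Otimes>\<^sub>M M) = sets (borel \<Otimes>\<^sub>M M)"
    by (intro sets_pair_measure_cong) auto
  show ?thesis
    by (rule Fubini'[symmetric]) (use f measurable_cong_sets[OF eq refl] in blast)
qed

lemma circ_integral_of_has_integral:
  fixes f :: "real \<Rightarrow> real"
  assumes f: "continuous_on UNIV f" and I: "(f has_integral I) {0..2*pi}"
  shows "integrable circ f" and "(\<integral>\<theta>. f \<theta> \<partial>circ) = I / (2 * pi)"
proof -
  have ce: "continuous_on {0..2*pi} f" using f continuous_on_subset by blast
  have [measurable]: "f \<in> borel_measurable borel" by (rule borel_measurable_continuous_onI[OF f])
  have si: "set_integrable lborel {0..2*pi} f"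
    by (rule borel_integrable_atLeastAtMost') (rule ce)
  have val: "(LINT t:{0..2*pi}|lborel. f t) = I"
    using set_borel_integral_eq_integral(2)[OF si] I by (simp add: integral_unique)
  have ud: "circ = density lborel (\<lambda>x. ennreal (indicator {0..2*pi} x / (2 * pi)))"
    unfolding uniform_measure_def
    by (intro density_cong) (auto split: split_indicator simp: divide_ennreal ennreal_1[symmetric] simp del: ennreal_1)
  have int1: "integrable lborel (\<lambda>x. (indicator {0..2*pi} x / (2 * pi)) *\<^sub>R f x)"
  proof -
    have "integrable lborel (\<lambda>x. (1 / (2 * pi)) *\<^sub>R (indicator {0..2*pi} x *\<^sub>R f x))"
      using si unfolding set_integrable_def by (intro integrable_scaleR_right)
    then show ?thesis by simp
  qed
  show "integrable circ f"
    unfolding ud by (subst integrable_density) (use int1 in auto)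
  have "(\<integral>\<theta>. f \<theta> \<partial>circ) = (\<integral>x. (indicator {0..2*pi} x / (2 * pi)) *\<^sub>R f x \<partial>lborel)"
    unfolding ud by (subst integral_density) auto
  also have "\<dots> = (1 / (2*pi)) * (LINT t:{0..2*pi}|lborel. f t)"
    unfolding set_lebesgue_integral_def by (subst integral_mult_right_zero[symmetric]) simp
  finally show "(\<integral>\<theta>. f \<theta> \<partial>circ) = I / (2 * pi)"
    by (simp add: val)
qed

text \<open>
  After division by \<open>a\<close> this is the mean value property, on the unit circle, of the real part of the
  holomorphic function \<open>Ln (1 + w z)\<close> with \<open>w = b / a\<close>.
\<close>

lemma log_mean_value:
  fixes a b :: complex
  assumes "cmod b < cmod a"
  shows "integrable circ (\<lambda>\<theta>. ln (cmod (a + cis \<theta> * b)))"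
    and "(\<integral>\<theta>. ln (cmod (a + cis \<theta> * b)) \<partial>circ) = ln (cmod a)"
proof -
  define w where "w = b / a"
  have a: "a \<noteq> 0" using assms by auto
  have w: "cmod w < 1" using assms a by (simp add: w_def norm_divide)
  have nz: "1 + w * z \<noteq> 0" "1 + w * z \<notin> \<real>\<^sub>\<le>\<^sub>0" if "cmod z \<le> 1" for z
  proof -
    have "cmod (w * z) < 1" 
      using w that mult_right_le_one_le[of "cmod w" "cmod z"] by (auto simp: norm_mult)
    then have "Re (w * z) > -1" using abs_Re_le_cmod[of "w * z"] by linarith
    then have "Re (1 + w * z) > 0" by simp
    then show "1 + w * z \<noteq> 0" "1 + w * z \<notin> \<real>\<^sub>\<le>\<^sub>0"
      by (metis less_irrefl zero_complex.sel(1), metis complex_nonpos_Reals_iff not_le)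
  qed
  define g where "g z = Ln (1 + w * z)" for z
  have hol: "g holomorphic_on ball 0 1"
    unfolding g_def using nz by (intro holomorphic_intros) auto
  have cont: "continuous_on (cball 0 1) g"
    unfolding g_def using nz by (intro continuous_intros) auto
  have "((\<lambda>u. g u / (u - 0)) has_contour_integral 2 * of_real pi * \<i> * g 0) (circlepath 0 1)"
    by (rule Cauchy_integral_circlepath[OF cont hol]) auto
  then have "((\<lambda>t. g (0 + complex_of_real 1 * cis t) / (0 + complex_of_real 1 * cis t - 0) * complex_of_real 1 * \<i> * cis t) has_integral 0) {0..2*pi}"
    unfolding circlepath_def by (subst (asm) has_contour_integral_part_circlepath_iff) (auto simp: g_def)
  then have "((\<lambda>t. \<i> * g (cis t)) has_integral 0) {0..2*pi}"
    by (simp add: mult_ac)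
  from has_integral_mult_right[OF this, of "- \<i>"]
  have "((\<lambda>t. g (cis t)) has_integral 0) {0..2*pi}" by (simp add: mult.assoc[symmetric])
  from has_integral_Re[OF this]
  have "((\<lambda>t. Re (g (cis t))) has_integral 0) {0..2*pi}" by simp
  then have hi: "((\<lambda>t. ln (cmod (1 + w * cis t))) has_integral 0) {0..2*pi}"
    using nz by (simp add: g_def Re_Ln)
  have le: "ln (cmod (a + cis t * b)) = ln (cmod a) + ln (cmod (1 + w * cis t))" for t
  proof -
    have "a + cis t * b = a * (1 + w * cis t)" using a by (simp add: w_def field_simps)
    then show ?thesis using a nz[of "cis t"] by (simp add: norm_mult ln_mult)
  qed
  have hi2: "((\<lambda>t. ln (cmod (a + cis t * b))) has_integral (2 * pi * ln (cmod a) + 0)) {0..2*pi}"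
    unfolding le using has_integral_add[OF has_integral_const_real hi, of "ln (cmod a)"] by simp
  have nz2: "a + cis t * b \<noteq> 0" for t
    using assms by (metis add_eq_0_iff2 norm_cis norm_minus_cancel norm_mult mult_1 less_irrefl)
  have ce: "continuous_on UNIV (\<lambda>t. ln (cmod (a + cis t * b)))"
    using nz2 by (intro continuous_intros) auto
  show "integrable circ (\<lambda>\<theta>. ln (cmod (a + cis \<theta> * b)))"
    "(\<integral>\<theta>. ln (cmod (a + cis \<theta> * b)) \<partial>circ) = ln (cmod a)"
    using circ_integral_of_has_integral[OF ce hi2] by auto
qed

lemma log_mean_value_nn:
  fixes a b :: complex
  assumes "cmod b < cmod a" and "\<And>\<theta>. 0 \<le> K + B * ln (cmod (a + cis \<theta> * b))"
  shows "(\<integral>\<^sup>+\<theta>. ennreal (K + B * ln (cmod (a + cis \<theta> * b))) \<partial>circ) = ennreal (K + B * ln (cmod a))"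
proof -
  interpret finite_measure circ by (rule finite_measure_circ)
  note l = log_mean_value[OF assms(1)]
  have i: "integrable circ (\<lambda>\<theta>. K + B * ln (cmod (a + cis \<theta> * b)))"
    using l(1) by simp
  have "measure circ UNIV = 1" using prob_space_circ by (simp add: measure_def)
  then show ?thesis
    using assms(2) l by (subst nn_integral_eq_integral[OF i]) (auto simp: space_uniform_measure)
qed

section \<open>The minimum principle for radial functions\<close>

text \<open>
  For functions with an upper bound \<open>B\<close>, the difference of two integrals becomes one integral of the
  nonnegative function \<open>B - f\<close>. In this form Tonelli's theorem and Fatou's lemma apply to
  subharmonic functions without any integrability hypothesis.
\<close>

lemma ereal_integral_bounded_above:
  assumes M: "emeasure M (space M) = 1"
    and f[measurable]: "f \<in> borel_measurable M" and B: "\<And>x. f x \<le> ereal B"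
  shows "ereal_integral M f = ereal B - enn2ereal (\<integral>\<^sup>+x. e2ennreal (ereal B - f x) \<partial>M)"
proof -
  have pw: "e2ennreal (ereal B - y) + (e2ennreal y + ennreal (- B)) = e2ennreal (- y) + ennreal B"
    if "y \<le> ereal B" for y
  proof (cases y)
    case (real r)
    have m: "ennreal t = ennreal (max 0 t)" for t by (simp add: max_def ennreal_neg)
    have "ennreal (B - r) + (ennreal r + ennreal (-B)) = ennreal (-r) + ennreal B"
      using that real by (subst (1 2 3 4 5) m) (simp add: max_def flip: ennreal_plus)
    then show ?thesis using real by simp
  next
    case PInf then show ?thesis using that by simp
  next
    case MInf
    have "e2ennreal \<infinity> = top" by (simp add: e2ennreal_infty)
    then show ?thesis using MInf by simp
  qed
  define P where "P = (\<integral>\<^sup>+x. e2ennreal (f x) \<partial>M)"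
  define N where "N = (\<integral>\<^sup>+x. e2ennreal (- f x) \<partial>M)"
  define X where "X = (\<integral>\<^sup>+x. e2ennreal (ereal B - f x) \<partial>M)"
  have "(\<integral>\<^sup>+x. e2ennreal (ereal B - f x) + (e2ennreal (f x) + ennreal (- B)) \<partial>M)
     = (\<integral>\<^sup>+x. e2ennreal (- f x) + ennreal B \<partial>M)"
    by (intro nn_integral_cong pw B)
  then have *: "X + (P + ennreal (- B)) = N + ennreal B"
    by (simp add: nn_integral_add M X_def P_def N_def)
  have "P \<le> (\<integral>\<^sup>+x. ennreal B \<partial>M)"
    unfolding P_def using B by (intro nn_integral_mono) (metis e2ennreal_ereal e2ennreal_mono)
  then have "P \<le> ennreal B" by (simp add: M)
  then have "P < top" by (rule le_less_trans) simp
  then obtain p where p: "P = ennreal p" "0 \<le> p" by (cases P) auto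
  have "enn2ereal P - enn2ereal N = ereal B - enn2ereal X"
  proof (cases "X = top")
    case True
    then have "N + ennreal B = top" using * by simp
    then have "N = top" by simp
    moreover have "enn2ereal \<infinity> = \<infinity>" by (simp add: top_ereal_def)
    ultimately show ?thesis using True p by simp
  next
    case False
    then obtain x where x: "X = ennreal x" "0 \<le> x" by (cases X) auto
    have "N \<noteq> top"
    proof
      assume "N = top"
      then have "ennreal x + (ennreal p + ennreal (- B)) = top" using * x p by simp
      then show False by simp
    qed
    then obtain n where n: "N = ennreal n" "0 \<le> n" by (cases N) auto
    have "x + p + max 0 (- B) = n + max 0 B"
    proof -
      have m: "ennreal t = ennreal (max 0 t)" for t by (simp add: max_def ennreal_neg)
      have "ennreal (x + p + max 0 (- B)) = ennreal (n + max 0 B)"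
        using * x p n unfolding m[of B] m[of "-B"] by (simp add: add.assoc flip: ennreal_plus)
      then show ?thesis using x p n by (subst (asm) ennreal_inj) auto
    qed
    then show ?thesis using x p n by (auto simp: enn2ereal_ennreal max_def split: if_splits)
  qed
  then show ?thesis unfolding ereal_integral_def P_def N_def X_def .
qed

lemma lsc_liminf:
  fixes f :: "'a::topological_space \<Rightarrow> ennreal"
  assumes "\<And>c. open {z. f z > c}" and "X \<longlonglongrightarrow> x"
  shows "f x \<le> liminf (\<lambda>n. f (X n))"
  unfolding le_Liminf_iff
proof (intro allI impI)
  fix y assume "y < f x"
  then show "\<forall>\<^sub>F n in sequentially. y < f (X n)"
    using topological_tendstoD[OF assms(2) assms(1)[of y]] by simp
qed

lemma ennreal_liminf_add:
  fixes f g :: "nat \<Rightarrow> ennreal"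
  shows "liminf f + liminf g \<le> liminf (\<lambda>n. f n + g n)"
proof -
  have "liminf f + liminf g = (SUP n. (INF m\<in>{n..}. f m) + (INF m\<in>{n..}. g m))"
    unfolding liminf_SUP_INF
    by (intro ennreal_SUP_add[symmetric]) (auto intro!: incseq_SucI INF_superset_mono)
  also have "\<dots> \<le> liminf (\<lambda>n. f n + g n)"
    unfolding liminf_SUP_INF
    by (intro SUP_mono' INF_greatest add_mono INF_lower) auto
  finally show ?thesis .
qed

text \<open>
  A lower semicontinuous \<open>H\<close> attains its minimum. If this is below the boundary values, consider the
  largest radius \<open>s\<close> at which it is attained: a circle about a point of modulus \<open>s\<close> has half of its
  points at larger moduli, where \<open>H\<close> exceeds the minimum, and this contradicts the mean value
  inequality at \<open>s\<close>.
\<close>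

lemma radial_min_principle:
  fixes H :: "real \<Rightarrow> ennreal"
  assumes [measurable]: "H \<in> borel_measurable borel" and r: "0 < r1" "r1 \<le> r" "r \<le> r2"
    and lsc: "\<And>x X. (\<And>n. X n \<in> {r1..r2}) \<Longrightarrow> X \<longlonglongrightarrow> x \<Longrightarrow> H x \<le> liminf (\<lambda>n::nat. H (X n))"
    and mean: "\<And>s e. 0 < e \<Longrightarrow> r1 \<le> s - e \<Longrightarrow> s + e \<le> r2 \<Longrightarrow>
        (\<integral>\<^sup>+\<theta>. H (cmod (of_real s + cis \<theta> * of_real e)) \<partial>circ) \<le> H s"
    and K: "K \<le> H r1" "K \<le> H r2"
  shows "K \<le> H r"
proof (rule ccontr)
  assume "\<not> K \<le> H r"
  define \<mu> where "\<mu> = (INF x\<in>{r1..r2}. H x)"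
  have muH: "\<mu> \<le> H x" if "x \<in> {r1..r2}" for x
    unfolding \<mu>_def using that by (rule INF_lower)
  have muK: "\<mu> < K"
    using muH[of r] r \<open>\<not> K \<le> H r\<close> by auto
  have clsd: "closed {x\<in>{r1..r2}. H x \<le> t}" for t
    unfolding closed_sequential_limits
  proof (intro allI impI, elim conjE)
    fix X x assume X: "\<forall>n. X n \<in> {x \<in> {r1..r2}. H x \<le> t}" "X \<longlonglongrightarrow> x"
    have "x \<in> {r1..r2}"
      by (rule closed_sequentially[OF closed_real_atLeastAtMost _ X(2)]) (use X(1) in blast)
    moreover have "H x \<le> liminf (\<lambda>n. H (X n))" using X by (intro lsc) auto
    moreover have "liminf (\<lambda>n. H (X n)) \<le> t"
      using X by (intro Liminf_le) auto
    ultimately show "x \<in> {x \<in> {r1..r2}. H x \<le> t}" by auto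
  qed
  have "{r1..r2} \<inter> (\<Inter>t\<in>{\<mu><..}. {x\<in>{r1..r2}. H x \<le> t}) \<noteq> {}"
  proof (rule compact_imp_fip_image[OF compact_Icc clsd])
    fix I' assume I': "finite I'" "I' \<subseteq> {\<mu><..}"
    show "{r1..r2} \<inter> (\<Inter>t\<in>I'. {x\<in>{r1..r2}. H x \<le> t}) \<noteq> {}"
    proof (cases "I' = {}")
      case True then show ?thesis using r by auto
    next
      case False
      then have "\<mu> < Min I'" using I' by auto
      then obtain x where x: "x \<in> {r1..r2}" "H x < Min I'"
        unfolding \<mu>_def INF_less_iff by auto
      have "H x \<le> t" if "t \<in> I'" for t
        using x(2) Min_le[OF I'(1) that] by auto
      then show ?thesis using x(1) by auto
    qed
  qed
  then obtain x0 where "x0 \<in> {r1..r2} \<inter> (\<Inter>t\<in>{\<mu><..}. {x\<in>{r1..r2}. H x \<le> t})" by blast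
  then have x0: "x0 \<in> {r1..r2}" "\<And>t. \<mu> < t \<Longrightarrow> H x0 \<le> t" by auto
  then have "H x0 \<le> \<mu>" using dense_ge by blast
  define S where "S = {x\<in>{r1..r2}. H x \<le> \<mu>}"
  have cS: "compact S"
  proof -
    have "S = {r1..r2} \<inter> S" by (auto simp: S_def)
    then show ?thesis
      using compact_Int_closed[OF compact_Icc, of S r1 r2] clsd[of \<mu>] by (simp add: S_def)
  qed
  have "S \<noteq> {}" using x0 \<open>H x0 \<le> \<mu>\<close> by (auto simp: S_def)
  \<comment> \<open>the outermost minimum: beyond it \<open>H\<close> is strictly larger\<close>
  obtain s where s: "s \<in> S" "\<And>t. t \<in> S \<Longrightarrow> t \<le> s"
    using compact_attains_sup[OF cS \<open>S \<noteq> {}\<close>] by auto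
  have Hs: "H s = \<mu>" using s(1) muH[of s] by (auto simp: S_def)
  have "r1 < s" "s < r2"
    using s(1) Hs muK K by (auto simp: S_def less_le)
  define e where "e = min (s - r1) (r2 - s)"
  have e: "0 < e" "r1 \<le> s - e" "s + e \<le> r2"
    using \<open>r1 < s\<close> \<open>s < r2\<close> by (auto simp: e_def)
  define q where "q \<theta> = cmod (of_real s + cis \<theta> * of_real e)" for \<theta>
  have [measurable]: "q \<in> borel_measurable borel" unfolding q_def by measurable
  have "e < s" using e r by linarith
  have q: "q \<theta> \<in> {r1..r2}" for \<theta>
  proof -
    have n: "cmod (cis \<theta> * of_real e) = e" using e by (simp add: norm_mult)
    have "q \<theta> \<le> s + e" unfolding q_def
      using norm_triangle_ineq[of "of_real s" "cis \<theta> * of_real e"] n \<open>e < s\<close> e by simp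
    moreover have "s - e \<le> q \<theta>" unfolding q_def
      using norm_diff_ineq[of "of_real s" "cis \<theta> * of_real e"] n \<open>e < s\<close> e by simp
    ultimately show ?thesis using e by simp
  qed
  have "(\<integral>\<^sup>+\<theta>. H (q \<theta>) \<partial>circ) \<le> \<mu>"
    using mean[OF e] Hs by (simp add: q_def)
  moreover have "\<mu> \<noteq> \<infinity>" using muK by auto
  moreover have "(\<integral>\<^sup>+\<theta>. H (q \<theta>) - \<mu> \<partial>circ) = (\<integral>\<^sup>+\<theta>. H (q \<theta>) \<partial>circ) - (\<integral>\<^sup>+\<theta>. \<mu> \<partial>circ)"
    using \<open>\<mu> \<noteq> \<infinity>\<close> muH q by (intro nn_integral_diff) auto
  ultimately have "(\<integral>\<^sup>+\<theta>. H (q \<theta>) - \<mu> \<partial>circ) = 0"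
    by (auto simp: diff_eq_0_iff_ennreal top.not_eq_extremum)
  then have "AE \<theta> in circ. H (q \<theta>) - \<mu> = 0"
    by (subst (asm) nn_integral_0_iff_AE) auto
  moreover have "H (q \<theta>) - \<mu> \<noteq> 0" if "\<theta> \<in> {0..pi/2}" for \<theta>
  proof -
    have c: "0 \<le> cos \<theta>" using that by (intro cos_ge_zero) auto
    have "(q \<theta>)\<^sup>2 = (s + e * cos \<theta>)\<^sup>2 + (e * sin \<theta>)\<^sup>2"
      unfolding q_def cmod_power2 by (simp add: mult.commute)
    also have "\<dots> = s\<^sup>2 + 2 * s * e * cos \<theta> + e\<^sup>2 * ((sin \<theta>)\<^sup>2 + (cos \<theta>)\<^sup>2)"
      by algebra
    also have "\<dots> > s\<^sup>2" using c e \<open>e < s\<close> by (simp add: add_nonneg_pos)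
    finally have "q \<theta> > s" using power2_less_imp_less[of s "q \<theta>"] q[of \<theta>] r by auto
    then have "q \<theta> \<notin> S" using s(2) by force
    then have "\<not> H (q \<theta>) \<le> \<mu>" using q[of \<theta>] by (auto simp: S_def)
    then have "0 < H (q \<theta>) - \<mu>" by (intro diff_gr0_ennreal) auto
    then show ?thesis by simp
  qed
  ultimately have "AE \<theta> in circ. \<theta> \<notin> {0..pi/2}"
    by (auto elim: eventually_mono)
  moreover have "{\<theta> \<in> space circ. \<not> \<theta> \<notin> {0..pi/2}} = {0..pi/2}"
    by (simp only: space_uniform_measure space_lborel space_borel) blast
  ultimately have "emeasure circ {0..pi/2} = 0"
    using AE_iff_measurable[of "{0..pi/2}" circ "\<lambda>\<theta>. \<theta> \<notin> {0..pi/2}"] by simp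
  moreover have "emeasure circ {0..pi/2} = ennreal (pi/2) / ennreal (2*pi)"
  proof -
    have "{0..2*pi} \<inter> {0..pi/2} = {0..pi/2}" by auto
    then show ?thesis by (subst emeasure_uniform_measure) (auto simp del: Int_atLeastAtMost)
  qed
  ultimately show False
    by (simp add: divide_ennreal)
qed

section \<open>Three circles and a Harnack inequality\<close>

lemma lsc_borel_measurable:
  fixes f :: "'a::topological_space \<Rightarrow> ennreal"
  assumes "\<And>c. open {z. f z > c}"
  shows "f \<in> borel_measurable borel"
  using assms by (intro borel_measurableI_greater) auto

lemma ennreal_mult_le_cancel_right:
  assumes "0 < t" "x * ennreal t \<le> y * ennreal t"
  shows "x \<le> y"
proof -
  have "ennreal t \<noteq> 0" using assms(1) by simp
  then show ?thesis
    using divide_right_mono_ennreal[OF assms(2), of "ennreal t"]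
    by (subst (asm) (1 2) mult_divide_eq_ennreal) auto
qed

lemma ball_borel [measurable]: "ball (a :: 'a::metric_space) r \<in> sets borel"
  by simp

lemma borel_measurable_nn_integral_circ [measurable (raw)]:
  assumes "case_prod f \<in> borel_measurable (N \<Otimes>\<^sub>M borel)"
  shows "(\<lambda>x. \<integral>\<^sup>+\<theta>. f x \<theta> \<partial>circ) \<in> borel_measurable N"
proof -
  interpret sigma_finite_measure circ by (rule sigma_finite_circ)
  have "sets (N \<Otimes>\<^sub>M circ) = sets (N \<Otimes>\<^sub>M borel)"
    by (intro sets_pair_measure_cong) auto
  then show ?thesis
    using assms by (intro borel_measurable_nn_integral) (simp cong: measurable_cong_sets)
qed

lemma circ_mean_lsc:
  fixes f :: "complex \<Rightarrow> ennreal"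
  assumes lsc: "\<And>c. open {z. f z > c}" and X: "X \<longlonglongrightarrow> x"
  shows "(\<integral>\<^sup>+\<theta>. f (cis \<theta> * of_real x) \<partial>circ) \<le> liminf (\<lambda>n. \<integral>\<^sup>+\<theta>. f (cis \<theta> * of_real (X n)) \<partial>circ)"
proof -
  have [measurable]: "f \<in> borel_measurable borel" by (rule lsc_borel_measurable[OF lsc])
  have "(\<integral>\<^sup>+\<theta>. f (cis \<theta> * of_real x) \<partial>circ)
      \<le> (\<integral>\<^sup>+\<theta>. liminf (\<lambda>n. f (cis \<theta> * of_real (X n))) \<partial>circ)"
    by (intro nn_integral_mono lsc_liminf lsc tendsto_intros X)
  also have "\<dots> \<le> liminf (\<lambda>n. \<integral>\<^sup>+\<theta>. f (cis \<theta> * of_real (X n)) \<partial>circ)"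
    by (intro nn_integral_liminf) measurable
  finally show ?thesis .
qed

lemma circ_mean_norm:
  assumes [measurable]: "f \<in> borel_measurable borel"
  shows "(\<integral>\<^sup>+\<theta>. f (cis \<theta> * c) \<partial>circ) = (\<integral>\<^sup>+\<theta>. f (cis \<theta> * of_real (cmod c)) \<partial>circ)"
proof (cases "c = 0")
  case False
  have eq: "of_real (cmod c) * (sgn c * z) = z * c" for z
    using False by (simp add: sgn_eq field_simps)
  have "(\<integral>\<^sup>+\<theta>. f (of_real (cmod c) * (sgn c * cis \<theta>)) \<partial>circ) = (\<integral>\<^sup>+\<theta>. f (of_real (cmod c) * cis \<theta>) \<partial>circ)"
    by (rule nn_integral_circ_rotate[where h = "\<lambda>z. f (of_real (cmod c) * z)"])
       (use False in \<open>auto simp: norm_sgn\<close>)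
  then show ?thesis unfolding eq by (simp only: mult.commute[of "complex_of_real (cmod c)"])
qed simp

text \<open>
  Hadamard's three circles theorem for superharmonic functions. The circle mean is again
  superharmonic as a function of the radius vector, and \<open>ln |z|\<close> is harmonic, so comparison with
  \<open>A + B ln r\<close> is an instance of the minimum principle. The constant \<open>K\<close> of the proof keeps all
  functions nonnegative.
\<close>

lemma circle_concave:
  fixes f :: "complex \<Rightarrow> ennreal"
  assumes lsc: "\<And>c. open {z. f z > c}"
    and mean: "\<And>a b. cmod a + cmod b \<le> R \<Longrightarrow> (\<integral>\<^sup>+\<theta>. f (a + cis \<theta> * b) \<partial>circ) \<le> f a"
    and r: "0 < r1" "r1 \<le> r" "r \<le> r2" "r2 \<le> R"
    and e1: "ennreal (A + B * ln r1) \<le> (\<integral>\<^sup>+\<theta>. f (cis \<theta> * of_real r1) \<partial>circ)"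
    and e2: "ennreal (A + B * ln r2) \<le> (\<integral>\<^sup>+\<theta>. f (cis \<theta> * of_real r2) \<partial>circ)"
  shows "ennreal (A + B * ln r) \<le> (\<integral>\<^sup>+\<theta>. f (cis \<theta> * of_real r) \<partial>circ)"
proof -
  have [measurable]: "f \<in> borel_measurable borel" by (rule lsc_borel_measurable[OF lsc])
  define N where "N r = (\<integral>\<^sup>+\<theta>. f (cis \<theta> * of_real r) \<partial>circ)" for r
  have N[measurable]: "N \<in> borel_measurable borel"
    unfolding N_def by measurable
  \<comment> \<open>an upper bound of \<open>A + B * ln x\<close> on the whole interval\<close>
  define K where "K = \<bar>A\<bar> + \<bar>B\<bar> * (\<bar>ln r1\<bar> + \<bar>ln r2\<bar>)"
  have K0: "0 \<le> K" by (simp add: K_def)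
  have Kx: "0 \<le> K - A - B * ln x" if "r1 \<le> x" "x \<le> r2" for x
  proof -
    have "ln r1 \<le> ln x" "ln x \<le> ln r2" using that r by auto
    then have "\<bar>ln x\<bar> \<le> \<bar>ln r1\<bar> + \<bar>ln r2\<bar>" by linarith
    then have "\<bar>B * ln x\<bar> \<le> \<bar>B\<bar> * (\<bar>ln r1\<bar> + \<bar>ln r2\<bar>)"
      unfolding abs_mult by (intro mult_left_mono) auto
    then show ?thesis unfolding K_def by linarith
  qed
  define H where "H x = N x + ennreal (K - A - B * ln x)" for x
  have [measurable]: "H \<in> borel_measurable borel" unfolding H_def by measurable
  have endp: "ennreal K \<le> H x" if x: "r1 \<le> x" "x \<le> r2" and "ennreal (A + B * ln x) \<le> N x" for x
  proof -
    have "ennreal K \<le> ennreal (A + B * ln x) + ennreal (K - A - B * ln x)"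
    proof (cases "0 \<le> A + B * ln x")
      case True
      then show ?thesis using Kx[OF x] by (simp flip: ennreal_plus)
    next
      case False
      then show ?thesis by (intro order_trans[OF _ add_increasing]) (auto intro!: ennreal_leI)
    qed
    also have "\<dots> \<le> H x" unfolding H_def by (intro add_right_mono that)
    finally show ?thesis .
  qed
  have "ennreal K \<le> H r"
  proof (rule radial_min_principle[OF _ r(1-3)])
    fix x X assume X: "\<And>n. X n \<in> {r1..r2}" "X \<longlonglongrightarrow> x"
    have "x \<in> {r1..r2}"
      by (rule closed_sequentially[OF closed_real_atLeastAtMost _ X(2)]) (use X(1) in blast)
    then have x0: "x > 0" using r by auto
    have t: "(\<lambda>n. ennreal (K - A - B * ln (X n))) \<longlonglongrightarrow> ennreal (K - A - B * ln x)"
      using X(2) x0 by (intro tendsto_intros tendsto_ennrealI) auto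
    have "H x \<le> liminf (\<lambda>n. N (X n)) + liminf (\<lambda>n. ennreal (K - A - B * ln (X n)))"
      unfolding H_def lim_imp_Liminf[OF sequentially_bot t] N_def
      by (intro add_right_mono circ_mean_lsc lsc X(2))
    also have "\<dots> \<le> liminf (\<lambda>n. H (X n))"
      unfolding H_def by (rule ennreal_liminf_add)
    finally show "H x \<le> liminf (\<lambda>n. H (X n))" .
  next
    fix s e assume se: "0 < e" "r1 \<le> s - e" "s + e \<le> r2"
    have "s > e" using se r by linarith
    define c where "c \<phi> = of_real s + cis \<phi> * of_real e" for \<phi>
    have [measurable]: "c \<in> borel_measurable borel" unfolding c_def by measurable
    have c: "cmod (c \<phi>) \<in> {r1..r2}" for \<phi>
    proof -
      have n: "cmod (cis \<phi> * of_real e) = e" using se by (simp add: norm_mult)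
      have "cmod (c \<phi>) \<le> s + e" unfolding c_def
        using norm_triangle_ineq[of "of_real s" "cis \<phi> * of_real e"] n \<open>e < s\<close> se by simp
      moreover have "s - e \<le> cmod (c \<phi>)" unfolding c_def
        using norm_diff_ineq[of "of_real s" "cis \<phi> * of_real e"] n \<open>e < s\<close> se by simp
      ultimately show ?thesis using se by simp
    qed
    have "(\<integral>\<^sup>+\<phi>. N (cmod (c \<phi>)) \<partial>circ) = (\<integral>\<^sup>+\<phi>. (\<integral>\<^sup>+\<theta>. f (cis \<theta> * c \<phi>) \<partial>circ) \<partial>circ)"
      unfolding N_def by (intro nn_integral_cong circ_mean_norm[symmetric]) measurable
    also have "\<dots> = (\<integral>\<^sup>+\<theta>. (\<integral>\<^sup>+\<phi>. f (cis \<theta> * c \<phi>) \<partial>circ) \<partial>circ)"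
      by (rule circ_Tonelli[OF sigma_finite_circ]) (simp cong: measurable_cong_sets)
    also have "\<dots> = (\<integral>\<^sup>+\<theta>. (\<integral>\<^sup>+\<phi>. f (cis \<theta> * of_real s + cis \<phi> * (cis \<theta> * of_real e)) \<partial>circ) \<partial>circ)"
      by (simp add: c_def algebra_simps)
    also have "\<dots> \<le> N s"
      unfolding N_def using se \<open>e < s\<close> r by (intro nn_integral_mono mean) (auto simp: norm_mult)
    finally have 1: "(\<integral>\<^sup>+\<phi>. N (cmod (c \<phi>)) \<partial>circ) \<le> N s" .
    have "(\<integral>\<^sup>+\<phi>. ennreal ((K - A) + (- B) * ln (cmod (of_real s + cis \<phi> * of_real e))) \<partial>circ)
       = ennreal ((K - A) + (- B) * ln (cmod (of_real s)))"
    proof (rule log_mean_value_nn)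
      show "cmod (of_real e) < cmod (of_real s)" using se \<open>e < s\<close> by simp
      show "0 \<le> (K - A) + (- B) * ln (cmod (of_real s + cis \<phi> * of_real e))" for \<phi>
        using Kx[of "cmod (c \<phi>)"] c[of \<phi>] by (simp add: c_def)
    qed
    then have 2: "(\<integral>\<^sup>+\<phi>. ennreal (K - A - B * ln (cmod (c \<phi>))) \<partial>circ) = ennreal (K - A - B * ln s)"
      using se \<open>e < s\<close> by (simp add: c_def)
    have "(\<integral>\<^sup>+\<phi>. H (cmod (c \<phi>)) \<partial>circ) \<le> H s"
      unfolding H_def by (subst nn_integral_add) (use 1 2 in auto)
    then show "(\<integral>\<^sup>+\<theta>. H (cmod (of_real s + cis \<theta> * of_real e)) \<partial>circ) \<le> H s"
      by (simp add: c_def)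
  next
    show "ennreal K \<le> H r1" "ennreal K \<le> H r2"
      using endp r e1 e2 by (auto simp: N_def)
  qed simp
  then have *: "ennreal K \<le> N r + ennreal (K - A - B * ln r)" by (simp add: H_def)
  show ?thesis
  proof (cases "N r")
    case (real n)
    then have "K \<le> n + (K - A - B * ln r)"
      using * Kx[of r] r by (simp flip: ennreal_plus)
    then show ?thesis using real by (simp add: N_def[symmetric] ennreal_leI)
  qed (simp add: N_def)
qed

lemma nn_integral_circ_average_complex:
  fixes h :: "complex \<Rightarrow> ennreal"
  assumes [measurable]: "h \<in> borel_measurable borel"
  shows "(\<integral>\<^sup>+x. h x \<partial>lborel) = (\<integral>\<^sup>+x. (\<integral>\<^sup>+\<theta>. h (cis \<theta> * x) \<partial>circ) \<partial>lborel)"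
proof -
  have "(\<integral>\<^sup>+x. h x \<partial>lborel) = (\<integral>\<^sup>+\<theta>. (\<integral>\<^sup>+x. h (cis \<theta> * x) \<partial>lborel) \<partial>circ)"
    by (simp add: nn_integral_lborel_cis_complex)
  also have "\<dots> = (\<integral>\<^sup>+x. (\<integral>\<^sup>+\<theta>. h (cis \<theta> * x) \<partial>circ) \<partial>lborel)"
    by (rule circ_Tonelli[OF sigma_finite_lborel]) measurable
  finally show ?thesis .
qed

lemma nn_integral_circ_average:
  fixes h :: "complex ^ 'n::finite \<Rightarrow> ennreal"
  assumes [measurable]: "h \<in> borel_measurable borel"
  shows "(\<integral>\<^sup>+x. h x \<partial>lborel) = (\<integral>\<^sup>+x. (\<integral>\<^sup>+\<theta>. h (cis \<theta> *s x) \<partial>circ) \<partial>lborel)"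
proof -
  have "(\<integral>\<^sup>+x. h x \<partial>lborel) = (\<integral>\<^sup>+\<theta>. (\<integral>\<^sup>+x. h (cis \<theta> *s x) \<partial>lborel) \<partial>circ)"
    by (simp add: nn_integral_lborel_cis)
  also have "\<dots> = (\<integral>\<^sup>+x. (\<integral>\<^sup>+\<theta>. h (cis \<theta> *s x) \<partial>circ) \<partial>lborel)"
    by (rule circ_Tonelli[OF sigma_finite_lborel]) measurable
  finally show ?thesis .
qed

lemma disc_supermean:
  fixes D :: "complex \<Rightarrow> ennreal"
  assumes [measurable]: "D \<in> borel_measurable borel" and \<rho>: "0 \<le> \<rho>"
    and mean: "\<And>b. cmod b < \<rho> \<Longrightarrow> (\<integral>\<^sup>+\<theta>. D (a + cis \<theta> * b) \<partial>circ) \<le> D a"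
  shows "(\<integral>\<^sup>+y. D y * indicator (ball a \<rho>) y \<partial>lborel) \<le> D a * ennreal (pi * \<rho>\<^sup>2)"
proof -
  have "(\<integral>\<^sup>+y. D y * indicator (ball a \<rho>) y \<partial>lborel)
     = (\<integral>\<^sup>+y. D (a + y) * indicator (ball a \<rho>) (a + y) \<partial>lborel)"
    by (rule nn_integral_lborel_translate[symmetric]) measurable
  also have "\<dots> = (\<integral>\<^sup>+y. D (a + y) * indicator (ball 0 \<rho>) y \<partial>lborel)"
    by (intro nn_integral_cong) (auto split: split_indicator simp: dist_norm)
  also have "\<dots> = (\<integral>\<^sup>+y. (\<integral>\<^sup>+\<theta>. D (a + cis \<theta> * y) * indicator (ball 0 \<rho>) (cis \<theta> * y) \<partial>circ) \<partial>lborel)"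
    by (rule nn_integral_circ_average_complex) measurable
  also have "\<dots> \<le> (\<integral>\<^sup>+(y::complex). D a * indicator (ball 0 \<rho>) y \<partial>lborel)"
  proof (rule nn_integral_mono)
    fix y :: complex
    have "indicator (ball 0 \<rho>) (cis \<theta> * y) = (indicator (ball 0 \<rho>) y :: ennreal)" for \<theta>
      by (auto split: split_indicator simp: norm_mult)
    then show "(\<integral>\<^sup>+\<theta>. D (a + cis \<theta> * y) * indicator (ball 0 \<rho>) (cis \<theta> * y) \<partial>circ) \<le> D a * indicator (ball 0 \<rho>) y"
      using mean[of y] by (auto split: split_indicator)
  qed
  also have "\<dots> = D a * ennreal (pi * \<rho>\<^sup>2)"
    using \<rho> by (simp add: nn_integral_cmult emeasure_ball unit_ball_vol_2 ennreal_mult)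
  finally show ?thesis .
qed

text \<open>
  Every point \<open>\<xi>\<close> of the disc of radius \<open>R / 8\<close> about \<open>a\<close> sees the disc of radius \<open>R / 4\<close> about \<open>a'\<close>
  inside the disc of radius \<open>R / 2\<close> about \<open>\<xi>\<close>. Thus \<open>D \<xi>\<close> dominates a multiple of the integral over
  the former disc, and integration over \<open>\<xi>\<close> gives the comparison.
\<close>

lemma Harnack_step:
  fixes D :: "complex \<Rightarrow> ennreal"
  assumes [measurable]: "D \<in> borel_measurable borel" and R: "0 < R"
    and mean: "\<And>a b. cmod b + R / 4 \<le> cmod a \<Longrightarrow> (\<integral>\<^sup>+\<theta>. D (a + cis \<theta> * b) \<partial>circ) \<le> D a"
    and a: "cmod a = R" "cmod a' = R" "cmod (a - a') \<le> R / 8"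
  shows "(\<integral>\<^sup>+y. D y * indicator (ball a' (R/4)) y \<partial>lborel) \<le> 16 * (\<integral>\<^sup>+y. D y * indicator (ball a (R/4)) y \<partial>lborel)"
    (is "?I a' \<le> 16 * ?I a")
proof -
  have 1: "?I a' \<le> D \<xi> * ennreal (pi * (R/2)\<^sup>2)" if "\<xi> \<in> ball a (R/8)" for \<xi>
  proof -
    have d: "cmod (a - \<xi>) < R/8" using that by (simp add: dist_norm)
    have n: "cmod \<xi> \<ge> 7 * R / 8" using d a norm_triangle_ineq2[of a \<xi>] by linarith
    have "ball a' (R/4) \<subseteq> ball \<xi> (R/2)"
    proof
      fix y assume "y \<in> ball a' (R/4)"
      then have "cmod (a' - y) < R/4" by (simp add: dist_norm)
      moreover have "\<xi> - y = (\<xi> - a) + (a - a') + (a' - y)" by simp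
      then have "cmod (\<xi> - y) \<le> cmod (a - \<xi>) + cmod (a - a') + cmod (a' - y)"
        by (metis norm_minus_commute norm_triangle_mono norm_triangle_ineq order_refl)
      ultimately show "y \<in> ball \<xi> (R/2)" using d a by (simp add: dist_norm)
    qed
    then have "?I a' \<le> (\<integral>\<^sup>+y. D y * indicator (ball \<xi> (R/2)) y \<partial>lborel)"
      by (intro nn_integral_mono) (auto split: split_indicator)
    also have "\<dots> \<le> D \<xi> * ennreal (pi * (R/2)\<^sup>2)"
      using n R by (intro disc_supermean mean) auto
    finally show ?thesis .
  qed
  have "?I a' * ennreal (pi * (R/8)\<^sup>2) = (\<integral>\<^sup>+\<xi>. ?I a' * indicator (ball a (R/8)) \<xi> \<partial>lborel)"
    using R by (subst nn_integral_cmult_indicator) (auto simp: emeasure_ball unit_ball_vol_2 ennreal_mult)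
  also have "\<dots> \<le> (\<integral>\<^sup>+\<xi>. ennreal (pi * (R/2)\<^sup>2) * (D \<xi> * indicator (ball a (R/4)) \<xi>) \<partial>lborel)"
    using 1 R by (intro nn_integral_mono) (auto split: split_indicator simp: mult.commute)
  also have "\<dots> = ennreal (pi * (R/2)\<^sup>2) * ?I a"
    by (rule nn_integral_cmult) measurable
  also have "\<dots> = (16 * ?I a) * ennreal (pi * (R/8)\<^sup>2)"
  proof -
    have "ennreal (pi * (R/2)\<^sup>2) = ennreal (16 * (pi * (R/8)\<^sup>2))" by (simp add: power2_eq_square mult_ac)
    also have "\<dots> = 16 * ennreal (pi * (R/8)\<^sup>2)" by (subst ennreal_mult) auto
    finally show ?thesis by (simp add: mult_ac)
  qed
  finally have "?I a' * ennreal (pi * (R/8)\<^sup>2) \<le> (16 * ?I a) * ennreal (pi * (R/8)\<^sup>2)" .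
  then show ?thesis by (rule ennreal_mult_le_cancel_right[rotated]) (use R in simp)
qed

text \<open>
  A weak Harnack inequality: the value of a nonnegative superharmonic function at one point of a
  circle controls its circle means of comparable radius. The integrals over discs of radius \<open>R / 4\<close>
  centred on the circle are compared by passing from disc to disc around the circle; \<open>51\<close> steps of
  angle at most \<open>1 / 8\<close> suffice since \<open>2 \<pi> < 51 / 8\<close>.
\<close>

lemma Harnack_circle:
  fixes D :: "complex \<Rightarrow> ennreal"
  assumes [measurable]: "D \<in> borel_measurable borel" and R: "0 < R"
    and mean: "\<And>a b. cmod b + R / 4 \<le> cmod a \<Longrightarrow> (\<integral>\<^sup>+\<theta>. D (a + cis \<theta> * b) \<partial>circ) \<le> D a"
    and l: "cmod l = R"
    and E: "\<And>y. cmod y \<ge> 3 * R / 4 \<Longrightarrow> E \<le> (\<integral>\<^sup>+\<theta>. D (cis \<theta> * y) \<partial>circ)"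
  shows "E \<le> 4 * 16 ^ 51 * D l"
proof -
  define I where "I a = (\<integral>\<^sup>+y. D y * indicator (ball a (R/4)) y \<partial>lborel)" for a
  have it: "I (cis (real j * \<phi>) * l) \<le> 16 ^ j * I l" if "0 \<le> \<phi>" "\<phi> \<le> 1 / 8" for j \<phi>
  proof (induction j)
    case (Suc j)
    have "cis (real (Suc j) * \<phi>) = cis \<phi> * cis (real j * \<phi>)" by (simp add: cis_mult algebra_simps)
    then have "cis (real j * \<phi>) * l - cis (real (Suc j) * \<phi>) * l = - ((cis \<phi> - 1) * (cis (real j * \<phi>) * l))"
      by (simp add: algebra_simps)
    then have "cmod (cis (real j * \<phi>) * l - cis (real (Suc j) * \<phi>) * l) = cmod (cis \<phi> - 1) * R"
      by (simp only: norm_minus_cancel norm_mult norm_cis l)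
    also have "cmod (cis \<phi> - 1) \<le> \<phi>"
    proof -
      have "cmod (cis \<phi> - 1) = 2 * \<bar>sin (\<phi> / 2)\<bar>"
        using dist_exp_i_1[of \<phi>] by (simp add: cis_conv_exp)
      also have "\<dots> \<le> \<phi>" using abs_sin_x_le_abs_x[of "\<phi>/2"] that by simp
      finally show ?thesis .
    qed
    finally have "cmod (cis (real j * \<phi>) * l - cis (real (Suc j) * \<phi>) * l) \<le> \<phi> * R"
      using R by simp
    also have "\<dots> \<le> 1 / 8 * R" using that R by (intro mult_right_mono) auto
    finally have "cmod (cis (real j * \<phi>) * l - cis (real (Suc j) * \<phi>) * l) \<le> R / 8" by simp
    then have "I (cis (real (Suc j) * \<phi>) * l) \<le> 16 * I (cis (real j * \<phi>) * l)"
      unfolding I_def using R l by (intro Harnack_step mean) (auto simp: norm_mult)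
    also have "\<dots> \<le> 16 * (16 ^ j * I l)" by (intro mult_left_mono Suc.IH) auto
    finally show ?case by (simp add: mult_ac)
  qed simp
  have all: "I (cis \<theta> * l) \<le> 16 ^ 51 * I l" if "\<theta> \<in> {0..2*pi}" for \<theta>
    using it[of "\<theta>/51" 51] that pi_less_4 pi_approx by auto
  have Il: "I l \<le> D l * ennreal (pi * (R/2)\<^sup>2)"
  proof -
    have "I l \<le> (\<integral>\<^sup>+y. D y * indicator (ball l (R/2)) y \<partial>lborel)"
      unfolding I_def using R by (intro nn_integral_mono) (auto split: split_indicator)
    also have "\<dots> \<le> D l * ennreal (pi * (R/2)\<^sup>2)"
      using l R by (intro disc_supermean mean) auto
    finally show ?thesis .
  qed
  have "E * ennreal (pi * (R/4)\<^sup>2) = (\<integral>\<^sup>+y. E * indicator (ball l (R/4)) y \<partial>lborel)"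
    using R by (simp add: nn_integral_cmult emeasure_ball unit_ball_vol_2 ennreal_mult)
  also have "\<dots> \<le> (\<integral>\<^sup>+y. (\<integral>\<^sup>+\<theta>. D (cis \<theta> * y) * indicator (ball l (R/4)) y \<partial>circ) \<partial>lborel)"
  proof (rule nn_integral_mono)
    fix y
    have "E \<le> (\<integral>\<^sup>+\<theta>. D (cis \<theta> * y) \<partial>circ)" if "y \<in> ball l (R/4)"
      using that l norm_triangle_ineq2[of l y] by (intro E) (auto simp: dist_norm)
    then show "E * indicator (ball l (R/4)) y \<le> (\<integral>\<^sup>+\<theta>. D (cis \<theta> * y) * indicator (ball l (R/4)) y \<partial>circ)"
      by (auto split: split_indicator)
  qed
  also have "\<dots> = (\<integral>\<^sup>+\<theta>. (\<integral>\<^sup>+y. D (cis \<theta> * y) * indicator (ball l (R/4)) y \<partial>lborel) \<partial>circ)"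
    by (rule circ_Tonelli[OF sigma_finite_lborel, symmetric]) measurable
  also have "\<dots> = (\<integral>\<^sup>+\<theta>. I (cis \<theta> * l) \<partial>circ)"
  proof (rule nn_integral_cong)
    fix \<theta>
    have "I (cis \<theta> * l) = (\<integral>\<^sup>+y. D (cis \<theta> * y) * indicator (ball (cis \<theta> * l) (R/4)) (cis \<theta> * y) \<partial>lborel)"
      unfolding I_def by (rule nn_integral_lborel_cis_complex[symmetric]) measurable
    moreover have "indicator (ball (cis \<theta> * l) (R/4)) (cis \<theta> * y) = (indicator (ball l (R/4)) y :: ennreal)" for y
      by (auto split: split_indicator simp: dist_norm norm_mult simp flip: right_diff_distrib)
    ultimately show "(\<integral>\<^sup>+y. D (cis \<theta> * y) * indicator (ball l (R/4)) y \<partial>lborel) = I (cis \<theta> * l)" by simp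
  qed
  also have "\<dots> \<le> (\<integral>\<^sup>+\<theta>. 16 ^ 51 * I l \<partial>circ)"
  proof (rule nn_integral_mono_AE)
    have "AE \<theta> in circ. \<theta> \<in> {0..2*pi}" by (rule AE_uniform_measureI) auto
    then show "AE \<theta> in circ. I (cis \<theta> * l) \<le> 16 ^ 51 * I l"
      by eventually_elim (rule all)
  qed
  also have "\<dots> \<le> 16 ^ 51 * (D l * ennreal (pi * (R/2)\<^sup>2))"
    using Il by (simp only: nn_integral_circ_const) (intro mult_left_mono, auto)
  also have "\<dots> = (4 * 16 ^ 51 * D l) * ennreal (pi * (R/4)\<^sup>2)"
  proof -
    have "ennreal (pi * (R/2)\<^sup>2) = ennreal (4 * (pi * (R/4)\<^sup>2))" by (simp add: power2_eq_square mult_ac)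
    also have "\<dots> = 4 * ennreal (pi * (R/4)\<^sup>2)" by (subst ennreal_mult) auto
    finally show ?thesis by (simp only: mult_ac)
  qed
  finally show ?thesis by (rule ennreal_mult_le_cancel_right[rotated]) (use R in simp)
qed

section \<open>Subharmonic functions of logarithmic growth\<close>

lemma less_e2ennreal_diff_iff:
  assumes "0 \<le> c"
  shows "ennreal c < e2ennreal (ereal B - y) \<longleftrightarrow> y < ereal (B - c)"
proof (cases y)
  case (real r)
  then show ?thesis using assms by (auto simp: ennreal_less_iff)
next
  case PInf
  then show ?thesis by (simp add: e2ennreal_neg)
next
  case MInf
  then show ?thesis by simp
qed

lemma lsc_e2ennreal_diff:
  fixes u :: "'a::topological_space \<Rightarrow> ereal"
  assumes "\<And>c. open {z. u z < c}"
  shows "open {z. e2ennreal (ereal B - u z) > c}"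
proof (cases c)
  case (real r)
  then show ?thesis using assms by (simp add: less_e2ennreal_diff_iff)
qed simp

lemma le_e2ennreal_diff:
  assumes "y \<le> ereal B - enn2ereal X"
  shows "X \<le> e2ennreal (ereal B - y)"
proof (cases X)
  case X: (real x)
  show ?thesis
  proof (cases y)
    case (real r)
    then show ?thesis using assms X by (auto intro!: ennreal_leI simp: enn2ereal_ennreal)
  next
    case PInf then show ?thesis using assms X by (simp add: enn2ereal_ennreal)
  next
    case MInf then show ?thesis by simp
  qed
next
  case top
  then show ?thesis using assms by simp
qed

lemma diff_enn2ereal_le_iff:
  "ereal B - enn2ereal X \<le> ereal y \<longleftrightarrow> ennreal (B - y) \<le> X"
proof (cases X)
  case (real x)
  then show ?thesis by (auto simp: enn2ereal_ennreal ennreal_le_iff2)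
next
  case top
  then show ?thesis by simp
qed

text \<open>
  The restriction of a function of the Lelong class to a complex line, including the value
  \<open>-\<infinity>\<close> everywhere.
\<close>

locale Lelong_line =
  fixes u :: "complex \<Rightarrow> ereal" and C :: real
  assumes usc: "open {z. u z < c}"
    and submean: "u a \<le> ereal_integral circ (\<lambda>\<theta>. u (a + cis \<theta> * b))"
    and growth: "u z \<le> ereal (ln (max 1 (cmod z)) + C)"
begin

definition circle_mean :: "real \<Rightarrow> ereal" where
  "circle_mean r = ereal_integral circ (\<lambda>\<theta>. u (cis \<theta> * of_real r))"

lemma u_borel [measurable]: "u \<in> borel_measurable borel"
  using usc by (intro borel_measurableI_less) auto

lemma circ_integral_eq:
  assumes "\<And>\<theta>. u (a + cis \<theta> * b) \<le> ereal B"
  shows "ereal_integral circ (\<lambda>\<theta>. u (a + cis \<theta> * b))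
    = ereal B - enn2ereal (\<integral>\<^sup>+\<theta>. e2ennreal (ereal B - u (a + cis \<theta> * b)) \<partial>circ)"
  using prob_space_circ by (intro ereal_integral_bounded_above assms) (auto simp: space_uniform_measure)

lemma supermean:
  assumes "\<And>\<theta>. u (a + cis \<theta> * b) \<le> ereal B"
  shows "(\<integral>\<^sup>+\<theta>. e2ennreal (ereal B - u (a + cis \<theta> * b)) \<partial>circ) \<le> e2ennreal (ereal B - u a)"
  using submean[of a b] unfolding circ_integral_eq[OF assms] by (rule le_e2ennreal_diff)

lemma circle_mean_eq:
  assumes "\<And>\<theta>. u (cis \<theta> * of_real r) \<le> ereal B"
  shows "circle_mean r = ereal B - enn2ereal (\<integral>\<^sup>+\<theta>. e2ennreal (ereal B - u (cis \<theta> * of_real r)) \<partial>circ)"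
  using circ_integral_eq[of 0 "of_real r" B] assms by (simp add: circle_mean_def)

lemma u_le:
  assumes "1 \<le> R" "cmod z \<le> R"
  shows "u z \<le> ereal (ln R + C)"
proof -
  have "ln (max 1 (cmod z)) \<le> ln R" using assms by (subst ln_le_cancel_iff) auto
  then show ?thesis using growth[of z] order_trans by fastforce
qed

text \<open>
  The circle mean is convex in \<open>ln r\<close> and at most \<open>ln r + C\<close> for large \<open>r\<close>, so its slope is at most
  \<open>1\<close>: apply convexity between \<open>r1\<close> and \<open>exp T\<close> and let \<open>T\<close> tend to infinity.
\<close>

lemma circle_mean_le_add_ln:
  assumes r: "0 < r1" "r1 \<le> r"
  shows "circle_mean r \<le> circle_mean r1 + ereal (ln r - ln r1)"
proof (cases "r1 = r")
  case True then show ?thesis by simp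
next
  case False
  then have "r1 < r" using r by simp
  have main: "circle_mean r \<le> ereal (y + (ln r - ln r1))" if y: "circle_mean r1 \<le> ereal y" for y
  proof -
    define h where "h T = (T + C) - (T + C - y) * (T - ln r) / (T - ln r1)" for T
    have ev: "\<forall>\<^sub>F T in at_top. circle_mean r \<le> ereal (h T)"
    proof -
      have "\<forall>\<^sub>F T in at_top. T > \<bar>ln r\<bar>" by (rule eventually_gt_at_top)
      then show ?thesis
      proof eventually_elim
        fix T assume T: "T > \<bar>ln r\<bar>"
        define r2 where "r2 = exp T"
        have r2: "r < r2" "1 \<le> r2" "ln r2 = T"
        proof -
          have "exp (ln r) < exp T" using T by (subst exp_less_cancel_iff) auto
          then show "r < r2" using r by (simp add: r2_def)
        qed (use T in \<open>auto simp: r2_def\<close>)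
        define B where "B = T + C"
        have uB: "u z \<le> ereal B" if "cmod z \<le> r2" for z
          using u_le[OF r2(2) that] r2 by (simp add: B_def)
        define f where "f z = e2ennreal (ereal B - u z)" for z
        have alg: "x * t / d + (- x / d) * l = x * (t - l) / d" for x t d l :: real
          by (simp add: divide_inverse algebra_simps)
        have lr: "ln r1 < ln r" "ln r < T" using \<open>r1 < r\<close> r T by auto
        have "ennreal ((B - y) * T / (T - ln r1) + (- (B - y) / (T - ln r1)) * ln r) \<le> (\<integral>\<^sup>+\<theta>. f (cis \<theta> * of_real r) \<partial>circ)"
        proof (rule circle_concave[where R = r2 and ?r1.0 = r1 and ?r2.0 = r2])
          show "open {z. f z > c}" for c
            unfolding f_def by (rule lsc_e2ennreal_diff[OF usc])
          show "(\<integral>\<^sup>+\<theta>. f (a + cis \<theta> * b) \<partial>circ) \<le> f a" if "cmod a + cmod b \<le> r2" for a b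
            unfolding f_def
          proof (rule supermean[OF uB])
            show "cmod (a + cis \<theta> * b) \<le> r2" for \<theta>
              using that norm_triangle_ineq[of a "cis \<theta> * b"] by (simp add: norm_mult)
          qed
          have "circle_mean r1 = ereal B - enn2ereal (\<integral>\<^sup>+\<theta>. f (cis \<theta> * of_real r1) \<partial>circ)"
            unfolding f_def using r r2 by (intro circle_mean_eq uB) (auto simp: norm_mult)
          then have "ennreal (B - y) \<le> (\<integral>\<^sup>+\<theta>. f (cis \<theta> * of_real r1) \<partial>circ)"
            using y by (simp add: diff_enn2ereal_le_iff)
          moreover have "(B - y) * T / (T - ln r1) + (- (B - y) / (T - ln r1)) * ln r1 = B - y"
            unfolding alg using lr by simp
          ultimately show "ennreal ((B - y) * T / (T - ln r1) + (- (B - y) / (T - ln r1)) * ln r1) \<le> (\<integral>\<^sup>+\<theta>. f (cis \<theta> * of_real r1) \<partial>circ)"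
            by simp
          have "(B - y) * T / (T - ln r1) + (- (B - y) / (T - ln r1)) * ln r2 = 0"
            unfolding alg using r2 by simp
          then show "ennreal ((B - y) * T / (T - ln r1) + (- (B - y) / (T - ln r1)) * ln r2) \<le> (\<integral>\<^sup>+\<theta>. f (cis \<theta> * of_real r2) \<partial>circ)"
            by simp
        qed (use r r2 in auto)
        moreover have "(B - y) * T / (T - ln r1) + (- (B - y) / (T - ln r1)) * ln r = B - h T"
          unfolding alg h_def B_def by simp
        moreover have "circle_mean r = ereal B - enn2ereal (\<integral>\<^sup>+\<theta>. f (cis \<theta> * of_real r) \<partial>circ)"
          unfolding f_def using r r2 by (intro circle_mean_eq uB) (auto simp: norm_mult)
        ultimately show "circle_mean r \<le> ereal (h T)"
          by (simp add: diff_enn2ereal_le_iff)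
      qed
    qed
    have "(h \<longlongrightarrow> y + (ln r - ln r1)) at_top"
      unfolding h_def by real_asymp
    then have "((\<lambda>T. ereal (h T)) \<longlongrightarrow> ereal (y + (ln r - ln r1))) at_top" by simp
    then show ?thesis
      by (rule tendsto_lowerbound) (use ev in auto)
  qed
  show ?thesis
  proof (rule ereal_le_real)
    fix z assume z: "circle_mean r1 + ereal (ln r - ln r1) \<le> ereal z"
    then have "circle_mean r1 \<le> ereal (z - (ln r - ln r1))"
      by (cases "circle_mean r1") auto
    from main[OF this] show "circle_mean r \<le> ereal z" by simp
  qed
qed

text \<open>
  Let \<open>l\<close> be the upper limit of \<open>W = u - ln |z|\<close>. Far out, \<open>l + \<delta> - W\<close> is nonnegative and
  superharmonic, and it is at most \<open>2 \<delta>\<close> at suitable points. By the Harnack inequality its circle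
  means there are of order \<open>\<delta>\<close> too, so those of \<open>W\<close> come close to \<open>l\<close>; and they decrease with the
  radius.
\<close>

lemma Limsup_le_circle_mean:
  assumes T: "0 < T"
  shows "Limsup at_infinity (\<lambda>z. u z - ereal (ln (cmod z))) \<le> circle_mean T - ereal (ln T)"
proof (rule ccontr)
  define W where "W z = u z - ereal (ln (cmod z))" for z
  define L where "L = Limsup at_infinity W"
  assume "\<not> ?thesis"
  then have MT: "circle_mean T - ereal (ln T) < L" by (simp add: L_def W_def[abs_def])
  have "L \<le> ereal C"
    unfolding L_def
  proof (rule Limsup_bounded)
    have "\<forall>\<^sub>F z::complex in at_infinity. 1 \<le> cmod z"
      unfolding eventually_at_infinity by blast
    then show "\<forall>\<^sub>F z in at_infinity. W z \<le> ereal C"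
    proof eventually_elim
      case (elim z)
      then show ?case using growth[of z] unfolding W_def
        by (cases "u z") (auto simp: max_def split: if_splits)
    qed
  qed
  then obtain l where l: "L = ereal l" using MT by (cases L) auto
  obtain q where q: "circle_mean T - ereal (ln T) < ereal q" "q < l"
    using MT l ereal_dense2[of "circle_mean T - ereal (ln T)" "ereal l"] by auto
  define K :: real where "K = 4 * 16 ^ 51"
  define \<delta> where "\<delta> = (l - q) / (2 * K)"
  have K: "K > 0" by (simp add: K_def)
  have \<delta>: "\<delta> > 0" using q K by (simp add: \<delta>_def)
  have "\<forall>\<^sub>F z in at_infinity. W z < ereal (l + \<delta>)"
    using \<delta> l unfolding L_def by (intro Limsup_lessD) auto
  then obtain R0 where R0: "\<And>z. R0 \<le> cmod z \<Longrightarrow> W z < ereal (l + \<delta>)"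
    unfolding eventually_at_infinity by auto
  \<comment> \<open>\<open>4 * R0\<close> makes \<open>W < l + \<delta>\<close> hold on all discs of the Harnack argument, \<open>4 * T\<close> makes the means of radius at least \<open>T\<close>\<close>
  define R1 where "R1 = max 1 (max (4 * R0) (4 * T))"
  have "\<not> (\<forall>\<^sub>F z in at_infinity. W z \<le> ereal (l - \<delta>))"
  proof
    assume "\<forall>\<^sub>F z in at_infinity. W z \<le> ereal (l - \<delta>)"
    then have "L \<le> ereal (l - \<delta>)" unfolding L_def by (rule Limsup_bounded)
    then show False using l \<delta> by simp
  qed
  then obtain z0 where z0: "R1 \<le> cmod z0" "\<not> W z0 \<le> ereal (l - \<delta>)"
    unfolding eventually_at_infinity by blast
  define R where "R = cmod z0"
  have R: "1 \<le> R" "4 * R0 \<le> R" "4 * T \<le> R" using z0 by (auto simp: R_def R1_def)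
  define B where "B = l + \<delta>"
  define D where "D z = (if z = 0 then top else e2ennreal (ereal (B + ln (cmod z)) - u z))" for z
  have D[measurable]: "D \<in> borel_measurable borel" unfolding D_def by measurable
  have WB: "u z \<le> ereal (B + ln (cmod z))" if "R / 4 \<le> cmod z" for z
    using R0[of z] that R unfolding W_def B_def by (cases "u z") auto
  \<comment> \<open>\<open>D\<close> is superharmonic away from the origin because the logarithm is harmonic there\<close>
  have Dmean: "(\<integral>\<^sup>+\<theta>. D (a + cis \<theta> * b) \<partial>circ) \<le> D a" if ab: "cmod b + R / 4 \<le> cmod a" for a b
  proof -
    define r where "r = cmod a + cmod b"
    define w where "w \<theta> = cmod (a + cis \<theta> * b)" for \<theta>
    have w: "R / 4 \<le> w \<theta>" "w \<theta> \<le> r" for \<theta>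
      using ab norm_diff_ineq[of a "cis \<theta> * b"] norm_triangle_ineq[of a "cis \<theta> * b"]
      by (auto simp: norm_mult r_def w_def)
    have ba: "cmod b < cmod a" using ab R by linarith
    then have a0: "a \<noteq> 0" "cmod b < cmod a" by auto
    have nz: "a + cis \<theta> * b \<noteq> 0" for \<theta> using w[of \<theta>] R unfolding w_def by auto
    have wp: "0 < w \<theta>" for \<theta> using nz by (simp add: w_def)
    define B' where "B' = B + ln r"
    have r0: "r > 0" using a0 by (auto simp: r_def add_pos_nonneg)
    have lw: "ln (w \<theta>) \<le> ln r" for \<theta> using w wp r0 by simp
    have uB': "u (a + cis \<theta> * b) \<le> ereal B'" for \<theta>
      using WB[of "a + cis \<theta> * b"] w[of \<theta>] lw[of \<theta>] unfolding w_def B'_def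
      by (cases "u (a + cis \<theta> * b)") auto
    have split: "e2ennreal (ereal B' - y) = e2ennreal (ereal (B + t) - y) + ennreal (ln r - t)"
      if "y \<le> ereal (B + t)" "t \<le> ln r" for y t
      using that by (cases y) (auto simp: B'_def simp flip: ennreal_plus)
    have "(\<integral>\<^sup>+\<theta>. e2ennreal (ereal B' - u (a + cis \<theta> * b)) \<partial>circ)
       = (\<integral>\<^sup>+\<theta>. D (a + cis \<theta> * b) + ennreal (ln r + (-1) * ln (w \<theta>)) \<partial>circ)"
    proof (rule nn_integral_cong)
      fix \<theta>
      show "e2ennreal (ereal B' - u (a + cis \<theta> * b)) = D (a + cis \<theta> * b) + ennreal (ln r + (-1) * ln (w \<theta>))"
        using split[of "u (a + cis \<theta> * b)" "ln (w \<theta>)"] WB[of "a + cis \<theta> * b"] w[of \<theta>] lw[of \<theta>] nz[of \<theta>]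
        by (simp add: D_def w_def)
    qed
    also have "\<dots> = (\<integral>\<^sup>+\<theta>. D (a + cis \<theta> * b) \<partial>circ) + (\<integral>\<^sup>+\<theta>. ennreal (ln r + (-1) * ln (w \<theta>)) \<partial>circ)"
      unfolding w_def by (intro nn_integral_add) measurable
    also have "(\<integral>\<^sup>+\<theta>. ennreal (ln r + (-1) * ln (w \<theta>)) \<partial>circ) = ennreal (ln r - ln (cmod a))"
      using log_mean_value_nn[of b a "ln r" "-1"] a0 lw by (simp add: w_def)
    finally have "(\<integral>\<^sup>+\<theta>. D (a + cis \<theta> * b) \<partial>circ) + ennreal (ln r - ln (cmod a)) \<le> e2ennreal (ereal B' - u a)"
      using supermean[OF uB'] by simp
    also have "\<dots> = D a + ennreal (ln r - ln (cmod a))"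
    proof -
      have "R / 4 \<le> cmod a" using ab norm_ge_zero[of b] by linarith
      moreover have "ln (cmod a) \<le> ln r" using a0 by (auto simp: r_def add_pos_nonneg)
      ultimately show ?thesis using split[of "u a" "ln (cmod a)"] WB[of a] a0 by (simp add: D_def)
    qed
    finally show ?thesis by (simp add: ennreal_add_left_cancel_le add.commute)
  qed
  have "ennreal (B - q) \<le> 4 * 16 ^ 51 * D z0"
  proof (rule Harnack_circle[OF D _ Dmean])
    fix y assume y: "3 * R / 4 \<le> cmod y"
    define t where "t = cmod y"
    have t: "T \<le> t" "R / 4 \<le> t" "0 < t" using y R T by (auto simp: t_def)
    have b: "u (cis \<theta> * of_real t) \<le> ereal (B + ln t)" for \<theta>
      using WB[of "cis \<theta> * of_real t"] t by (simp add: norm_mult)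
    have "circle_mean t \<le> circle_mean T + ereal (ln t - ln T)" using T t by (intro circle_mean_le_add_ln) auto
    also have "\<dots> \<le> ereal (q + ln t)" using q(1) by (cases "circle_mean T") auto
    finally have "ereal (B + ln t) - enn2ereal (\<integral>\<^sup>+\<theta>. e2ennreal (ereal (B + ln t) - u (cis \<theta> * of_real t)) \<partial>circ) \<le> ereal (q + ln t)"
      unfolding circle_mean_eq[OF b] .
    then have "ennreal (B - q) \<le> (\<integral>\<^sup>+\<theta>. e2ennreal (ereal (B + ln t) - u (cis \<theta> * of_real t)) \<partial>circ)"
      unfolding diff_enn2ereal_le_iff by simp
    also have "\<dots> = (\<integral>\<^sup>+\<theta>. D (cis \<theta> * of_real t) \<partial>circ)"
      using t by (intro nn_integral_cong) (auto simp: D_def norm_mult)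
    also have "\<dots> = (\<integral>\<^sup>+\<theta>. D (cis \<theta> * y) \<partial>circ)"
      unfolding t_def by (rule circ_mean_norm[symmetric]) measurable
    finally show "ennreal (B - q) \<le> (\<integral>\<^sup>+\<theta>. D (cis \<theta> * y) \<partial>circ)" .
  qed (use R in \<open>auto simp: R_def\<close>)
  also have "\<dots> \<le> ennreal (K * (2 * \<delta>))"
  proof -
    have z0n: "z0 \<noteq> 0" using R by (auto simp: R_def)
    have "D z0 \<le> ennreal (2 * \<delta>)"
      using z0(2) z0n \<delta> unfolding D_def W_def B_def
      by (cases "u z0") (auto intro!: ennreal_leI simp: e2ennreal_neg)
    then have "4 * 16 ^ 51 * D z0 \<le> 4 * 16 ^ 51 * ennreal (2 * \<delta>)" by (intro mult_left_mono) auto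
    also have "\<dots> = ennreal K * ennreal (2 * \<delta>)"
      unfolding K_def by (subst ennreal_mult) (auto simp: ennreal_power[symmetric])
    also have "\<dots> = ennreal (K * (2 * \<delta>))" using K \<delta> by (simp add: ennreal_mult)
    finally show ?thesis .
  qed
  also have "K * (2 * \<delta>) = l - q" using K by (simp add: \<delta>_def)
  finally show False using q \<delta> by (simp add: B_def ennreal_le_iff)
qed

lemma circle_mean_le_Limsup:
  assumes c: "Limsup at_infinity (\<lambda>z. u z - ereal (ln (cmod z))) < ereal c"
  shows "\<exists>R. \<forall>r\<ge>R. circle_mean r \<le> ereal (ln r + c)"
proof -
  have "\<forall>\<^sub>F z in at_infinity. u z - ereal (ln (cmod z)) < ereal c"
    by (rule Limsup_lessD[OF c])
  then obtain R where R: "\<And>z. R \<le> cmod z \<Longrightarrow> u z - ereal (ln (cmod z)) < ereal c"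
    unfolding eventually_at_infinity by auto
  have "circle_mean r \<le> ereal (ln r + c)" if r: "max 1 R \<le> r" for r
  proof -
    have "u (cis \<theta> * of_real r) \<le> ereal (ln r + c)" for \<theta>
      using R[of "cis \<theta> * of_real r"] r by (cases "u (cis \<theta> * of_real r)") (auto simp: norm_mult)
    then show ?thesis
      by (subst circle_mean_eq) (auto simp: diff_enn2ereal_le_iff)
  qed
  then show ?thesis by blast
qed

text \<open>
  A countable infimum of circle means, so the Robin function inherits their measurability.
\<close>

theorem Limsup_eq_INF:
  "Limsup at_infinity (\<lambda>z. u z - ereal (ln (cmod z))) = (INF k. circle_mean (real (Suc k)) - ereal (ln (real (Suc k))))"
proof (rule antisym)
  show "Limsup at_infinity (\<lambda>z. u z - ereal (ln (cmod z))) \<le> (INF k. circle_mean (real (Suc k)) - ereal (ln (real (Suc k))))"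
    by (intro INF_greatest Limsup_le_circle_mean) auto
  show "(INF k. circle_mean (real (Suc k)) - ereal (ln (real (Suc k)))) \<le> Limsup at_infinity (\<lambda>z. u z - ereal (ln (cmod z)))"
  proof (rule ereal_le_real, rule ccontr)
    fix z assume z: "Limsup at_infinity (\<lambda>z. u z - ereal (ln (cmod z))) \<le> ereal z"
      and nz: "\<not> (INF k. circle_mean (real (Suc k)) - ereal (ln (real (Suc k)))) \<le> ereal z"
    then obtain c where c: "ereal z < ereal c" "ereal c < (INF k. circle_mean (real (Suc k)) - ereal (ln (real (Suc k))))"
      using ereal_dense2[of "ereal z"] by (auto simp: not_le)
    obtain R where R: "\<And>r. r \<ge> R \<Longrightarrow> circle_mean r \<le> ereal (ln r + c)"
      using circle_mean_le_Limsup[OF le_less_trans[OF z c(1)]] by blast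
    obtain k where k: "R \<le> real (Suc k)" 
      by (meson lessI less_imp_le_nat of_nat_mono order_trans real_arch_simple)
    have "(INF k. circle_mean (real (Suc k)) - ereal (ln (real (Suc k)))) \<le> circle_mean (real (Suc k)) - ereal (ln (real (Suc k)))"
      by (rule INF_lower) simp
    also have "\<dots> \<le> ereal c" using R[OF k] by (cases "circle_mean (real (Suc k))") auto
    finally show False using c(2) by simp
  qed
qed

end

section \<open>The Fubini--Study density\<close>

lemma det_replace_row_mat_1:
  fixes v :: "'a::field ^ 'n::finite"
  shows "det (\<chi> i. if i = k then v else axis i 1) = v $ k"
proof -
  have r: "row i (mat 1 :: 'a^'n^'n) = axis i 1" for i
    by (auto simp: row_def mat_def axis_def vec_eq_iff)
  have s: "(\<Sum>i\<in>UNIV. v $ i *s axis i 1) = v"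
    by (simp add: basis_expansion)
  show ?thesis
    using cramer_lemma_transpose[of k v "mat 1 :: 'a^'n^'n"] unfolding r s by simp
qed

text \<open>
  Subtracting multiples of row \<open>k\<close> removes the rank-one terms from the rows in \<open>S\<close>.
\<close>

lemma det_replace_row_rank_1:
  fixes v :: "'a::field ^ 'n::finite"
  assumes "finite S" "k \<notin> S"
  shows "det (\<chi> i. if i = k then v else if i \<in> S then axis i 1 + u i *s v else axis i 1) = v $ k"
  using assms
proof (induction S)
  case empty
  then show ?case by (simp add: det_replace_row_mat_1 cong: if_cong)
next
  case (insert m S)
  define A where "A = (\<chi> i. if i = k then v else if i \<in> S then axis i 1 + u i *s v else axis i 1)"
  have rw: "row i A = (if i = k then v else if i \<in> S then axis i 1 + u i *s v else axis i 1)" for i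
    by (simp add: row_def A_def vec_eq_iff)
  have eq: "(\<chi> i. if i = k then v else if i \<in> insert m S then axis i 1 + u i *s v else axis i 1)
     = (\<chi> i. if i = m then row m A + u m *s row k A else row i A)"
    using insert by (simp only: rw) (auto simp: vec_eq_iff)
  have "m \<noteq> k" using insert by auto
  show ?case
    unfolding eq det_row_operation[OF \<open>m \<noteq> k\<close>] unfolding A_def using insert by blast
qed

lemma det_identity_plus_rank_1_on:
  fixes v :: "'a::field ^ 'n::finite"
  assumes "finite S"
  shows "det (\<chi> i. if i \<in> S then axis i 1 + u i *s v else axis i 1) = 1 + (\<Sum>i\<in>S. u i * v $ i)"
  using assms
proof (induction S)
  case empty
  have "(\<chi> i. axis i 1) = (mat 1 :: 'a^'n^'n)"
    by (auto simp: mat_def axis_def vec_eq_iff)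
  then show ?case by simp
next
  case (insert k S)
  define c where "c i = (if i \<in> S then axis i 1 + u i *s v else axis i 1)" for i
  have "(\<chi> i. if i \<in> insert k S then axis i 1 + u i *s v else axis i 1)
     = (\<chi> i. if i = k then axis k 1 + u k *s v else c i)"
    using insert by (auto simp: vec_eq_iff c_def)
  moreover have "(\<chi> i. if i = k then axis k 1 else c i) = (\<chi> i. if i \<in> S then axis i 1 + u i *s v else axis i 1)"
    using insert by (auto simp: vec_eq_iff c_def)
  moreover have "det (\<chi> i. if i = k then v else c i) = v $ k"
    using det_replace_row_rank_1[of S k v u] insert unfolding c_def by blast
  ultimately show ?case
    using insert by (simp add: det_row_add det_row_mul)
qed

lemma det_identity_plus_rank_1:
  fixes v :: "'a::field ^ 'n::finite"
  shows "det (\<chi> i. axis i 1 + u i *s v) = 1 + (\<Sum>i\<in>UNIV. u i * v $ i)"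
  using det_identity_plus_rank_1_on[of UNIV u v] by simp

lemma norm_add_axis_power2:
  fixes w :: "complex ^ 'n::finite"
  shows "(norm (w + t *\<^sub>R axis l b))\<^sup>2 = (norm w)\<^sup>2 + 2 * t * (w $ l \<bullet> b) + t\<^sup>2 * (norm b)\<^sup>2"
proof -
  have "(norm (w + t *\<^sub>R axis l b))\<^sup>2 = (w + t *\<^sub>R axis l b) \<bullet> (w + t *\<^sub>R axis l b)"
    by (rule power2_norm_eq_inner)
  also have "\<dots> = w \<bullet> w + 2 * t * (w \<bullet> axis l b) + t\<^sup>2 * (axis l b \<bullet> axis l b)"
    by (simp add: inner_add_left inner_add_right inner_commute power2_eq_square algebra_simps)
  also have "\<dots> = (norm w)\<^sup>2 + 2 * t * (w $ l \<bullet> b) + t\<^sup>2 * (norm b)\<^sup>2"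
    by (simp add: inner_axis power2_norm_eq_inner inner_axis_axis)
  finally show ?thesis .
qed

lemma partial_zbar_log_norm:
  fixes w :: "complex ^ 'n::finite"
  assumes "w \<noteq> 0"
  shows "partial_zbar l (\<lambda>w. complex_of_real (ln ((norm w)\<^sup>2))) w = w $ l / of_real ((norm w)\<^sup>2)"
proof -
  have n: "(norm w)\<^sup>2 > 0" using assms by simp
  have d: "vector_derivative (\<lambda>t::real. complex_of_real (ln ((norm (w + t *\<^sub>R axis l b))\<^sup>2))) (at 0)
      = of_real (2 * (w $ l \<bullet> b) / (norm w)\<^sup>2)" for b
  proof (rule vector_derivative_at)
    have "((\<lambda>t. ln ((norm w)\<^sup>2 + 2 * t * (w $ l \<bullet> b) + t\<^sup>2 * (norm b)\<^sup>2)) has_real_derivative (2 * (w $ l \<bullet> b) / (norm w)\<^sup>2)) (at 0)"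
      using n by (auto intro!: derivative_eq_intros)
    then show "((\<lambda>t. complex_of_real (ln ((norm (w + t *\<^sub>R axis l b))\<^sup>2))) has_vector_derivative of_real (2 * (w $ l \<bullet> b) / (norm w)\<^sup>2)) (at 0)"
      unfolding norm_add_axis_power2
      by (intro has_vector_derivative_of_real) (simp add: has_real_derivative_iff_has_vector_derivative)
  qed
  show ?thesis
    unfolding partial_zbar_def d by (simp add: complex_eq_iff inner_complex_def Re_divide_of_real Im_divide_of_real)
qed

lemma FS_coeff_eq:
  fixes z :: "complex ^ 'n::finite"
  assumes "z \<noteq> 0"
  shows "FS_coeff z j l = (if j = l then 1 else 0) / of_real ((norm z)\<^sup>2) - z $ l * cnj (z $ j) / of_real ((norm z) ^ 4)"
proof -
  define q where "q = (norm z)\<^sup>2"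
  have n: "q > 0" using assms by (simp add: q_def)
  define P where "P = partial_zbar l (\<lambda>w::complex^'n. complex_of_real (ln ((norm w)\<^sup>2)))"
  define \<delta> where "\<delta> = (if j = l then 1 else 0 :: complex)"
  have d: "vector_derivative (\<lambda>t::real. P (z + t *\<^sub>R axis j b)) (at 0)
      = \<delta> * b / of_real q - z $ l * of_real (2 * (z $ j \<bullet> b)) / of_real (q^2)" for b
  proof (rule vector_derivative_at)
    define N where "N t = q + 2 * t * (z $ j \<bullet> b) + t\<^sup>2 * (norm b)\<^sup>2" for t
    have N: "(N has_real_derivative (2 * (z $ j \<bullet> b))) (at 0)"
      unfolding N_def by (auto intro!: derivative_eq_intros)
    have "((\<lambda>t. complex_of_real (inverse (N t))) has_vector_derivative of_real (- (2 * (z $ j \<bullet> b)) / q^2)) (at 0)"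
    proof (intro has_vector_derivative_of_real)
      have "((\<lambda>t. inverse (N t)) has_real_derivative (- (2 * (z $ j \<bullet> b)) / q^2)) (at 0)"
        using n by (auto intro!: derivative_eq_intros N simp: N_def field_simps power2_eq_square)
      then show "((\<lambda>t. inverse (N t)) has_real_derivative (- (2 * (z $ j \<bullet> b)) / q^2)) (at 0)" .
    qed
    moreover have "((\<lambda>t. z $ l + of_real t * (\<delta> * b)) has_vector_derivative \<delta> * b) (at 0)"
      by (auto intro!: derivative_eq_intros)
    ultimately have "((\<lambda>t. (z $ l + of_real t * (\<delta> * b)) * complex_of_real (inverse (N t))) has_vector_derivative
       (z $ l + of_real 0 * (\<delta> * b)) * of_real (- (2 * (z $ j \<bullet> b)) / q^2) + \<delta> * b * complex_of_real (inverse (N 0))) (at 0)"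
      by (rule has_vector_derivative_mult[rotated])
    then have D: "((\<lambda>t. (z $ l + of_real t * (\<delta> * b)) * complex_of_real (inverse (N t))) has_vector_derivative
       \<delta> * b / of_real q - z $ l * of_real (2 * (z $ j \<bullet> b)) / of_real (q^2)) (at 0)"
      by (simp add: N_def divide_inverse mult_ac)
    have op: "open ((\<lambda>t::real. z + t *\<^sub>R axis j b) -` (- {0}))"
      by (intro open_vimage continuous_intros)
    show "((\<lambda>t. P (z + t *\<^sub>R axis j b)) has_vector_derivative
       \<delta> * b / of_real q - z $ l * of_real (2 * (z $ j \<bullet> b)) / of_real (q^2)) (at 0)"
    proof (rule has_vector_derivative_transform_within_open[OF D op])
      show "0 \<in> (\<lambda>t::real. z + t *\<^sub>R axis j b) -` (- {0})" using assms by simp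
      fix t :: real assume "t \<in> (\<lambda>t::real. z + t *\<^sub>R axis j b) -` (- {0})"
      then have nz: "z + t *\<^sub>R axis j b \<noteq> 0" by simp
      have "(z + t *\<^sub>R axis j b) $ l = z $ l + of_real t * (\<delta> * b)"
        by (auto simp: axis_def \<delta>_def scaleR_conv_of_real[where 'a=complex])
      then show "(z $ l + of_real t * (\<delta> * b)) * complex_of_real (inverse (N t)) = P (z + t *\<^sub>R axis j b)"
        unfolding P_def partial_zbar_log_norm[OF nz] norm_add_axis_power2
        by (simp add: N_def q_def divide_inverse)
    qed
  qed
  have c: "cnj (z $ j) = of_real (Re (z $ j)) - \<i> * of_real (Im (z $ j))"
    by (simp add: complex_eq_iff)
  have "FS_coeff z j l = ((\<delta> * 1 / of_real q - z $ l * of_real (2 * (z $ j \<bullet> 1)) / of_real (q^2))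
     - \<i> * (\<delta> * \<i> / of_real q - z $ l * of_real (2 * (z $ j \<bullet> \<i>)) / of_real (q^2))) / 2"
    unfolding FS_coeff_def partial_z_def P_def[symmetric] d ..
  also have "\<dots> = \<delta> / of_real q - z $ l * cnj (z $ j) / of_real (q^2)"
  proof -
    have e: "(\<delta> * 1 * Q - y * (2 * a) * P) - \<i> * (\<delta> * \<i> * Q - y * (2 * b) * P) = 2 * (\<delta> * Q - y * (a - \<i> * b) * P)"
      for Q P y a b :: complex by (simp add: algebra_simps)
    have "((\<delta> * 1 / Q - y * (2 * a) / P) - \<i> * (\<delta> * \<i> / Q - y * (2 * b) / P)) / 2 = \<delta> / Q - y * (a - \<i> * b) / P"
      for Q P y a b :: complex
      using e[where Q = "inverse Q" and P = "inverse P"]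
      unfolding divide_inverse[where b = Q] divide_inverse[where b = P] by (simp only:) simp
    moreover have "of_real (2 * (z $ j \<bullet> 1)) = 2 * complex_of_real (Re (z $ j))"
      "of_real (2 * (z $ j \<bullet> \<i>)) = 2 * complex_of_real (Im (z $ j))"
      by (simp_all add: inner_complex_def)
    ultimately show ?thesis unfolding c by (simp only:)
  qed
  finally show ?thesis by (simp add: \<delta>_def q_def)
qed

lemma affine_chart_nonzero: "affine_chart k \<zeta> \<noteq> 0"
proof
  assume "affine_chart k \<zeta> = 0"
  then have "affine_chart k \<zeta> $ k = 0" by simp
  then show False by (simp add: affine_chart_def)
qed

lemma power2_norm_vec: "(norm (z :: complex ^ 'n::finite))\<^sup>2 = (\<Sum>i\<in>UNIV. (cmod (z $ i))\<^sup>2)"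
  by (simp add: norm_vec_def L2_set_def sum_nonneg)

text \<open>
  The Hessian of \<open>ln |z|\<^sup>2\<close> is \<open>|z|\<^sup>-\<^sup>2\<close> times the identity minus a matrix of rank one; in the chart, where
  \<open>z\<^sub>k = 1\<close>, the rank-one determinant formula leaves one further factor \<open>|z|\<^sup>-\<^sup>2\<close>.
\<close>

lemma FS_density_eq:
  fixes k :: "'n::finite"
  shows "FS_density k \<zeta> = fact (CARD('n) - 1) / pi ^ (CARD('n) - 1) * inverse ((norm (affine_chart k \<zeta>))\<^sup>2 ^ CARD('n))"
proof -
  define z where "z = affine_chart k \<zeta>"
  have z0: "z \<noteq> 0" by (simp add: z_def affine_chart_nonzero)
  have zk: "z $ k = 1" by (simp add: z_def affine_chart_def)
  define q where "q = (norm z)\<^sup>2"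
  have q: "q > 0" using z0 by (simp add: q_def)
  define u where "u i = (if i = k then 0 else - cnj (z $ i) / of_real q)" for i
  define v where "v = (\<chi> l. if l = k then 0 else z $ l)"
  define d where "d i = (if i = k then 1 else inverse (complex_of_real q))" for i
  have "(\<chi> j l. if j \<noteq> k \<and> l \<noteq> k then FS_coeff z j l else if j = l then 1 else 0)
     = (\<chi> i. d i *s (axis i 1 + u i *s v))"
    using q by (auto simp: vec_eq_iff FS_coeff_eq[OF z0] d_def u_def v_def axis_def q_def[symmetric]
        power4_eq_xxxx power2_eq_square field_simps q_def)
  then have "det (\<chi> j l. if j \<noteq> k \<and> l \<noteq> k then FS_coeff z j l else if j = l then 1 else 0)
     = det (\<chi> i. d i *s (axis i 1 + u i *s v))"
    by (rule arg_cong)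
  also have "\<dots> = prod d UNIV * (1 + (\<Sum>i\<in>UNIV. u i * v $ i))"
    by (simp only: det_rows_mul det_identity_plus_rank_1)
  also have "prod d UNIV = inverse (of_real q) ^ (CARD('n) - 1)"
  proof -
    have "prod d UNIV = prod d (UNIV - {k})"
      by (rule prod.mono_neutral_right) (auto simp: d_def)
    also have "\<dots> = (\<Prod>i\<in>UNIV - {k}. inverse (of_real q))"
      by (rule prod.cong) (auto simp: d_def)
    finally show ?thesis by (simp add: card_Diff_singleton)
  qed
  also have "1 + (\<Sum>i\<in>UNIV. u i * v $ i) = inverse (of_real q)"
  proof -
    have "(\<Sum>i\<in>UNIV. u i * v $ i) = (\<Sum>i\<in>UNIV - {k}. - of_real ((cmod (z $ i))\<^sup>2) / of_real q)"
    proof (rule sum.mono_neutral_cong_right)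
      have "cnj a * a = of_real ((cmod a)\<^sup>2)" for a
        by (metis complex_norm_square mult.commute)
      then show "u i * v $ i = - of_real ((cmod (z $ i))\<^sup>2) / of_real q" if "i \<in> UNIV - {k}" for i
        using that by (simp add: u_def v_def)
    qed (auto simp: u_def)
    also have "\<dots> = - of_real (\<Sum>i\<in>UNIV - {k}. (cmod (z $ i))\<^sup>2) / of_real q"
      by (simp add: sum_divide_distrib[symmetric] sum_negf)
    also have "(\<Sum>i\<in>UNIV - {k}. (cmod (z $ i))\<^sup>2) = q - 1"
      unfolding q_def power2_norm_vec by (subst sum.remove[of _ k]) (auto simp: zk)
    finally show ?thesis using q by (simp add: field_simps)
  qed
  also have "inverse (of_real q) ^ (CARD('n) - 1) * inverse (of_real q) = complex_of_real (inverse (q ^ CARD('n)))"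
    using power_minus_mult[of "CARD('n)" "inverse (complex_of_real q)"] by (simp add: power_inverse)
  finally have "Re (det (\<chi> j l. if j \<noteq> k \<and> l \<noteq> k then FS_coeff z j l else if j = l then 1 else 0)) = inverse (q ^ CARD('n))"
    by (simp only: Re_complex_of_real)
  then show ?thesis
    unfolding FS_density_def z_def[symmetric] q_def by simp
qed

section \<open>The Fubini--Study volume as the angular part of Lebesgue measure\<close>

abbreviation lborel_pow :: "'i set \<Rightarrow> ('i \<Rightarrow> complex) measure" where
  "lborel_pow I \<equiv> \<Pi>\<^sub>M j\<in>I. lborel"

interpretation lborel_pow: product_sigma_finite "\<lambda>_::'n. lborel :: complex measure"
  by unfold_locales

lemma measurable_vec_lambda_PiM [measurable]:
  "(\<lambda>\<zeta>. \<chi> j. \<zeta> j) \<in> measurable (lborel_pow (UNIV :: 'n::finite set)) borel"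
proof (subst borel_measurable_euclidean_space, rule ballI)
  fix b :: "complex ^ 'n" assume "b \<in> Basis"
  then obtain i c where b: "b = axis i c" by (auto simp: Basis_vec_def)
  have "(\<lambda>\<zeta>. \<zeta> i \<bullet> c) \<in> borel_measurable (lborel_pow (UNIV :: 'n set))"
    by measurable
  then show "(\<lambda>\<zeta>. (\<chi> j. \<zeta> j) \<bullet> b) \<in> borel_measurable (lborel_pow (UNIV :: 'n set))"
    by (simp add: b inner_axis)
qed

lemma lborel_eq_distr_PiM:
  "distr (lborel_pow (UNIV :: 'n::finite set)) borel (\<lambda>\<zeta>. \<chi> j. \<zeta> j) = lborel"
proof (rule lborel_eqI[symmetric])
  fix l u :: "complex ^ 'n" assume lu: "\<And>b. b \<in> Basis \<Longrightarrow> l \<bullet> b \<le> u \<bullet> b"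
  have lu': "l $ j \<bullet> c \<le> u $ j \<bullet> c" if "c \<in> Basis" for j c
    using lu[of "axis j c"] that by (simp add: inner_axis)
  have B: "(Basis :: (complex ^ 'n) set) = (\<lambda>(j, c). axis j c) ` (UNIV \<times> Basis)"
    by (auto simp: Basis_vec_def)
  have inj: "inj_on (\<lambda>(j, c). axis j c :: complex ^ 'n) (UNIV \<times> Basis)"
    by (auto simp: inj_on_def axis_eq_axis)
  have "(\<lambda>\<zeta>. \<chi> j. \<zeta> j) -` box l u \<inter> space (lborel_pow (UNIV :: 'n set))
     = (\<Pi>\<^sub>E j\<in>UNIV. box (l $ j) (u $ j))"
    by (auto simp: space_PiM box_def B inner_axis)
  then have "emeasure (distr (lborel_pow (UNIV :: 'n set)) borel (\<lambda>\<zeta>. \<chi> j. \<zeta> j)) (box l u)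
     = emeasure (lborel_pow (UNIV :: 'n set)) (\<Pi>\<^sub>E j\<in>UNIV. box (l $ j) (u $ j))"
    by (subst emeasure_distr) auto
  also have "\<dots> = (\<Prod>j\<in>UNIV. emeasure (lborel :: complex measure) (box (l $ j) (u $ j)))"
    by (rule lborel_pow.emeasure_PiM) auto
  also have "\<dots> = (\<Prod>j\<in>UNIV. ennreal (\<Prod>c\<in>Basis. (u $ j - l $ j) \<bullet> c))"
    using lu' by (intro prod.cong emeasure_lborel_box) auto
  also have "\<dots> = ennreal (\<Prod>j\<in>UNIV. \<Prod>c\<in>Basis. (u $ j - l $ j) \<bullet> c)"
    using lu' by (intro prod_ennreal prod_nonneg) (auto simp: inner_diff_left)
  also have "(\<Prod>j\<in>UNIV. \<Prod>c\<in>Basis. (u $ j - l $ j) \<bullet> c) = (\<Prod>b\<in>Basis. (u - l) \<bullet> b)"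
    unfolding B prod.reindex[OF inj] by (simp add: prod.cartesian_product inner_axis case_prod_unfold)
  finally show "emeasure (distr (lborel_pow (UNIV :: 'n set)) borel (\<lambda>\<zeta>. \<chi> j. \<zeta> j)) (box l u)
     = ennreal (prod ((\<bullet>) (u - l)) Basis)"
    by simp
qed simp

lemma nn_integral_PiM_scale:
  assumes I: "finite I" and c: "c \<noteq> 0"
    and f: "f \<in> borel_measurable (lborel_pow I)"
  shows "(\<integral>\<^sup>+\<zeta>. f \<zeta> \<partial>(lborel_pow I))
    = ennreal ((cmod c)\<^sup>2) ^ card I * (\<integral>\<^sup>+\<zeta>. f (\<lambda>j\<in>I. c * \<zeta> j) \<partial>(lborel_pow I))"
  using I f
proof (induction I arbitrary: f)
  case empty
  have "(\<lambda>j\<in>{}. c * \<zeta> j) = (\<lambda>_. undefined)" for \<zeta> :: "'a \<Rightarrow> complex" by auto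
  then show ?case by (simp add: PiM_empty nn_integral_count_space_finite)
next
  case (insert i I)
  note [measurable] = insert.prems
  have "(\<integral>\<^sup>+\<zeta>. f \<zeta> \<partial>(lborel_pow (insert i I)))
     = (\<integral>\<^sup>+x. (\<integral>\<^sup>+y. f (x(i := y)) \<partial>lborel) \<partial>(lborel_pow I))"
    by (rule lborel_pow.product_nn_integral_insert) (use insert in auto)
  also have "\<dots> = (\<integral>\<^sup>+x. ennreal ((cmod c)\<^sup>2) * (\<integral>\<^sup>+y. f (x(i := c * y)) \<partial>lborel) \<partial>(lborel_pow I))"
  proof (rule nn_integral_cong)
    fix x assume "x \<in> space (lborel_pow I)"
    then have "(\<lambda>y. f (x(i := y))) \<in> borel_measurable lborel"
      by (intro measurable_compose[OF measurable_component_update insert.prems]) (use insert in auto)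
    then show "(\<integral>\<^sup>+y. f (x(i := y)) \<partial>lborel) = ennreal ((cmod c)\<^sup>2) * (\<integral>\<^sup>+y. f (x(i := c * y)) \<partial>lborel)"
      by (intro nn_integral_lborel_mult_complex[where h = "\<lambda>y. f (x(i := y))"] c) simp
  qed
  also have "\<dots> = ennreal ((cmod c)\<^sup>2) * (\<integral>\<^sup>+x. (\<integral>\<^sup>+y. f (x(i := c * y)) \<partial>lborel) \<partial>(lborel_pow I))"
    by (rule nn_integral_cmult) measurable
  also have "(\<integral>\<^sup>+x. (\<integral>\<^sup>+y. f (x(i := c * y)) \<partial>lborel) \<partial>(lborel_pow I))
     = ennreal ((cmod c)\<^sup>2) ^ card I * (\<integral>\<^sup>+x. (\<integral>\<^sup>+y. f ((\<lambda>j\<in>I. c * x j)(i := c * y)) \<partial>lborel) \<partial>(lborel_pow I))"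
    by (rule insert.IH) measurable
  also have "(\<integral>\<^sup>+x. (\<integral>\<^sup>+y. f ((\<lambda>j\<in>I. c * x j)(i := c * y)) \<partial>lborel) \<partial>(lborel_pow I))
     = (\<integral>\<^sup>+x. (\<integral>\<^sup>+y. f (\<lambda>j\<in>insert i I. c * (x(i := y)) j) \<partial>lborel) \<partial>(lborel_pow I))"
    by (intro nn_integral_cong arg_cong[where f = f] ext) (use insert in \<open>auto simp: restrict_def\<close>)
  also have "\<dots> = (\<integral>\<^sup>+\<zeta>. f (\<lambda>j\<in>insert i I. c * \<zeta> j) \<partial>(lborel_pow (insert i I)))"
    by (rule lborel_pow.product_nn_integral_insert[symmetric]) (use insert in \<open>auto intro!: measurable_compose[OF _ insert.prems] measurable_restrict\<close>)
  finally show ?case by (simp only: card_insert_disjoint[OF insert.hyps(1,2)] power_Suc mult.assoc)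
qed

lemma measurable_affine_chart [measurable]:
  "affine_chart k \<in> measurable (lborel_pow (- {k :: 'n::finite})) borel"
proof (subst borel_measurable_euclidean_space, rule ballI)
  fix b :: "complex ^ 'n" assume "b \<in> Basis"
  then obtain i c where b: "b = axis i c" by (auto simp: Basis_vec_def)
  have "(\<lambda>\<zeta>. (if i = k then 1 else \<zeta> i) \<bullet> c) \<in> borel_measurable (lborel_pow (- {k}))"
    by (cases "i = k") auto
  then show "(\<lambda>\<zeta>. affine_chart k \<zeta> \<bullet> b) \<in> borel_measurable (lborel_pow (- {k}))"
    by (simp add: b inner_axis affine_chart_def)
qed

text \<open>
  The substitution \<open>x = c (1, \<zeta>)\<close>, with the coordinate \<open>1\<close> at position \<open>k\<close>, has Jacobian \<open>|c|\<^sup>2\<^sup>n\<^sup>-\<^sup>2\<close>,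
  and replacing \<open>c\<close> by \<open>c / |(1, \<zeta>)|\<close> separates the two variables.
\<close>

lemma nn_integral_homogeneous_chart:
  fixes f :: "complex ^ 'n::finite \<Rightarrow> ennreal" and W :: "real \<Rightarrow> ennreal"
  assumes f[measurable]: "f \<in> borel_measurable borel" and W[measurable]: "W \<in> borel_measurable borel"
    and hom: "\<And>c x. c \<noteq> 0 \<Longrightarrow> f (c *s x) = f x"
  shows "(\<integral>\<^sup>+x. f x * W (norm x) \<partial>lborel)
    = (\<integral>\<^sup>+c. ennreal ((cmod c)\<^sup>2) ^ (CARD('n) - 1) * W (cmod c) \<partial>lborel)
      * (\<integral>\<^sup>+\<zeta>. f (affine_chart k \<zeta>) * ennreal (inverse ((norm (affine_chart k \<zeta>))\<^sup>2 ^ CARD('n))) \<partial>(lborel_pow (- {k})))"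
proof -
  let ?P = "lborel_pow (- {k})"
  define n where "n = CARD('n) - 1"
  have ins: "insert k (- {k}) = (UNIV :: 'n set)" by auto
  have cardk: "card (- {k}) = n" by (simp add: n_def Compl_eq_Diff_UNIV card_Diff_singleton)
  have Cn: "CARD('n) = Suc n" by (simp add: n_def)
  interpret P: sigma_finite_measure ?P by (rule lborel_pow.sigma_finite) simp
  interpret PP: pair_sigma_finite lborel ?P
    by (intro pair_sigma_finite.intro sigma_finite_lborel P.sigma_finite_measure_axioms)
  define F where "F \<zeta> = f (\<chi> j. \<zeta> j) * W (norm (\<chi> j. \<zeta> j :: complex ^ 'n))" for \<zeta>
  have F[measurable]: "F \<in> borel_measurable (lborel_pow (insert k (- {k})))"
    unfolding F_def ins by measurable
  have "(\<integral>\<^sup>+x. f x * W (norm x) \<partial>lborel) = (\<integral>\<^sup>+\<zeta>. F \<zeta> \<partial>(lborel_pow (insert k (- {k}))))"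
    by (subst lborel_eq_distr_PiM[symmetric], subst nn_integral_distr) (auto simp: F_def[abs_def] ins)
  also have "\<dots> = (\<integral>\<^sup>+c. (\<integral>\<^sup>+\<zeta>. F (\<zeta>(k := c)) \<partial>?P) \<partial>lborel)"
    by (rule lborel_pow.product_nn_integral_insert_rev) auto
  also have "\<dots> = (\<integral>\<^sup>+c. (\<integral>\<^sup>+\<zeta>. ennreal ((cmod c)\<^sup>2) ^ n * (f (affine_chart k \<zeta>) * W (cmod c * norm (affine_chart k \<zeta>))) \<partial>?P) \<partial>lborel)"
  proof (rule nn_integral_cong_AE)
    have "AE c in lborel. c \<noteq> (0::complex)" by (rule AE_lborel_singleton)
    then show "AE c in lborel. (\<integral>\<^sup>+\<zeta>. F (\<zeta>(k := c)) \<partial>?P)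
      = (\<integral>\<^sup>+\<zeta>. ennreal ((cmod c)\<^sup>2) ^ n * (f (affine_chart k \<zeta>) * W (cmod c * norm (affine_chart k \<zeta>))) \<partial>?P)"
    proof eventually_elim
      fix c :: complex assume c: "c \<noteq> 0"
      have m: "(\<lambda>\<zeta>. F (\<zeta>(k := c))) \<in> borel_measurable ?P"
        by (rule measurable_compose[OF _ F]) (auto intro!: measurable_fun_upd[where J = "- {k}"] measurable_ident)
      have "(\<integral>\<^sup>+\<zeta>. F (\<zeta>(k := c)) \<partial>?P) = ennreal ((cmod c)\<^sup>2) ^ n * (\<integral>\<^sup>+\<zeta>. F ((\<lambda>j\<in>-{k}. c * \<zeta> j)(k := c)) \<partial>?P)"
        by (subst nn_integral_PiM_scale[OF _ c m]) (auto simp: cardk)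
      also have "\<dots> = (\<integral>\<^sup>+\<zeta>. ennreal ((cmod c)\<^sup>2) ^ n * F ((\<lambda>j\<in>-{k}. c * \<zeta> j)(k := c)) \<partial>?P)"
        by (rule nn_integral_cmult[symmetric])
          (rule measurable_compose[OF _ m], auto intro!: measurable_restrict)
      also have "(\<lambda>\<zeta>. F ((\<lambda>j\<in>-{k}. c * \<zeta> j)(k := c))) = (\<lambda>\<zeta>. f (affine_chart k \<zeta>) * W (cmod c * norm (affine_chart k \<zeta>)))"
      proof
        fix \<zeta>
        have "(\<chi> j. ((\<lambda>j\<in>-{k}. c * \<zeta> j)(k := c)) j) = c *s affine_chart k \<zeta>"
          by (auto simp: vec_eq_iff affine_chart_def)
        then show "F ((\<lambda>j\<in>-{k}. c * \<zeta> j)(k := c)) = f (affine_chart k \<zeta>) * W (cmod c * norm (affine_chart k \<zeta>))"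
          unfolding F_def by (simp only: hom[OF c] norm_vector_smult)
      qed
      finally show "(\<integral>\<^sup>+\<zeta>. F (\<zeta>(k := c)) \<partial>?P)
        = (\<integral>\<^sup>+\<zeta>. ennreal ((cmod c)\<^sup>2) ^ n * (f (affine_chart k \<zeta>) * W (cmod c * norm (affine_chart k \<zeta>))) \<partial>?P)" .
    qed
  qed
  also have "\<dots> = (\<integral>\<^sup>+\<zeta>. (\<integral>\<^sup>+c. ennreal ((cmod c)\<^sup>2) ^ n * (f (affine_chart k \<zeta>) * W (cmod c * norm (affine_chart k \<zeta>))) \<partial>lborel) \<partial>?P)"
    by (rule PP.Fubini'[symmetric]) measurable
  also have "\<dots> = (\<integral>\<^sup>+\<zeta>. (\<integral>\<^sup>+c. ennreal ((cmod c)\<^sup>2) ^ n * W (cmod c) \<partial>lborel)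
      * (f (affine_chart k \<zeta>) * ennreal (inverse ((norm (affine_chart k \<zeta>))\<^sup>2 ^ CARD('n)))) \<partial>?P)"
  proof (rule nn_integral_cong)
    fix \<zeta>
    define h where "h = norm (affine_chart k \<zeta>)"
    have h: "h > 0" by (simp add: h_def affine_chart_nonzero)
    have "(\<integral>\<^sup>+c. ennreal ((cmod c)\<^sup>2) ^ n * W (cmod c * h) \<partial>lborel)
       = ennreal ((cmod (of_real (inverse h)))\<^sup>2) * (\<integral>\<^sup>+c. ennreal ((cmod (of_real (inverse h) * c))\<^sup>2) ^ n * W (cmod (of_real (inverse h) * c) * h) \<partial>lborel)"
      by (rule nn_integral_lborel_mult_complex) (use h in auto)
    also have "(\<integral>\<^sup>+c. ennreal ((cmod (of_real (inverse h) * c))\<^sup>2) ^ n * W (cmod (of_real (inverse h) * c) * h) \<partial>lborel)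
       = (\<integral>\<^sup>+c. ennreal ((inverse h)\<^sup>2 ^ n) * (ennreal ((cmod c)\<^sup>2) ^ n * W (cmod c)) \<partial>lborel)"
    proof (rule nn_integral_cong)
      fix c :: complex
      have "cmod (of_real (inverse h) * c) = inverse h * cmod c" using h by (simp add: norm_mult norm_inverse)
      moreover have "inverse h * cmod c * h = cmod c" using h by simp
      ultimately show "ennreal ((cmod (of_real (inverse h) * c))\<^sup>2) ^ n * W (cmod (of_real (inverse h) * c) * h)
         = ennreal ((inverse h)\<^sup>2 ^ n) * (ennreal ((cmod c)\<^sup>2) ^ n * W (cmod c))"
        by (simp only:) (simp add: power_mult_distrib ennreal_mult ennreal_power mult_ac)
    qed
    also have "\<dots> = ennreal ((inverse h)\<^sup>2 ^ n) * (\<integral>\<^sup>+c. ennreal ((cmod c)\<^sup>2) ^ n * W (cmod c) \<partial>lborel)"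
      by (rule nn_integral_cmult) measurable
    finally have "(\<integral>\<^sup>+c. ennreal ((cmod c)\<^sup>2) ^ n * W (cmod c * h) \<partial>lborel)
      = (ennreal ((inverse h)\<^sup>2) * ennreal ((inverse h)\<^sup>2 ^ n)) * (\<integral>\<^sup>+c. ennreal ((cmod c)\<^sup>2) ^ n * W (cmod c) \<partial>lborel)"
      using h by (simp add: mult_ac norm_inverse)
    also have "ennreal ((inverse h)\<^sup>2) * ennreal ((inverse h)\<^sup>2 ^ n) = ennreal (inverse (h\<^sup>2 ^ CARD('n)))"
      by (simp add: Cn power_inverse ennreal_mult[symmetric])
    finally have I: "(\<integral>\<^sup>+c. ennreal ((cmod c)\<^sup>2) ^ n * W (cmod c * h) \<partial>lborel)
      = ennreal (inverse (h\<^sup>2 ^ CARD('n))) * (\<integral>\<^sup>+c. ennreal ((cmod c)\<^sup>2) ^ n * W (cmod c) \<partial>lborel)" .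
    have "(\<integral>\<^sup>+c. ennreal ((cmod c)\<^sup>2) ^ n * (f (affine_chart k \<zeta>) * W (cmod c * h)) \<partial>lborel)
       = f (affine_chart k \<zeta>) * (\<integral>\<^sup>+c. ennreal ((cmod c)\<^sup>2) ^ n * W (cmod c * h) \<partial>lborel)"
      by (subst nn_integral_cmult[symmetric]) (auto simp: mult_ac)
    then show "(\<integral>\<^sup>+c. ennreal ((cmod c)\<^sup>2) ^ n * (f (affine_chart k \<zeta>) * W (cmod c * norm (affine_chart k \<zeta>))) \<partial>lborel)
      = (\<integral>\<^sup>+c. ennreal ((cmod c)\<^sup>2) ^ n * W (cmod c) \<partial>lborel)
      * (f (affine_chart k \<zeta>) * ennreal (inverse ((norm (affine_chart k \<zeta>))\<^sup>2 ^ CARD('n))))"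
      unfolding h_def[symmetric] I by (simp add: mult_ac)
  qed
  also have "\<dots> = (\<integral>\<^sup>+c. ennreal ((cmod c)\<^sup>2) ^ n * W (cmod c) \<partial>lborel)
      * (\<integral>\<^sup>+\<zeta>. f (affine_chart k \<zeta>) * ennreal (inverse ((norm (affine_chart k \<zeta>))\<^sup>2 ^ CARD('n))) \<partial>?P)"
    by (rule nn_integral_cmult) measurable
  finally show ?thesis unfolding n_def .
qed

lemma proj_eq_iff: "x \<noteq> 0 \<Longrightarrow> y \<noteq> 0 \<Longrightarrow> proj x = proj y \<longleftrightarrow> same_line x y"
  unfolding proj_def
  using Quotient_rel[OF Quotient_cproj, of x y]
  by (auto simp: same_line_def intro: exI[of _ 1])

lemma Robin_proj_proj: "x \<noteq> 0 \<Longrightarrow> Robin_proj V (proj x) = Robin V x"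
  unfolding proj_def by (rule Robin_proj.abs_eq) (auto simp: same_line_def intro: exI[of _ 1])

lemma measurable_proj [measurable]: "proj \<in> borel_measurable borel"
proof (rule borel_measurableI)
  fix S :: "'a cproj set" assume "open S"
  then have o: "open {z::complex ^ 'a. z \<noteq> 0 \<and> proj z \<in> S}" by (simp add: open_cproj_def)
  have "proj -` S = {z::complex ^ 'a. z \<noteq> 0 \<and> proj z \<in> S} \<union> (if proj (0 :: complex ^ 'a) \<in> S then {0} else {})"
    by auto
  then show "proj -` S \<inter> space borel \<in> sets borel" using o by auto
qed

definition chart_dom :: "'n \<Rightarrow> 'n::finite cproj set" where
  "chart_dom k = {p. \<exists>x. x $ k \<noteq> 0 \<and> p = proj x}"

text \<open>
  The homogeneous coordinates with \<open>k\<close>-th entry \<open>1\<close>; the value \<open>0\<close> off the chart is a default.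
\<close>

definition chart_sec :: "'n \<Rightarrow> 'n::finite cproj \<Rightarrow> complex ^ 'n" where
  "chart_sec k p = (if p \<in> chart_dom k then (THE x. x $ k = 1 \<and> p = proj x) else 0)"

lemma proj_smult: "c \<noteq> 0 \<Longrightarrow> x \<noteq> 0 \<Longrightarrow> proj (c *s x) = proj x"
  by (subst proj_eq_iff) (auto simp: same_line_def vector_smult_assoc intro!: exI[of _ "inverse c"])

lemma proj_mem_chart_dom: "x $ k \<noteq> 0 \<Longrightarrow> proj (x :: complex ^ 'n::finite) \<in> chart_dom k"
  by (auto simp: chart_dom_def)

lemma proj_in_chart_dom: "x \<noteq> 0 \<Longrightarrow> proj x \<in> chart_dom k \<longleftrightarrow> x $ k \<noteq> 0"
proof
  assume x: "x \<noteq> 0" and "proj x \<in> chart_dom k"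
  then obtain y where y: "y $ k \<noteq> 0" "proj x = proj y" by (auto simp: chart_dom_def)
  then have "y \<noteq> 0" by auto
  then obtain c where "c \<noteq> 0" "y = c *s x" using proj_eq_iff[OF x] y by (auto simp: same_line_def)
  then show "x $ k \<noteq> 0" using y by auto
qed (auto simp: chart_dom_def)

lemma chart_sec_proj:
  fixes x :: "complex ^ 'n::finite"
  assumes "x $ k \<noteq> 0"
  shows "chart_sec k (proj x) = inverse (x $ k) *s x"
proof -
  have x: "x \<noteq> 0" using assms by auto
  have "(THE y. y $ k = 1 \<and> proj x = proj y) = inverse (x $ k) *s x"
  proof (rule the_equality)
    show "(inverse (x $ k) *s x) $ k = 1 \<and> proj x = proj (inverse (x $ k) *s x)"
      using assms x by (simp add: proj_smult)
    fix y assume y: "y $ k = 1 \<and> proj x = proj y"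
    then have "y \<noteq> 0" by auto
    then obtain c where c: "c \<noteq> 0" "y = c *s x" using proj_eq_iff[OF x] y by (auto simp: same_line_def)
    then have "c * x $ k = 1" using y by simp
    then have "c = inverse (x $ k)" using assms by (simp add: field_simps)
    then show "y = inverse (x $ k) *s x" using c by simp
  qed
  then show ?thesis using assms x by (simp add: chart_sec_def proj_in_chart_dom)
qed

lemma open_chart_dom: "open (chart_dom k)"
proof -
  have "{z. z \<noteq> 0 \<and> proj z \<in> chart_dom k} = (\<lambda>z. z $ k) -` (- {0})"
    by (auto simp: proj_in_chart_dom proj_mem_chart_dom)
  moreover have "open ((\<lambda>z::complex ^ 'a. z $ k) -` (- {0}))"
    by (intro open_vimage continuous_intros)
  ultimately show ?thesis by (simp add: open_cproj_def)
qed

lemma measurable_chart_sec: "chart_sec k \<in> borel_measurable borel"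
proof (rule borel_measurableI)
  fix S :: "(complex ^ 'a) set" assume S: "open S"
  define T where "T = {p \<in> chart_dom k. chart_sec k p \<in> S}"
  have "{z. z \<noteq> 0 \<and> proj z \<in> T} = {z. z $ k \<noteq> 0 \<and> inverse (z $ k) *s z \<in> S}"
    by (auto simp: T_def proj_in_chart_dom proj_mem_chart_dom chart_sec_proj)
  moreover have "open {z::complex ^ 'a. z $ k \<noteq> 0 \<and> inverse (z $ k) *s z \<in> S}"
  proof -
    have c: "continuous_on {z::complex ^ 'a. z $ k \<noteq> 0} (\<lambda>z. inverse (z $ k) *s z)"
      by (intro continuous_intros) auto
    have "open {z::complex ^ 'a. z $ k \<noteq> 0}"
      by (intro open_Collect_neq continuous_intros)
    from continuous_open_preimage[OF c this S]
    have "open ({z::complex ^ 'a. z $ k \<noteq> 0} \<inter> (\<lambda>z. inverse (z $ k) *s z) -` S)" .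
    moreover have "{z::complex ^ 'a. z $ k \<noteq> 0} \<inter> (\<lambda>z. inverse (z $ k) *s z) -` S
       = {z. z $ k \<noteq> 0 \<and> inverse (z $ k) *s z \<in> S}" by blast
    ultimately show ?thesis by metis
  qed
  ultimately have "open T" by (simp add: open_cproj_def)
  then have T: "T \<in> sets borel" by (rule borel_open)
  have D: "- chart_dom k \<in> sets borel"
    by (rule borel_closed) (simp add: closed_Compl open_chart_dom)
  have eq: "chart_sec k -` S \<inter> space borel = T \<union> (if 0 \<in> S then - chart_dom k else {})"
    by (auto simp: T_def chart_sec_def split: if_splits)
  show "chart_sec k -` S \<inter> space borel \<in> sets borel"
    unfolding eq using sets.Un[OF T D] T by (cases "0 \<in> S") (simp_all only: if_True if_False Un_empty_right)
qed

lemma nn_integral_FS_measure_chart: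
  fixes f :: "complex ^ 'n::finite \<Rightarrow> ennreal" and g :: "'n cproj \<Rightarrow> ennreal"
  assumes f[measurable]: "f \<in> borel_measurable borel" and g: "\<And>x. x \<noteq> 0 \<Longrightarrow> g (proj x) = f x"
  shows "(\<integral>\<^sup>+p. g p \<partial>FS_measure_chart k)
    = ennreal (fact (CARD('n) - 1) / pi ^ (CARD('n) - 1)) *
     (\<integral>\<^sup>+\<zeta>. f (affine_chart k \<zeta>) * ennreal (inverse ((norm (affine_chart k \<zeta>))\<^sup>2 ^ CARD('n))) \<partial>(lborel_pow (- {k})))"
proof -
  let ?P = "lborel_pow (- {k})"
  define A :: real where "A = fact (CARD('n) - 1) / pi ^ (CARD('n) - 1)"
  have A: "A \<ge> 0" by (simp add: A_def)
  define g' where "g' p = (if p \<in> chart_dom k then f (chart_sec k p) else 0)" for p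
  have [measurable]: "chart_dom k \<in> sets borel" by (rule borel_open[OF open_chart_dom])
  note measurable_chart_sec[of k, measurable]
  have g'[measurable]: "g' \<in> borel_measurable borel"
    unfolding g'_def by measurable
  have gg': "g p = g' p" if p: "p \<in> chart_dom k" for p
  proof -
    obtain x where x: "x $ k \<noteq> 0" "p = proj x" using p by (auto simp: chart_dom_def)
    then have "x \<noteq> 0" by auto
    have n: "inverse (x $ k) *s x \<noteq> 0" "proj (inverse (x $ k) *s x) = proj x"
      using x \<open>x \<noteq> 0\<close> by (auto simp: proj_smult vec_eq_iff)
    show ?thesis
      using x p n g[OF n(1)] by (simp add: g'_def chart_sec_proj)
  qed
  have dens: "(\<lambda>\<zeta>. ennreal (FS_density k \<zeta>)) \<in> borel_measurable ?P"
    unfolding FS_density_eq by measurable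
  have ch: "proj (affine_chart k \<zeta>) \<in> chart_dom k" for \<zeta>
    by (simp add: proj_in_chart_dom affine_chart_nonzero) (simp add: affine_chart_def)
  have "AE p in FS_measure_chart k. p \<in> chart_dom k"
    unfolding FS_measure_chart_def by (subst AE_distr_iff) (auto simp: ch)
  then have "(\<integral>\<^sup>+p. g p \<partial>FS_measure_chart k) = (\<integral>\<^sup>+p. g' p \<partial>FS_measure_chart k)"
    by (intro nn_integral_cong_AE) (auto elim!: eventually_mono gg')
  also have "\<dots> = (\<integral>\<^sup>+\<zeta>. ennreal (FS_density k \<zeta>) * g' (proj (affine_chart k \<zeta>)) \<partial>?P)"
    unfolding FS_measure_chart_def
    by (subst nn_integral_distr) (auto intro!: nn_integral_density dens)
  also have "\<dots> = (\<integral>\<^sup>+\<zeta>. ennreal A * (f (affine_chart k \<zeta>) * ennreal (inverse ((norm (affine_chart k \<zeta>))\<^sup>2 ^ CARD('n)))) \<partial>?P)"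
  proof (rule nn_integral_cong)
    fix \<zeta>
    have "g' (proj (affine_chart k \<zeta>)) = f (affine_chart k \<zeta>)"
      using gg'[OF ch[of \<zeta>]] g[OF affine_chart_nonzero[of k \<zeta>]] by simp
    then show "ennreal (FS_density k \<zeta>) * g' (proj (affine_chart k \<zeta>)) = ennreal A * (f (affine_chart k \<zeta>) * ennreal (inverse ((norm (affine_chart k \<zeta>))\<^sup>2 ^ CARD('n))))"
      unfolding FS_density_eq A_def[symmetric] using A by (simp add: ennreal_mult mult_ac)
  qed
  also have "\<dots> = ennreal A * (\<integral>\<^sup>+\<zeta>. f (affine_chart k \<zeta>) * ennreal (inverse ((norm (affine_chart k \<zeta>))\<^sup>2 ^ CARD('n))) \<partial>?P)"
    by (rule nn_integral_cmult) measurable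
  finally show ?thesis by (simp add: A_def)
qed

text \<open>
  In polar coordinates the Fubini--Study volume is the angular part of Lebesgue measure. The constant
  \<open>K\<close> collects the radial integral of \<open>W\<close> and the normalizing factor of the volume.
\<close>

lemma nn_integral_homogeneous_FS:
  fixes W :: "real \<Rightarrow> ennreal"
  assumes W[measurable]: "W \<in> borel_measurable borel"
  shows "\<exists>K. \<forall>f g. f \<in> borel_measurable borel \<longrightarrow> (\<forall>c x. c \<noteq> 0 \<longrightarrow> f (c *s x) = f x) \<longrightarrow>
     (\<forall>x. x \<noteq> 0 \<longrightarrow> g (proj x) = f x) \<longrightarrow>
     (\<integral>\<^sup>+x. f x * W (norm (x :: complex ^ 'n::finite)) \<partial>lborel) = K * (\<integral>\<^sup>+p. g p \<partial>FS_measure)"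
proof -
  define k :: 'n where "k = (SOME k. True)"
  define A :: real where "A = fact (CARD('n) - 1) / pi ^ (CARD('n) - 1)"
  have A: "A > 0" by (simp add: A_def)
  define K where "K = (\<integral>\<^sup>+(c::complex). ennreal ((cmod c)\<^sup>2) ^ (CARD('n) - 1) * W (cmod c) \<partial>lborel) * ennreal (inverse A)"
  show ?thesis
  proof (intro exI allI impI)
    fix f :: "complex ^ 'n \<Rightarrow> ennreal" and g
    assume f1: "f \<in> borel_measurable borel" "\<forall>c x. c \<noteq> 0 \<longrightarrow> f (c *s x) = f x" "\<forall>x. x \<noteq> 0 \<longrightarrow> g (proj x) = f x"
    then have f: "f \<in> borel_measurable borel" "\<And>c x. c \<noteq> 0 \<Longrightarrow> f (c *s x) = f x" "\<And>x. x \<noteq> 0 \<Longrightarrow> g (proj x) = f x"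
      by blast+
    have FS: "(\<integral>\<^sup>+p. g p \<partial>FS_measure) = ennreal A * (\<integral>\<^sup>+\<zeta>. f (affine_chart k \<zeta>) * ennreal (inverse ((norm (affine_chart k \<zeta>))\<^sup>2 ^ CARD('n))) \<partial>(lborel_pow (- {k})))"
      unfolding FS_measure_def A_def k_def[symmetric] by (rule nn_integral_FS_measure_chart[OF f(1,3)])
    have H: "(\<integral>\<^sup>+x. f x * W (norm x) \<partial>lborel)
      = (\<integral>\<^sup>+(c::complex). ennreal ((cmod c)\<^sup>2) ^ (CARD('n) - 1) * W (cmod c) \<partial>lborel)
      * (\<integral>\<^sup>+\<zeta>. f (affine_chart k \<zeta>) * ennreal (inverse ((norm (affine_chart k \<zeta>))\<^sup>2 ^ CARD('n))) \<partial>(lborel_pow (- {k})))"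
      by (rule nn_integral_homogeneous_chart) (use f W in auto)
    have "ennreal (inverse A) * ennreal A = 1" using A by (simp flip: ennreal_mult)
    then show "(\<integral>\<^sup>+x. f x * W (norm x) \<partial>lborel) = K * (\<integral>\<^sup>+p. g p \<partial>FS_measure)"
      using H by (simp only: FS K_def mult.assoc mult.assoc[symmetric, of "ennreal (inverse A)" "ennreal A"] mult_1)
  qed
qed

section \<open>Averages of Lelong functions\<close>

lemma lborel_affine_integral:
  fixes f :: "'a::euclidean_space \<Rightarrow> real"
  assumes f: "integrable lborel f" and c: "c \<noteq> 0"
  shows "integrable lborel (\<lambda>x. f (t + c *\<^sub>R x))"
    and "(\<integral>x. f x \<partial>lborel) = \<bar>c\<bar> ^ DIM('a) * (\<integral>x. f (t + c *\<^sub>R x) \<partial>lborel)"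
proof -
  have [measurable]: "f \<in> borel_measurable borel" using f by auto
  have i: "integrable (density (distr lborel borel (\<lambda>x. t + c *\<^sub>R x)) (\<lambda>_. ennreal (\<bar>c\<bar> ^ DIM('a)))) f"
    using f by (subst (asm) lborel_affine[OF c, of t])
  show "integrable lborel (\<lambda>x. f (t + c *\<^sub>R x))"
    using i c by (subst (asm) integrable_density) (auto simp: integrable_distr_eq)
  show "(\<integral>x. f x \<partial>lborel) = \<bar>c\<bar> ^ DIM('a) * (\<integral>x. f (t + c *\<^sub>R x) \<partial>lborel)"
    by (subst lborel_affine[OF c, of t]) (simp add: integral_density integral_distr)
qed

lemma AE_lborel_affine:
  fixes P :: "'a::euclidean_space \<Rightarrow> bool"
  assumes P: "AE x in lborel. P x" and [measurable]: "Measurable.pred borel P" and c: "c \<noteq> 0"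
  shows "AE x in lborel. P (t + c *\<^sub>R x)"
  using P c by (subst (asm) lborel_affine[OF c, of t]) (auto simp: AE_density AE_distr_iff)

lemma ennreal_affine_le:
  fixes X Y Z :: ennreal
  assumes p: "0 < p" "p < 1"
    and le: "\<And>a b. 0 \<le> a \<Longrightarrow> 0 \<le> b \<Longrightarrow> ennreal a \<le> X \<Longrightarrow> ennreal b \<le> Y \<Longrightarrow> ennreal ((1 - p) * a + p * b) \<le> Z"
  shows "ennreal (1 - p) * X + ennreal p * Y \<le> Z"
proof (cases "Z = top")
  case False
  then obtain c where c: "Z = ennreal c" "0 \<le> c" by (cases Z) auto
  have "X \<noteq> top"
  proof
    assume "X = top"
    then have "ennreal ((1 - p) * ((c + 1) / (1 - p)) + p * 0) \<le> Z"
      using p c by (intro le) auto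
    then show False using p c by simp
  qed
  have "Y \<noteq> top"
  proof
    assume "Y = top"
    then have "ennreal ((1 - p) * 0 + p * ((c + 1) / p)) \<le> Z"
      using p c by (intro le) auto
    then show False using p c by simp
  qed
  with \<open>X \<noteq> top\<close> obtain x y where "X = ennreal x" "0 \<le> x" "Y = ennreal y" "0 \<le> y"
    by (cases X; cases Y) auto
  then show ?thesis using le[of x y] p by (simp add: ennreal_mult[symmetric] flip: ennreal_plus)
qed simp

context Lelong_line
begin

text \<open>
  The comparison with affine functions of \<open>ln r\<close>, in the form of an inequality between the means
  themselves.
\<close>

lemma circle_mean_concave:
  assumes xy: "x < y" and p: "0 < p" "p < 1"
    and B: "\<And>l. cmod l \<le> exp y \<Longrightarrow> u l \<le> ereal B"
  defines "N \<equiv> \<lambda>s. \<integral>\<^sup>+\<theta>. e2ennreal (ereal B - u (cis \<theta> * of_real (exp s))) \<partial>circ"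
  shows "ennreal (1 - p) * N x + ennreal p * N y \<le> N ((1 - p) * x + p * y)"
proof (rule ennreal_affine_le[OF p])
  fix a b :: real assume ab: "0 \<le> a" "0 \<le> b" "ennreal a \<le> N x" "ennreal b \<le> N y"
  define k where "k = (b - a) / (y - x)"
  define s where "s = (1 - p) * x + p * y"
  have "p * (y - x) > 0" "(1 - p) * (y - x) > 0" using p xy by auto
  then have s: "x \<le> s" "s \<le> y" by (auto simp: s_def algebra_simps)
  have "ennreal ((a - k * x) + k * ln (exp s)) \<le> (\<integral>\<^sup>+\<theta>. e2ennreal (ereal B - u (cis \<theta> * of_real (exp s))) \<partial>circ)"
  proof (rule circle_concave[where R = "exp y" and ?r1.0 = "exp x" and ?r2.0 = "exp y"])
    show "open {z. e2ennreal (ereal B - u z) > c}" for c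
      by (rule lsc_e2ennreal_diff[OF usc])
    show "(\<integral>\<^sup>+\<theta>. e2ennreal (ereal B - u (a + cis \<theta> * b)) \<partial>circ) \<le> e2ennreal (ereal B - u a)"
      if "cmod a + cmod b \<le> exp y" for a b
    proof (rule supermean[OF B])
      show "cmod (a + cis \<theta> * b) \<le> exp y" for \<theta>
        using that norm_triangle_ineq[of a "cis \<theta> * b"] by (simp add: norm_mult)
    qed
    show "ennreal ((a - k * x) + k * ln (exp x)) \<le> (\<integral>\<^sup>+\<theta>. e2ennreal (ereal B - u (cis \<theta> * of_real (exp x))) \<partial>circ)"
      using ab by (simp add: N_def)
    have "(a - k * x) + k * y = a + k * (y - x)" by (simp add: algebra_simps)
    also have "\<dots> = b" using xy by (simp add: k_def)
    finally show "ennreal ((a - k * x) + k * ln (exp y)) \<le> (\<integral>\<^sup>+\<theta>. e2ennreal (ereal B - u (cis \<theta> * of_real (exp y))) \<partial>circ)"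
      using ab by (simp add: N_def)
  qed (use s in auto)
  moreover have "(a - k * x) + k * ln (exp s) = (1 - p) * a + p * b"
  proof -
    have "(a - k * x) + k * s = a + p * (k * (y - x))" by (simp add: s_def algebra_simps)
    also have "k * (y - x) = b - a" using xy by (simp add: k_def)
    finally show ?thesis by (simp add: algebra_simps)
  qed
  ultimately show "ennreal ((1 - p) * a + p * b) \<le> N ((1 - p) * x + p * y)"
    by (simp add: N_def s_def)
qed

end

locale Lelong_fn =
  fixes V :: "complex ^ 'n::finite \<Rightarrow> ereal" and C :: real
  assumes usc: "open {z. V z < c}"
    and submean: "V a \<le> ereal_integral circ (\<lambda>\<theta>. V (a + cis \<theta> *s b))"
    and growth: "V z \<le> ereal (ln (max 1 (norm z)) + C)"
    and nontrivial: "\<exists>a. V a \<noteq> -\<infinity>"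
begin

lemma V_borel [measurable]: "V \<in> borel_measurable borel"
  using usc by (intro borel_measurableI_less) auto

lemma V_not_top: "V z \<noteq> \<infinity>"
  using growth[of z] by auto

lemma V_le:
  assumes "1 \<le> R" "norm z \<le> R"
  shows "V z \<le> ereal (ln R + C)"
proof -
  have "ln (max 1 (norm z)) \<le> ln R" using assms by (subst ln_le_cancel_iff) auto
  then show ?thesis using growth[of z] order_trans by fastforce
qed

lemma line: "Lelong_line (\<lambda>l. V (z + l *s x)) (C + ln (1 + norm z + norm x))"
proof
  fix c
  have "open ((\<lambda>l. z + l *s x) -` {y. V y < c})"
    by (intro open_vimage usc continuous_intros)
  then show "open {l. V (z + l *s x) < c}" by (simp add: vimage_def)
next
  fix a b
  have "z + (a + cis \<theta> * b) *s x = (z + a *s x) + cis \<theta> *s (b *s x)" for \<theta>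
    by (simp add: vec_eq_iff algebra_simps)
  then show "V (z + a *s x) \<le> ereal_integral circ (\<lambda>\<theta>. V (z + (a + cis \<theta> * b) *s x))"
    using submean[of "z + a *s x" "b *s x"] by (simp add: add.assoc)
next
  fix l
  define M where "M = max 1 (cmod l)"
  define K where "K = 1 + norm z + norm x"
  have M: "1 \<le> M" "cmod l \<le> M" and K: "1 \<le> K" by (auto simp: M_def K_def)
  have "norm (z + l *s x) \<le> norm z + cmod l * norm x"
    using norm_triangle_ineq[of z "l *s x"] by (simp add: norm_vector_smult)
  also have "\<dots> \<le> M * norm z + M * norm x"
    using M mult_right_mono[of 1 M "norm z"] by (intro add_mono mult_right_mono) auto
  also have "\<dots> \<le> M * K" using M by (simp add: K_def algebra_simps)
  finally have "norm (z + l *s x) \<le> M * K" .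
  moreover have "1 \<le> M * K" using M K mult_mono[of 1 M 1 K] by simp
  ultimately have "V (z + l *s x) \<le> ereal (ln (M * K) + C)" by (intro V_le)
  also have "ln (M * K) = ln M + ln K" using M K by (simp add: ln_mult)
  finally show "V (z + l *s x) \<le> ereal (ln (max 1 (cmod l)) + (C + ln (1 + norm z + norm x)))"
    by (simp add: M_def K_def algebra_simps)
qed

text \<open>
  The values \<open>B - V\<close>, to be used where \<open>V \<le> B\<close>; there \<open>defect B\<close> is superharmonic on complex lines.
\<close>

definition defect :: "real \<Rightarrow> complex ^ 'n \<Rightarrow> ennreal" where
  "defect B x = e2ennreal (ereal B - V x)"

lemma defect_borel [measurable]: "defect B \<in> borel_measurable borel"
  unfolding defect_def by measurable

lemma supermean:
  assumes "\<And>\<theta>. V (a + cis \<theta> *s b) \<le> ereal B"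
  shows "(\<integral>\<^sup>+\<theta>. defect B (a + cis \<theta> *s b) \<partial>circ) \<le> defect B a"
proof -
  interpret L: Lelong_line "\<lambda>l. V (a + l *s b)" "C + ln (1 + norm a + norm b)" by (rule line)
  show ?thesis using L.supermean[of 0 1 B] assms by (simp add: defect_def)
qed

lemma ball_supermean:
  assumes \<rho>: "0 \<le> \<rho>" and B: "\<And>y. norm (y - a) < \<rho> \<Longrightarrow> V y \<le> ereal B"
  shows "(\<integral>\<^sup>+y. defect B y * indicator (ball a \<rho>) y \<partial>lborel) \<le> defect B a * emeasure lborel (ball (0 :: complex ^ 'n) \<rho>)"
proof -
  have "(\<integral>\<^sup>+y. defect B y * indicator (ball a \<rho>) y \<partial>lborel)
     = (\<integral>\<^sup>+y. defect B (a + y) * indicator (ball a \<rho>) (a + y) \<partial>lborel)"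
    by (rule nn_integral_lborel_translate[symmetric]) measurable
  also have "\<dots> = (\<integral>\<^sup>+y. defect B (a + y) * indicator (ball 0 \<rho>) y \<partial>lborel)"
    by (intro nn_integral_cong) (auto split: split_indicator simp: dist_norm)
  also have "\<dots> = (\<integral>\<^sup>+y. (\<integral>\<^sup>+\<theta>. defect B (a + cis \<theta> *s y) * indicator (ball 0 \<rho>) (cis \<theta> *s y) \<partial>circ) \<partial>lborel)"
    by (rule nn_integral_circ_average) measurable
  also have "\<dots> \<le> (\<integral>\<^sup>+(y :: complex ^ 'n). defect B a * indicator (ball 0 \<rho>) y \<partial>lborel)"
  proof (rule nn_integral_mono)
    fix y :: "complex ^ 'n"
    have i: "indicator (ball 0 \<rho>) (cis \<theta> *s y) = (indicator (ball 0 \<rho>) y :: ennreal)" for \<theta>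
      by (auto split: split_indicator simp: norm_vector_smult)
    have "(\<integral>\<^sup>+\<theta>. defect B (a + cis \<theta> *s y) \<partial>circ) \<le> defect B a" if "norm y < \<rho>"
      using that by (intro supermean B) (simp add: norm_vector_smult)
    then show "(\<integral>\<^sup>+\<theta>. defect B (a + cis \<theta> *s y) * indicator (ball 0 \<rho>) (cis \<theta> *s y) \<partial>circ) \<le> defect B a * indicator (ball 0 \<rho>) y"
      unfolding i by (auto split: split_indicator)
  qed
  also have "\<dots> = defect B a * emeasure lborel (ball (0 :: complex ^ 'n) \<rho>)"
    by (simp add: nn_integral_cmult)
  finally show ?thesis .
qed

lemma defect_mono: "B \<le> B' \<Longrightarrow> defect B x \<le> defect B' x"
  unfolding defect_def by (intro e2ennreal_mono ereal_minus_mono) auto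

text \<open>
  Since \<open>V\<close> is defined on the whole space, the mean value inequality on large balls about a single
  point with a finite value controls the integral over every ball.
\<close>

lemma defect_finite_on_ball:
  assumes R: "0 < R"
  shows "(\<integral>\<^sup>+y. defect B y * indicator (ball 0 R) y \<partial>lborel) < \<infinity>"
proof -
  obtain a where a: "V a \<noteq> -\<infinity>" using nontrivial by blast
  define \<rho> where "\<rho> = R + norm a"
  define M where "M = max 1 (\<rho> + norm a)"
  define B' where "B' = max B (ln M + C)"
  have "(\<integral>\<^sup>+y. defect B y * indicator (ball 0 R) y \<partial>lborel)
     \<le> (\<integral>\<^sup>+y. defect B' y * indicator (ball a \<rho>) y \<partial>lborel)"
  proof (rule nn_integral_mono)
    fix y :: "complex ^ 'n"
    have "y \<in> ball a \<rho>" if "y \<in> ball 0 R"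
      using that norm_triangle_ineq4[of a y] by (simp add: \<rho>_def dist_norm)
    then show "defect B y * indicator (ball 0 R) y \<le> defect B' y * indicator (ball a \<rho>) y"
      by (auto split: split_indicator simp: B'_def intro!: defect_mono)
  qed
  also have "\<dots> \<le> defect B' a * emeasure lborel (ball (0 :: complex ^ 'n) \<rho>)"
  proof (rule ball_supermean)
    fix y assume y: "norm (y - a) < \<rho>"
    then have "norm y \<le> M" using norm_triangle_ineq2[of y a] by (simp add: M_def)
    then have "V y \<le> ereal (ln M + C)" by (intro V_le) (auto simp: M_def)
    also have "\<dots> \<le> ereal B'" by (simp add: B'_def)
    finally show "V y \<le> ereal B'" .
  qed (use R in \<open>simp add: \<rho>_def\<close>)
  also have "\<dots> < \<infinity>"
  proof -
    have "defect B' a < top" using a V_not_top[of a] unfolding defect_def by (cases "V a") auto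
    then show ?thesis using emeasure_lborel_ball_finite[of "0 :: complex ^ 'n" \<rho>]
      by (simp add: ennreal_mult_less_top)
  qed
  finally show ?thesis .
qed

definition v :: "complex ^ 'n \<Rightarrow> real" where "v x = real_of_ereal (V x)"

lemma v_borel [measurable]: "v \<in> borel_measurable borel"
  unfolding v_def by measurable

lemma AE_V_eq: "AE x in lborel. V x = ereal (v x)"
proof -
  have "AE x in lborel. \<forall>k::nat. defect 0 x * indicator (ball 0 (real (Suc k))) x \<noteq> \<infinity>"
  proof (subst AE_all_countable, rule allI)
    fix k
    show "AE x in lborel. defect 0 x * indicator (ball 0 (real (Suc k))) x \<noteq> \<infinity>"
      using defect_finite_on_ball[of "real (Suc k)" 0] by (intro nn_integral_PInf_AE) auto
  qed
  then show ?thesis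
  proof eventually_elim
    case (elim x)
    obtain k :: nat where k: "norm x < real k" using reals_Archimedean2 by blast
    then have "x \<in> ball 0 (real (Suc k))" by simp
    then have "defect 0 x \<noteq> \<infinity>" using elim[rule_format, of k] by simp
    then have "V x \<noteq> -\<infinity>" by (auto simp: defect_def)
    then show ?case using V_not_top[of x] by (cases "V x") (auto simp: v_def)
  qed
qed

lemma v_ball_integrable: 
  assumes R: "0 < R"
  shows "integrable lborel (\<lambda>x. indicator (ball 0 R) x * v x)"
proof -
  define B where "B = ln (max 1 R) + C"
  have "(\<integral>\<^sup>+x. ennreal (norm (indicator (ball 0 R) x * v x)) \<partial>lborel)
     \<le> (\<integral>\<^sup>+x. defect B x * indicator (ball 0 R) x + ennreal \<bar>B\<bar> * indicator (ball 0 R) x \<partial>lborel)"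
  proof (rule nn_integral_mono_AE)
    show "AE x in lborel. ennreal (norm (indicator (ball 0 R) x * v x))
      \<le> defect B x * indicator (ball 0 R) x + ennreal \<bar>B\<bar> * indicator (ball 0 R) x"
      using AE_V_eq
    proof eventually_elim
      case (elim x)
      show ?case
      proof (cases "x \<in> ball 0 R")
        case True
        then have "V x \<le> ereal B" unfolding B_def by (intro V_le) auto
        then have "v x \<le> B" using elim by simp
        then have "ennreal \<bar>v x\<bar> \<le> ennreal ((B - v x) + \<bar>B\<bar>)"
          by (intro ennreal_leI) linarith
        also have "\<dots> = ennreal (B - v x) + ennreal \<bar>B\<bar>"
          using \<open>v x \<le> B\<close> by (intro ennreal_plus) auto
        finally have "ennreal \<bar>v x\<bar> \<le> ennreal (B - v x) + ennreal \<bar>B\<bar>" .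
        then show ?thesis using True by (simp add: defect_def elim)
      qed simp
    qed
  qed
  also have "\<dots> = (\<integral>\<^sup>+x. defect B x * indicator (ball 0 R) x \<partial>lborel) + ennreal \<bar>B\<bar> * emeasure lborel (ball (0 :: complex ^ 'n) R)"
    by (subst nn_integral_add) (auto simp: nn_integral_cmult)
  also have "\<dots> < \<infinity>"
    using defect_finite_on_ball[OF R, of B] emeasure_lborel_ball_finite[of "0 :: complex ^ 'n" R]
    by (simp add: ennreal_mult_less_top)
  finally show ?thesis by (intro integrableI_bounded) auto
qed

lemma v_weight_integrable:
  assumes w[measurable]: "w \<in> borel_measurable borel" and M: "\<And>x. \<bar>w x\<bar> \<le> M" and supp: "\<And>x. R \<le> norm x \<Longrightarrow> w x = 0"
  shows "integrable lborel (\<lambda>x. v x * w x)"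
proof (rule Bochner_Integration.integrable_bound)
  define R' where "R' = max 1 R"
  show "integrable lborel (\<lambda>x. M * (indicator (ball 0 R') x * v x))"
    using v_ball_integrable[of R'] by (intro integrable_mult_right) (auto simp: R'_def)
  show "AE x in lborel. norm (v x * w x) \<le> norm (M * (indicator (ball 0 R') x * v x))"
  proof (rule AE_I2)
    fix x :: "complex ^ 'n"
    have "0 \<le> M" using M[of 0] by linarith
    show "norm (v x * w x) \<le> norm (M * (indicator (ball 0 R') x * v x))"
    proof (cases "x \<in> ball 0 R'")
      case True
      then show ?thesis using mult_right_mono[OF M[of x], of "\<bar>v x\<bar>"] \<open>0 \<le> M\<close>
        by (simp add: abs_mult mult.commute)
    next
      case False
      then have "w x = 0" by (intro supp) (auto simp: R'_def)
      then show ?thesis by simp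
    qed
  qed
qed measurable

lemma v_affine_integrable:
  assumes w[measurable]: "w \<in> borel_measurable borel" and M: "\<And>x. \<bar>w x\<bar> \<le> M" and supp: "\<And>x. R \<le> norm x \<Longrightarrow> w x = 0"
    and t: "0 < t"
  shows "integrable lborel (\<lambda>x. v (z + t *\<^sub>R x) * w x)"
proof -
  have "integrable lborel (\<lambda>y. v y * w (inverse t *\<^sub>R (y - z)))"
  proof (rule v_weight_integrable[OF _ M])
    fix y :: "complex ^ 'n" assume y: "norm z + t * R \<le> norm y"
    then have "t * R \<le> norm (y - z)" using norm_triangle_ineq2[of y z] by linarith
    have "R = inverse t * (t * R)" using t by simp
    also have "\<dots> \<le> inverse t * norm (y - z)"
      using t \<open>t * R \<le> norm (y - z)\<close> by (intro mult_left_mono) auto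
    also have "\<dots> = norm (inverse t *\<^sub>R (y - z))" using t by (simp only: norm_scaleR) simp
    finally show "w (inverse t *\<^sub>R (y - z)) = 0" by (rule supp)
  qed measurable
  from lborel_affine_integral(1)[OF this, of t z] show ?thesis using t by simp
qed

end

text \<open>
  The radius \<open>2\<close> leaves room for small translations and dilations of weights that live on the unit ball.
\<close>

definition weight :: "(complex ^ 'n::finite \<Rightarrow> real) \<Rightarrow> bool" where
  "weight w \<longleftrightarrow> w \<in> borel_measurable borel \<and> (\<exists>M. \<forall>x. 0 \<le> w x \<and> w x \<le> M) \<and> (\<forall>x. 2 \<le> norm x \<longrightarrow> w x = 0)"

lemma weightD:
  assumes "weight w"
  obtains M where "w \<in> borel_measurable borel" "\<And>x. 0 \<le> w x" "\<And>x. \<bar>w x\<bar> \<le> M" "\<And>x. 2 \<le> norm x \<Longrightarrow> w x = 0"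
  using assms unfolding weight_def by (metis abs_of_nonneg)

lemma bounded_support_integrable:
  fixes w :: "'a::euclidean_space \<Rightarrow> real"
  assumes w[measurable]: "w \<in> borel_measurable borel" and M: "\<And>x. \<bar>w x\<bar> \<le> M" and supp: "\<And>x. R \<le> norm x \<Longrightarrow> w x = 0"
  shows "integrable lborel w"
proof (rule Bochner_Integration.integrable_bound)
  show "integrable lborel (\<lambda>x. M * indicator (ball (0::'a) R) x)"
    using emeasure_lborel_ball_finite[of "0::'a" R] by (intro integrable_mult_right integrable_real_indicator) auto
  show "AE x in lborel. norm (w x) \<le> norm (M * indicator (ball (0::'a) R) x)"
  proof (rule AE_I2)
    fix x :: 'a
    have "\<bar>w x\<bar> \<le> \<bar>M\<bar>" using M[of x] by linarith
    then show "norm (w x) \<le> norm (M * indicator (ball (0::'a) R) x)"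
      using supp[of x] by (auto split: split_indicator)
  qed
qed measurable

lemma weight_integrable: "weight w \<Longrightarrow> integrable lborel w"
  by (erule weightD) (rule bounded_support_integrable)

context Lelong_fn
begin

definition avg :: "(complex ^ 'n \<Rightarrow> real) \<Rightarrow> complex ^ 'n \<Rightarrow> real \<Rightarrow> real" where
  "avg w z t = (\<integral>x. v (z + t *\<^sub>R x) * w x \<partial>lborel)"

lemma AE_V_affine: "t \<noteq> 0 \<Longrightarrow> AE x in lborel. V (z + t *\<^sub>R x) = ereal (v (z + t *\<^sub>R x))"
  by (rule AE_lborel_affine[OF AE_V_eq]) measurable

lemma defect_avg:
  assumes w: "weight w" and t: "0 < t" and B: "\<And>y. norm y \<le> norm z + 2 * t \<Longrightarrow> V y \<le> ereal B"
  shows "(\<integral>\<^sup>+x. defect B (z + t *\<^sub>R x) * ennreal (w x) \<partial>lborel) = ennreal (B * (\<integral>x. w x \<partial>lborel) - avg w z t)"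
    and "avg w z t \<le> B * (\<integral>x. w x \<partial>lborel)"
proof -
  obtain M where w': "w \<in> borel_measurable borel" "\<And>x. 0 \<le> w x" "\<And>x. \<bar>w x\<bar> \<le> M" "\<And>x. 2 \<le> norm x \<Longrightarrow> w x = 0"
    using weightD[OF w] by blast
  note w'(1)[measurable]
  have iw: "integrable lborel w" by (rule weight_integrable[OF w])
  have iv: "integrable lborel (\<lambda>x. v (z + t *\<^sub>R x) * w x)"
    by (rule v_affine_integrable[OF w'(1,3,4) t])
  have i: "integrable lborel (\<lambda>x. B * w x - v (z + t *\<^sub>R x) * w x)"
    using iw iv by auto
  have nn: "AE x in lborel. 0 \<le> B * w x - v (z + t *\<^sub>R x) * w x \<and>
      defect B (z + t *\<^sub>R x) * ennreal (w x) = ennreal (B * w x - v (z + t *\<^sub>R x) * w x)"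
    using AE_V_affine[of t z, OF less_imp_neq[OF t, symmetric]]
  proof eventually_elim
    case (elim x)
    show ?case
    proof (cases "norm x \<le> 2")
      case True
      then have "t * norm x \<le> t * 2" using t by (intro mult_left_mono) auto
      then have "norm (z + t *\<^sub>R x) \<le> norm z + 2 * t"
        using norm_triangle_ineq[of z "t *\<^sub>R x"] t unfolding norm_scaleR by linarith
      then have le: "v (z + t *\<^sub>R x) \<le> B" using B[of "z + t *\<^sub>R x"] elim by simp
      then have "0 \<le> (B - v (z + t *\<^sub>R x)) * w x" using w'(2) by simp
      moreover have "defect B (z + t *\<^sub>R x) * ennreal (w x) = ennreal ((B - v (z + t *\<^sub>R x)) * w x)"
        using le w'(2) by (simp add: defect_def elim ennreal_mult)
      ultimately show ?thesis by (simp add: left_diff_distrib)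
    next
      case False
      then show ?thesis using w'(4)[of x] by simp
    qed
  qed
  have "(\<integral>\<^sup>+x. defect B (z + t *\<^sub>R x) * ennreal (w x) \<partial>lborel) = (\<integral>\<^sup>+x. ennreal (B * w x - v (z + t *\<^sub>R x) * w x) \<partial>lborel)"
    using nn by (intro nn_integral_cong_AE) auto
  also have "\<dots> = ennreal (\<integral>x. B * w x - v (z + t *\<^sub>R x) * w x \<partial>lborel)"
    using nn by (intro nn_integral_eq_integral[OF i]) auto
  also have e: "(\<integral>x. B * w x - v (z + t *\<^sub>R x) * w x \<partial>lborel) = B * (\<integral>x. w x \<partial>lborel) - avg w z t"
    using iw iv by (simp add: avg_def)
  finally show "(\<integral>\<^sup>+x. defect B (z + t *\<^sub>R x) * ennreal (w x) \<partial>lborel) = ennreal (B * (\<integral>x. w x \<partial>lborel) - avg w z t)" .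
  have "0 \<le> (\<integral>x. B * w x - v (z + t *\<^sub>R x) * w x \<partial>lborel)"
    using nn by (intro integral_nonneg_AE) auto
  then show "avg w z t \<le> B * (\<integral>x. w x \<partial>lborel)" by (simp add: e)
qed

lemma defect_circ_average:
  assumes w[measurable]: "w \<in> borel_measurable borel" and rad: "\<And>\<theta> x. w (cis \<theta> *s x) = w x"
  shows "(\<integral>\<^sup>+x. defect B (z + t *\<^sub>R x) * ennreal (w x) \<partial>lborel)
    = (\<integral>\<^sup>+x. (\<integral>\<^sup>+\<theta>. defect B (z + (cis \<theta> * of_real t) *s x) \<partial>circ) * ennreal (w x) \<partial>lborel)"
proof -
  have e: "z + t *\<^sub>R (cis \<theta> *s x) = z + (cis \<theta> * of_real t) *s x" for \<theta> x
    by (simp add: vector_smult_of_real[symmetric] vector_smult_assoc mult.commute)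
  have "(\<integral>\<^sup>+x. defect B (z + t *\<^sub>R x) * ennreal (w x) \<partial>lborel)
    = (\<integral>\<^sup>+x. (\<integral>\<^sup>+\<theta>. defect B (z + t *\<^sub>R (cis \<theta> *s x)) * ennreal (w (cis \<theta> *s x)) \<partial>circ) \<partial>lborel)"
    by (rule nn_integral_circ_average) measurable
  also have "\<dots> = (\<integral>\<^sup>+x. (\<integral>\<^sup>+\<theta>. defect B (z + (cis \<theta> * of_real t) *s x) \<partial>circ) * ennreal (w x) \<partial>lborel)"
    unfolding e rad by (intro nn_integral_cong nn_integral_multc) (simp cong: measurable_cong_sets)
  finally show ?thesis .
qed

text \<open>
  A radial average is an average of circle means over the complex lines through \<open>z\<close>, each of which is
  convex in the logarithm of the radius.
\<close>

lemma avg_log_convex: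
  assumes w: "weight w" and rad: "\<And>\<theta> x. w (cis \<theta> *s x) = w x"
  shows "convex_on UNIV (\<lambda>s. avg w z (exp s))"
proof (rule convex_on_linorderI)
  fix p x y :: real assume p: "0 < p" "p < 1" and xy: "x < y"
  obtain M where w': "w \<in> borel_measurable borel" "\<And>x. 0 \<le> w x" "\<And>x. \<bar>w x\<bar> \<le> M" "\<And>x. 2 \<le> norm x \<Longrightarrow> w x = 0"
    using weightD[OF w] by blast
  note w'(1)[measurable]
  define s where "s = (1 - p) * x + p * y"
  have "p * (y - x) > 0" "(1 - p) * (y - x) > 0" using p xy by auto
  then have s: "x \<le> s" "s \<le> y" by (auto simp: s_def algebra_simps)
  define R where "R = max 1 (norm z + 2 * exp y)"
  define B where "B = ln R + C"
  have VB: "V a \<le> ereal B" if "norm a \<le> norm z + 2 * exp y" for a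
    unfolding B_def using that by (intro V_le) (auto simp: R_def)
  define Z where "Z = (\<integral>x. w x \<partial>lborel)"
  define I where "I t = (\<integral>\<^sup>+x. defect B (z + t *\<^sub>R x) * ennreal (w x) \<partial>lborel)" for t
  have I: "I (exp t) = ennreal (B * Z - avg w z (exp t))" "avg w z (exp t) \<le> B * Z" if "t \<le> y" for t
  proof -
    have "V a \<le> ereal B" if "norm a \<le> norm z + 2 * exp t" for a
      using that exp_le_cancel_iff[of t y] \<open>t \<le> y\<close> by (intro VB) linarith
    then show "I (exp t) = ennreal (B * Z - avg w z (exp t))" "avg w z (exp t) \<le> B * Z"
      unfolding I_def Z_def by (auto intro!: defect_avg w)
  qed
  define N where "N t x = (\<integral>\<^sup>+\<theta>. defect B (z + (cis \<theta> * of_real (exp t)) *s x) \<partial>circ)" for t x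
  have N[measurable]: "N t \<in> borel_measurable borel" for t unfolding N_def by measurable
  have IN: "I (exp t) = (\<integral>\<^sup>+x. N t x * ennreal (w x) \<partial>lborel)" for t
    unfolding I_def N_def by (rule defect_circ_average[OF w'(1) rad])
  have "ennreal (1 - p) * I (exp x) + ennreal p * I (exp y)
      = (\<integral>\<^sup>+a. (ennreal (1 - p) * N x a + ennreal p * N y a) * ennreal (w a) \<partial>lborel)"
    unfolding IN by (simp add: nn_integral_cmult[symmetric] nn_integral_add[symmetric] algebra_simps)
  also have "\<dots> \<le> (\<integral>\<^sup>+a. N s a * ennreal (w a) \<partial>lborel)"
  proof (rule nn_integral_mono)
    fix a :: "complex ^ 'n"
    show "(ennreal (1 - p) * N x a + ennreal p * N y a) * ennreal (w a) \<le> N s a * ennreal (w a)"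
    proof (cases "norm a \<le> 2")
      case True
      interpret L: Lelong_line "\<lambda>l. V (z + l *s a)" "C + ln (1 + norm z + norm a)" by (rule line)
      have "V (z + l *s a) \<le> ereal B" if "cmod l \<le> exp y" for l
      proof (rule VB)
        have "cmod l * norm a \<le> exp y * 2" using that True by (intro mult_mono) auto
        then show "norm (z + l *s a) \<le> norm z + 2 * exp y"
          using norm_triangle_ineq[of z "l *s a"] by (simp add: norm_vector_smult)
      qed
      from L.circle_mean_concave[OF xy p this]
      have "ennreal (1 - p) * N x a + ennreal p * N y a \<le> N s a"
        by (simp add: N_def defect_def s_def)
      then show ?thesis by (rule mult_right_mono) simp
    next
      case False
      then show ?thesis using w'(4)[of a] by simp
    qed
  qed
  also have "\<dots> = I (exp s)" by (simp add: IN)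
  finally have "ennreal ((1 - p) * (B * Z - avg w z (exp x)) + p * (B * Z - avg w z (exp y))) \<le> ennreal (B * Z - avg w z (exp s))"
    using p xy s I by (simp add: ennreal_mult[symmetric] flip: ennreal_plus)
  then have "(1 - p) * (B * Z - avg w z (exp x)) + p * (B * Z - avg w z (exp y)) \<le> B * Z - avg w z (exp s)"
    using I(2)[OF s(2)] by (subst (asm) ennreal_le_iff) auto
  then show "avg w z (exp ((1 - p) *\<^sub>R x + p *\<^sub>R y)) \<le> (1 - p) * avg w z (exp x) + p * avg w z (exp y)"
    by (simp add: s_def algebra_simps)
qed auto

text \<open>
  A convex function of \<open>s\<close> that is at most \<open>(s + c) Z\<close> for large \<open>s\<close> has slope at most \<open>Z\<close>.
\<close>

lemma avg_slope_le:
  assumes w: "weight w" and rad: "\<And>\<theta> x. w (cis \<theta> *s x) = w x" and s: "s1 \<le> s2"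
  shows "avg w z (exp s2) - avg w z (exp s1) \<le> (\<integral>x. w x \<partial>lborel) * (s2 - s1)"
proof (cases "s1 = s2")
  case False
  then have s: "s1 < s2" using s by simp
  define g where "g s = avg w z (exp s)" for s
  define Z where "Z = (\<integral>x. w x \<partial>lborel)"
  define c where "c = ln (norm z + 2) + C"
  have cv: "convex_on UNIV g" unfolding g_def by (rule avg_log_convex[OF w rad])
  have gr: "g s \<le> (s + c) * Z" if "s \<ge> 0" for s
  proof -
    have "V y \<le> ereal (s + c)" if y: "norm y \<le> norm z + 2 * exp s" for y
    proof -
      have e: "1 \<le> exp s" using \<open>s \<ge> 0\<close> by simp
      have "norm z + 2 * exp s \<le> exp s * (norm z + 2)"
        using mult_right_mono[OF e, of "norm z"] by (simp add: algebra_simps)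
      then have "norm y \<le> exp s * (norm z + 2)" using y by linarith
      moreover have "1 \<le> exp s * (norm z + 2)" using mult_mono[OF e, of 1 "norm z + 2"] by simp
      ultimately have "V y \<le> ereal (ln (exp s * (norm z + 2)) + C)" by (intro V_le)
      also have "ln (exp s * (norm z + 2)) = s + ln (norm z + 2)"
        using ln_mult_pos[of "exp s" "norm z + 2"] add_nonneg_pos[of "norm z" 2]
        by (simp only: norm_ge_zero exp_gt_zero ln_exp zero_less_numeral)
      finally show ?thesis by (simp add: c_def add.assoc)
    qed
    then show ?thesis unfolding g_def Z_def by (intro defect_avg(2)[OF w]) auto
  qed
  define q where "q = (g s2 - g s1) / (s2 - s1)"
  have "\<forall>\<^sub>F s in at_top. q \<le> ((s + c) * Z - g s2) / (s - s2)"
    using eventually_gt_at_top[of "max 0 s2"]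
  proof eventually_elim
    case (elim s3)
    have "(g s2 - g s1) / (s2 - s1) \<le> (g s3 - g s2) / (s3 - s2)"
    proof -
      have flip: "(a - b) / (c - d) = (b - a) / (d - c)" for a b c d :: real
        using minus_divide_divide[of "b - a" "d - c"] by simp
      have "(g s1 - g s2) / (s1 - s2) \<le> (g s2 - g s3) / (s2 - s3)"
        using convex_on_slope_le[OF cv, of s1 s3 s2] s elim by simp
      then show ?thesis unfolding flip[of "g s1"] flip[of "g s2" "g s3"] .
    qed
    also have "\<dots> \<le> ((s3 + c) * Z - g s2) / (s3 - s2)"
      using gr[of s3] elim by (intro divide_right_mono) auto
    finally show ?case by (simp add: q_def)
  qed
  moreover have "((\<lambda>s. ((s + c) * Z - g s2) / (s - s2)) \<longlongrightarrow> Z) at_top"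
    by real_asymp
  ultimately have "q \<le> Z" by (intro tendsto_lowerbound[of _ Z at_top]) auto
  then show ?thesis using s by (simp add: q_def g_def Z_def field_simps)
qed simp

end

section \<open>Averages and the Robin function\<close>

lemma e2ennreal_diff_add:
  assumes "y \<le> ereal B" "0 \<le> B"
  shows "e2ennreal (ereal B - y) + e2ennreal y = e2ennreal (- y) + ennreal B"
proof (cases y)
  case (real r)
  then show ?thesis
    using assms by (cases "0 \<le> r") (auto simp: ennreal_neg simp flip: ennreal_plus)
next
  case MInf
  then show ?thesis by simp
qed (use assms in auto)

context Lelong_fn
begin

definition ray_mean :: "real \<Rightarrow> complex ^ 'n \<Rightarrow> ereal" where
  "ray_mean r x = ereal_integral circ (\<lambda>\<theta>. V ((cis \<theta> * of_real r) *s x))"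

lemma ray_mean_borel [measurable]: "ray_mean r \<in> borel_measurable borel"
  unfolding ray_mean_def ereal_integral_def by measurable

lemma Robin_eq_Limsup:
  assumes x: "x \<noteq> 0"
  shows "Robin V x = Limsup at_infinity (\<lambda>t. V (0 + t *s x) - ereal (ln (cmod t))) + ereal (- ln (norm x))"
proof -
  have "Robin V x = Limsup at_infinity (\<lambda>t. (V (0 + t *s x) - ereal (ln (cmod t))) + ereal (- ln (norm x)))"
    unfolding Robin_def
  proof (rule Limsup_eq)
    have "\<forall>\<^sub>F t::complex in at_infinity. 1 \<le> cmod t"
      unfolding eventually_at_infinity by blast
    then show "\<forall>\<^sub>F t in at_infinity. V (t *s x) - ereal (ln (norm (t *s x)))
       = (V (0 + t *s x) - ereal (ln (cmod t))) + ereal (- ln (norm x))"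
    proof eventually_elim
      case (elim t)
      then have "ln (norm (t *s x)) = ln (cmod t) + ln (norm x)"
        using x unfolding norm_vector_smult by (subst ln_mult_pos) auto
      then show ?case by (cases "V (t *s x)") auto
    qed
  qed
  also have "\<dots> = Limsup at_infinity (\<lambda>t. V (0 + t *s x) - ereal (ln (cmod t))) + ereal (- ln (norm x))"
    using trivial_limit_at_infinity[where 'a = complex] by (intro Limsup_add_ereal_right) auto
  finally show ?thesis .
qed

lemma Robin_eq_INF:
  assumes x: "x \<noteq> 0"
  shows "Robin V x = (INF k. ray_mean (real (Suc k)) x - ereal (ln (real (Suc k)))) + ereal (- ln (norm x))"
proof -
  interpret L: Lelong_line "\<lambda>l. V (0 + l *s x)" "C + ln (1 + norm (0::complex^'n) + norm x)" by (rule line)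
  have "L.circle_mean r = ray_mean r x" for r unfolding L.circle_mean_def ray_mean_def by simp
  then show ?thesis unfolding Robin_eq_Limsup[OF x] L.Limsup_eq_INF by simp
qed

lemma Robin_borel [measurable]: "Robin V \<in> borel_measurable borel"
proof -
  have "Robin V = (\<lambda>x. if x = 0 then Robin V 0
     else (INF k. ray_mean (real (Suc k)) x - ereal (ln (real (Suc k)))) + ereal (- ln (norm x)))"
    using Robin_eq_INF by auto
  moreover have "(\<lambda>x. if x = 0 then Robin V 0
     else (INF k. ray_mean (real (Suc k)) x - ereal (ln (real (Suc k)))) + ereal (- ln (norm x))) \<in> borel_measurable borel"
    by measurable
  ultimately show ?thesis by simp
qed

text \<open>
  This is the passage from pointwise growth along rays to averages: on each complex line through the
  origin the Robin function bounds the circle means from below, for every radius.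
\<close>

lemma Robin_le_ray_mean:
  assumes x: "x \<noteq> 0" and t: "0 < t"
  shows "Robin V x + ereal (ln (norm x) + ln t) \<le> ray_mean t x"
proof -
  interpret L: Lelong_line "\<lambda>l. V (0 + l *s x)" "C + ln (1 + norm (0::complex^'n) + norm x)" by (rule line)
  have m: "L.circle_mean t = ray_mean t x" unfolding L.circle_mean_def ray_mean_def by simp
  define L0 where "L0 = Limsup at_infinity (\<lambda>t. V (0 + t *s x) - ereal (ln (cmod t)))"
  have "L0 \<le> ray_mean t x - ereal (ln t)"
    using L.Limsup_le_circle_mean[OF t] unfolding m L0_def .
  moreover have "Robin V x = L0 + ereal (- ln (norm x))"
    unfolding L0_def by (rule Robin_eq_Limsup[OF x])
  ultimately show ?thesis by (cases L0; cases "ray_mean t x") auto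
qed

lemma Robin_le: 
  assumes x: "x \<noteq> 0"
  shows "Robin V x \<le> ereal C"
  unfolding Robin_def
proof (rule Limsup_bounded)
  have "\<forall>\<^sub>F t::complex in at_infinity. inverse (norm x) \<le> cmod t"
    unfolding eventually_at_infinity by blast
  then show "\<forall>\<^sub>F t in at_infinity. V (t *s x) - ereal (ln (norm (t *s x))) \<le> ereal C"
  proof eventually_elim
    case (elim t)
    have "inverse (norm x) * norm x \<le> cmod t * norm x" using elim by (intro mult_right_mono) auto
    then have "1 \<le> norm (t *s x)" using x by (simp add: norm_vector_smult)
    then have "V (t *s x) \<le> ereal (ln (norm (t *s x)) + C)" by (intro V_le) auto
    then show ?case by (cases "V (t *s x)") auto
  qed
qed

text \<open>
  Average the lower bound of the circle means by the Robin function over all directions; the integral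
  of the Robin function against the radial weight vanishes by the normalization. Since \<open>B' \<ge> \<rho>\<close>, the
  identity \<open>(B' - \<rho>) + \<rho>\<^sup>+ = \<rho>\<^sup>- + B'\<close> turns this cancellation into a statement on nonnegative
  integrals.
\<close>

lemma avg_zero_ge:
  assumes LP: "ereal_integral FS_measure (Robin_proj V) = 0"
    and w: "weight w" and W[measurable]: "W \<in> borel_measurable borel" and wW: "\<And>x. w x = W (norm x)"
    and a: "0 < a" "\<And>r. r < a \<Longrightarrow> W r = 0" and t: "0 < t"
  shows "(ln t + ln a) * (\<integral>x. w x \<partial>lborel) \<le> avg w 0 t"
proof -
  obtain M where w': "w \<in> borel_measurable borel" "\<And>x. 0 \<le> w x" "\<And>x. \<bar>w x\<bar> \<le> M" "\<And>x. 2 \<le> norm x \<Longrightarrow> w x = 0"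
    using weightD[OF w] by blast
  note w'(1)[measurable]
  define Z where "Z = (\<integral>x. w x \<partial>lborel)"
  have Z0: "0 \<le> Z" unfolding Z_def using w'(2) by (intro integral_nonneg_AE) auto
  have Zn: "(\<integral>\<^sup>+x. ennreal (w x) \<partial>lborel) = ennreal Z"
    unfolding Z_def using w'(2) by (intro nn_integral_eq_integral weight_integrable[OF w]) auto
  have Wn: "ennreal (w x) = ennreal (W (norm x))" for x by (simp add: wW)
  define B where "B = max (ln (max 1 (2 * t)) + C) (\<bar>C\<bar> + ln a + ln t)"
  define B' where "B' = B - ln a - ln t"
  have B': "0 \<le> B'" "C \<le> B'" unfolding B'_def B_def by linarith+
  have VB: "V y \<le> ereal B" if "norm y \<le> 2 * t" for y
  proof -
    have "V y \<le> ereal (ln (max 1 (2 * t)) + C)" using that by (intro V_le) auto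
    also have "\<dots> \<le> ereal B" by (simp add: B_def)
    finally show ?thesis .
  qed
  obtain K where K: "\<forall>f g. f \<in> borel_measurable borel \<longrightarrow> (\<forall>c x. c \<noteq> 0 \<longrightarrow> f (c *s x) = f x) \<longrightarrow>
     (\<forall>x. x \<noteq> 0 \<longrightarrow> g (proj x) = f x) \<longrightarrow>
     (\<integral>\<^sup>+x. f x * ennreal (W (norm (x :: complex ^ 'n))) \<partial>lborel) = K * (\<integral>\<^sup>+p. g p \<partial>FS_measure)"
    using nn_integral_homogeneous_FS[of "\<lambda>r. ennreal (W r)"] by auto
  define P where "P = (\<integral>\<^sup>+x. e2ennreal (Robin V x) * ennreal (w x) \<partial>lborel)"
  define N where "N = (\<integral>\<^sup>+x. e2ennreal (- Robin V x) * ennreal (w x) \<partial>lborel)"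
  have "P = K * (\<integral>\<^sup>+p. e2ennreal (Robin_proj V p) \<partial>FS_measure)"
    unfolding P_def Wn by (rule K[rule_format]) (auto simp: Robin_scale Robin_proj_proj)
  moreover have "N = K * (\<integral>\<^sup>+p. e2ennreal (- Robin_proj V p) \<partial>FS_measure)"
    unfolding N_def Wn by (rule K[rule_format]) (auto simp: Robin_scale Robin_proj_proj)
  moreover have "(\<integral>\<^sup>+p. e2ennreal (Robin_proj V p) \<partial>FS_measure) = (\<integral>\<^sup>+p. e2ennreal (- Robin_proj V p) \<partial>FS_measure)"
    (is "?p = ?n")
  proof -
    have "enn2ereal ?p - enn2ereal ?n = 0" using LP by (simp add: ereal_integral_def)
    then have "enn2ereal ?p = enn2ereal ?n" by (cases "enn2ereal ?p"; cases "enn2ereal ?n") auto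
    then show ?thesis by (simp only: enn2ereal_inject)
  qed
  ultimately have PN: "P = N" by simp
  have w0: "w x = 0" if "norm x < a" for x using a that by (simp add: wW)
  have "P \<le> (\<integral>\<^sup>+x. ennreal \<bar>C\<bar> * ennreal (w x) \<partial>lborel)"
    unfolding P_def
  proof (rule nn_integral_mono)
    fix x :: "complex ^ 'n"
    show "e2ennreal (Robin V x) * ennreal (w x) \<le> ennreal \<bar>C\<bar> * ennreal (w x)"
    proof (cases "x = 0")
      case True then show ?thesis using w0 a by simp
    next
      case False
      have "Robin V x \<le> ereal \<bar>C\<bar>" using Robin_le[OF False] order_trans by fastforce
      then have "e2ennreal (Robin V x) \<le> ennreal \<bar>C\<bar>" by (metis e2ennreal_ereal e2ennreal_mono)
      then show ?thesis by (rule mult_right_mono) simp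
    qed
  qed
  also have "\<dots> = ennreal \<bar>C\<bar> * ennreal Z" by (simp add: nn_integral_cmult Zn)
  also have "\<dots> < top" by (simp add: ennreal_mult_less_top)
  finally have Pfin: "P \<noteq> top" by simp
  define X where "X = (\<integral>\<^sup>+x. e2ennreal (ereal B' - Robin V x) * ennreal (w x) \<partial>lborel)"
  have "X + P = (\<integral>\<^sup>+x. e2ennreal (ereal B' - Robin V x) * ennreal (w x) + e2ennreal (Robin V x) * ennreal (w x) \<partial>lborel)"
    unfolding X_def P_def by (rule nn_integral_add[symmetric]) measurable
  also have "\<dots> = (\<integral>\<^sup>+x. e2ennreal (- Robin V x) * ennreal (w x) + ennreal B' * ennreal (w x) \<partial>lborel)"
  proof (rule nn_integral_cong)
    fix x :: "complex ^ 'n"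
    show "e2ennreal (ereal B' - Robin V x) * ennreal (w x) + e2ennreal (Robin V x) * ennreal (w x)
      = e2ennreal (- Robin V x) * ennreal (w x) + ennreal B' * ennreal (w x)"
    proof (cases "x = 0")
      case True then show ?thesis using w0 a by simp
    next
      case False
      have "Robin V x \<le> ereal B'" using Robin_le[OF False] B'(2) order_trans by fastforce
      from e2ennreal_diff_add[OF this B'(1)] show ?thesis by (simp add: distrib_right[symmetric])
    qed
  qed
  also have "\<dots> = N + ennreal B' * ennreal Z"
    unfolding N_def Zn[symmetric] by (simp add: nn_integral_add nn_integral_cmult)
  finally have "P + X = P + ennreal B' * ennreal Z" by (simp add: PN add.commute)
  then have X: "X = ennreal B' * ennreal Z" using Pfin by (simp add: ennreal_add_left_cancel)
  have "ennreal (B * Z - avg w 0 t) = (\<integral>\<^sup>+x. defect B (0 + t *\<^sub>R x) * ennreal (w x) \<partial>lborel)"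
    unfolding Z_def using VB by (intro defect_avg(1)[symmetric] w t) auto
  also have "\<dots> = (\<integral>\<^sup>+x. (\<integral>\<^sup>+\<theta>. defect B (0 + (cis \<theta> * of_real t) *s x) \<partial>circ) * ennreal (w x) \<partial>lborel)"
    by (rule defect_circ_average[OF w'(1)]) (simp add: wW norm_vector_smult)
  also have "\<dots> \<le> X"
    unfolding X_def
  proof (rule nn_integral_mono)
    fix x :: "complex ^ 'n"
    show "(\<integral>\<^sup>+\<theta>. defect B (0 + (cis \<theta> * of_real t) *s x) \<partial>circ) * ennreal (w x) \<le> e2ennreal (ereal B' - Robin V x) * ennreal (w x)"
    proof (cases "a \<le> norm x \<and> norm x \<le> 2")
      case False
      then have "w x = 0" using w0[of x] w'(4)[of x] by force
      then show ?thesis by simp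
    next
      case True
      then have x0: "x \<noteq> 0" using a by auto
      interpret L: Lelong_line "\<lambda>l. V (0 + l *s x)" "C + ln (1 + norm (0::complex^'n) + norm x)" by (rule line)
      have "V (0 + (cis \<theta> * of_real t) *s x) \<le> ereal B" for \<theta>
      proof (rule VB)
        have "t * norm x \<le> t * 2" using True t by (intro mult_left_mono) auto
        then show "norm (0 + (cis \<theta> * of_real t) *s x) \<le> 2 * t" using t by (simp add: norm_vector_smult norm_mult mult.commute)
      qed
      from L.circle_mean_eq[OF this] have m: "ray_mean t x = ereal B - enn2ereal (\<integral>\<^sup>+\<theta>. defect B (0 + (cis \<theta> * of_real t) *s x) \<partial>circ)"
        unfolding L.circle_mean_def ray_mean_def defect_def by simp
      have "ln a \<le> ln (norm x)" using True a(1) x0 by simp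
      have "Robin V x + ereal (ln (norm x) + ln t) \<le> ereal B - enn2ereal (\<integral>\<^sup>+\<theta>. defect B (0 + (cis \<theta> * of_real t) *s x) \<partial>circ)"
        using Robin_le_ray_mean[OF x0 t] by (simp add: m)
      from le_e2ennreal_diff[OF this]
      have "(\<integral>\<^sup>+\<theta>. defect B (0 + (cis \<theta> * of_real t) *s x) \<partial>circ) \<le> e2ennreal (ereal B - (Robin V x + ereal (ln (norm x) + ln t)))" .
      also have "\<dots> \<le> e2ennreal (ereal B' - Robin V x)"
        using \<open>ln a \<le> ln (norm x)\<close> by (intro e2ennreal_mono) (cases "Robin V x", auto simp: B'_def)
      finally show ?thesis by (rule mult_right_mono) simp
    qed
  qed
  also have "X = ennreal (B' * Z)" using X B' Z0 by (simp add: ennreal_mult)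
  finally have "B * Z - avg w 0 t \<le> B' * Z" using B' Z0 by (simp add: ennreal_le_iff)
  then show ?thesis by (simp add: B'_def Z_def algebra_simps)
qed

text \<open>
  At the centre \<open>0\<close> this is the previous lemma. For another centre, the two weights differ at scale
  \<open>t = exp T\<close> by a translation by \<open>z / t\<close>, hence uniformly by \<open>\<epsilon>\<close> for large \<open>t\<close>, while \<open>|V(t x) - T|\<close> has
  bounded integral over the annulus \<open>A\<close>. So the bound holds at large scales up to \<open>\<epsilon> K\<close>, and the
  bound on the slope carries it down to the scale \<open>exp s\<close>.
\<close>

lemma avg_ge:
  assumes LP: "ereal_integral FS_measure (Robin_proj V) = 0"
    and W: "continuous_on UNIV W" "\<And>r. 0 \<le> W r" "\<And>r. r < 4/5 \<Longrightarrow> W r = 0" "\<And>r. 1 < r \<Longrightarrow> W r = 0"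
  defines "w \<equiv> \<lambda>x :: complex ^ 'n. W (norm x)"
  shows "(s + ln (4/5)) * (\<integral>x. w x \<partial>lborel) \<le> avg w z (exp s)"
proof -
  have Wm[measurable]: "W \<in> borel_measurable borel" by (rule borel_measurable_continuous_onI[OF W(1)])
  obtain M where M: "\<And>r. W r \<le> M"
  proof -
    have "compact (W ` {0..1})" by (intro compact_continuous_image continuous_on_subset[OF W(1)]) auto
    then obtain M where M: "\<And>r. r \<in> {0..1} \<Longrightarrow> W r \<le> M"
      by (meson bounded_imp_bdd_above bdd_above_def compact_imp_bounded image_eqI)
    have "W r \<le> max 0 M" for r
      using M[of r] W(3)[of r] W(4)[of r] by (cases "r \<in> {0..1}") (auto simp: not_le)
    then show thesis by (rule that)
  qed
  have wt: "weight w"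
    unfolding weight_def w_def using W M by (auto intro!: exI[of _ M])
  have rad: "w (cis \<theta> *s x) = w x" for \<theta> x by (simp add: w_def norm_vector_smult)
  have wm[measurable]: "w \<in> borel_measurable borel" unfolding w_def by measurable
  have wM: "\<bar>w x\<bar> \<le> M" for x using W(2) M by (simp add: w_def)
  have wi: "integrable lborel w" by (rule weight_integrable[OF wt])
  define Z where "Z = (\<integral>x. w x \<partial>lborel)"
  \<comment> \<open>\<open>A\<close> contains the shell and its translates by vectors of norm below \<open>1/5\<close>\<close>
  define A where "A = {x :: complex ^ 'n. 1/2 \<le> norm x \<and> norm x \<le> 3/2}"
  have Am[measurable]: "A \<in> sets borel" unfolding A_def by measurable
  have At: "weight (indicator A)"
    unfolding weight_def by (auto simp: A_def split: split_indicator intro!: exI[of _ 1])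
  define vol where "vol = (\<integral>x. indicator A x \<partial>lborel :: real)"
  have vol0: "0 \<le> vol" unfolding vol_def by (intro integral_nonneg_AE) auto
  define C1 where "C1 = ln 2 + \<bar>C\<bar>"
  have C10: "0 \<le> C1" by (simp add: C1_def)
  define K where "K = (2 * C1 + ln 2) * vol"
  have K0: "0 \<le> K" unfolding K_def C1_def using vol0 by (intro mult_nonneg_nonneg) auto
  have ucont: "uniformly_continuous_on (cball 0 3) w"
    unfolding w_def
    by (intro compact_uniformly_continuous continuous_on_compose2[OF W(1)] continuous_intros) auto
  have key: "(s + ln (4/5)) * Z - \<epsilon> * K \<le> avg w z (exp s)" if \<epsilon>: "0 < \<epsilon>" for \<epsilon>
  proof -
    obtain d where d: "d > 0" "\<And>x y. x \<in> cball 0 3 \<Longrightarrow> y \<in> cball 0 3 \<Longrightarrow> dist y x < d \<Longrightarrow> dist (w y) (w x) < \<epsilon>"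
      using ucont \<epsilon> unfolding uniformly_continuous_on_def by metis
    define \<delta> where "\<delta> = min d (1/5)"
    define T where "T = max (max s 0) (ln ((norm z + 1) / \<delta>))"
    have \<delta>: "0 < \<delta>" using d by (simp add: \<delta>_def)
    define t where "t = exp T"
    have t: "1 \<le> t" "0 < t" by (auto simp: t_def T_def)
    have "(norm z + 1) / \<delta> \<le> t"
    proof -
      have "0 < (norm z + 1) / \<delta>" using \<delta> by (simp add: add_nonneg_pos)
      moreover have "exp (ln ((norm z + 1) / \<delta>)) \<le> exp T" by (simp add: T_def)
      ultimately show ?thesis unfolding t_def by simp
    qed
    define h where "h = inverse t *\<^sub>R z"
    have h: "norm h < \<delta>"
    proof -
      have "norm z < t * \<delta>" using \<open>(norm z + 1) / \<delta> \<le> t\<close> \<delta> by (simp add: field_simps)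
      then show ?thesis using t by (simp add: h_def field_simps)
    qed
    have diff: "\<bar>w (x - h) - w x\<bar> \<le> \<epsilon> * indicator A x" for x
    proof (cases "x \<in> A")
      case True
      have "norm (x - h) \<le> norm x + norm h" by (rule norm_triangle_ineq4)
      then have "x - h \<in> cball 0 3" "x \<in> cball 0 3" using True h by (auto simp: A_def \<delta>_def)
      then have "dist (w (x - h)) (w x) < \<epsilon>" using h by (intro d(2)) (auto simp: dist_norm \<delta>_def)
      then show ?thesis using True by (simp add: dist_real_def)
    next
      case False
      have "\<bar>norm (x - h) - norm x\<bar> < 1/5" using h norm_triangle_ineq3[of "x - h" x] by (auto simp: \<delta>_def)
      consider "norm x < 1/2" | "3/2 < norm x" using False by (auto simp: A_def)
      then have "(norm x < 4/5 \<and> norm (x - h) < 4/5) \<or> (1 < norm x \<and> 1 < norm (x - h))"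
        using \<open>\<bar>norm (x - h) - norm x\<bar> < 1/5\<close> by cases (linarith | simp)+
      then have "w (x - h) = 0" "w x = 0"
        using W(3,4) unfolding w_def by auto
      then show ?thesis using False by simp
    qed
    define D where "D x = w (x - h) - w x" for x
    have Dm[measurable]: "D \<in> borel_measurable borel" unfolding D_def by measurable
    have e1: "avg w z t = (\<integral>x. v (0 + t *\<^sub>R x) * w (x - h) \<partial>lborel)"
    proof -
      have i: "integrable lborel (\<lambda>x. v (z + t *\<^sub>R x) * w x)"
        using wM t by (intro v_affine_integrable[where R = 2]) (auto simp: w_def W)
      have "(\<integral>x. v (z + t *\<^sub>R x) * w x \<partial>lborel) = (\<integral>x. v (z + t *\<^sub>R (- h + 1 *\<^sub>R x)) * w (- h + 1 *\<^sub>R x) \<partial>lborel)"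
        using lborel_affine_integral(2)[OF i, of 1 "- h"] by simp
      also have "\<dots> = (\<integral>x. v (0 + t *\<^sub>R x) * w (x - h) \<partial>lborel)"
        using t by (intro Bochner_Integration.integral_cong) (auto simp: h_def algebra_simps)
      finally show ?thesis by (simp add: avg_def)
    qed
    have DM: "\<bar>D x\<bar> \<le> \<epsilon>" "2 \<le> norm x \<Longrightarrow> D x = 0" for x
      using diff[of x] \<epsilon> by (auto simp: D_def A_def split: split_indicator_asm)
    have iD: "integrable lborel (\<lambda>x. v (0 + t *\<^sub>R x) * D x)"
      by (rule v_affine_integrable[OF Dm DM t(2)])
    have iw: "integrable lborel (\<lambda>x. v (0 + t *\<^sub>R x) * w x)"
      using wM t by (intro v_affine_integrable[where R = 2]) (auto simp: w_def W)
    have iA: "integrable lborel (\<lambda>x. v (0 + t *\<^sub>R x) * indicator A x)"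
      using t by (intro v_affine_integrable[where R = 2 and M = 1]) (auto simp: A_def split: split_indicator)
    have iA1: "integrable lborel (indicator A :: _ \<Rightarrow> real)" by (rule weight_integrable[OF At])
    have e2: "avg w z t - avg w 0 t = (\<integral>x. v (0 + t *\<^sub>R x) * D x \<partial>lborel)"
    proof -
      have "(\<integral>x. v (0 + t *\<^sub>R x) * w (x - h) \<partial>lborel) = (\<integral>x. v (0 + t *\<^sub>R x) * D x + v (0 + t *\<^sub>R x) * w x \<partial>lborel)"
        by (intro Bochner_Integration.integral_cong) (auto simp: D_def algebra_simps)
      then show ?thesis unfolding e1 using iD iw by (simp add: avg_def)
    qed
    have D0: "(\<integral>x. D x \<partial>lborel) = 0" "integrable lborel D"
    proof -
      have "integrable lborel (\<lambda>x. w (x - h))" "(\<integral>x. w (x - h) \<partial>lborel) = Z"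
        using lborel_affine_integral[OF wi, of 1 "- h"] by (auto simp: Z_def)
      then show "(\<integral>x. D x \<partial>lborel) = 0" "integrable lborel D"
        unfolding D_def using wi by (auto simp: Z_def)
    qed
    have "(\<integral>x. v (0 + t *\<^sub>R x) * D x \<partial>lborel) = (\<integral>x. (v (0 + t *\<^sub>R x) - T) * D x \<partial>lborel)"
      using iD D0 by (simp add: left_diff_distrib)
    also have "\<dots> \<ge> (\<integral>x. - \<epsilon> * (2 * C1 * indicator A x - (v (0 + t *\<^sub>R x) * indicator A x - T * indicator A x)) \<partial>lborel)"
    proof (rule integral_mono_AE)
      show "integrable lborel (\<lambda>x. - \<epsilon> * (2 * C1 * indicator A x - (v (0 + t *\<^sub>R x) * indicator A x - T * indicator A x)))"
        using iA iA1 by auto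
      show "integrable lborel (\<lambda>x. (v (0 + t *\<^sub>R x) - T) * D x)"
        using iD D0 by (simp add: left_diff_distrib)
      show "AE x in lborel. - \<epsilon> * (2 * C1 * indicator A x - (v (0 + t *\<^sub>R x) * indicator A x - T * indicator A x)) \<le> (v (0 + t *\<^sub>R x) - T) * D x"
        using AE_V_affine[of t 0, OF less_imp_neq[OF t(2), symmetric]]
      proof eventually_elim
        case (elim x)
        show ?case
        proof (cases "x \<in> A")
          case False
          then show ?thesis using diff[of x] by (simp add: D_def)
        next
          case True
          have "t * norm x \<le> t * 2" using True t by (intro mult_left_mono) (auto simp: A_def)
          then have "norm (0 + t *\<^sub>R x) \<le> 2 * t" using t by simp
          then have "V (0 + t *\<^sub>R x) \<le> ereal (ln (2 * t) + C)" using t by (intro V_le) auto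
          then have "v (0 + t *\<^sub>R x) \<le> ln (2 * t) + C" unfolding elim by simp
          also have "ln (2 * t) = ln 2 + T" using t by (subst ln_mult_pos) (auto simp: t_def)
          finally have y: "v (0 + t *\<^sub>R x) - T \<le> C1" by (simp add: C1_def)
          have "\<bar>v (0 + t *\<^sub>R x) - T\<bar> \<le> 2 * C1 - (v (0 + t *\<^sub>R x) - T)"
            using y C10 by (simp add: abs_le_iff)
          moreover have "\<bar>D x\<bar> \<le> \<epsilon>" by (rule DM)
          ultimately have "\<bar>v (0 + t *\<^sub>R x) - T\<bar> * \<bar>D x\<bar> \<le> (2 * C1 - (v (0 + t *\<^sub>R x) - T)) * \<epsilon>"
            by (intro mult_mono) auto
          then have "- ((2 * C1 - (v (0 + t *\<^sub>R x) - T)) * \<epsilon>) \<le> (v (0 + t *\<^sub>R x) - T) * D x"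
            unfolding abs_mult[symmetric] by linarith
          then show ?thesis using True by (simp add: algebra_simps)
        qed
      qed
    qed
    also have "(\<integral>x. - \<epsilon> * (2 * C1 * indicator A x - (v (0 + t *\<^sub>R x) * indicator A x - T * indicator A x)) \<partial>lborel)
       = - \<epsilon> * (2 * C1 * vol - (avg (indicator A) 0 t - T * vol))"
      using iA iA1 by (simp add: vol_def avg_def)
    finally have lo: "- \<epsilon> * (2 * C1 * vol - (avg (indicator A) 0 t - T * vol)) \<le> avg w z t - avg w 0 t"
      by (simp add: e2)
    have "(ln t + ln (1/2)) * vol \<le> avg (indicator A) 0 t"
      unfolding vol_def
      by (rule avg_zero_ge[OF LP At, where W = "indicator {1/2..3/2}"])
         (use t in \<open>auto simp: A_def split: split_indicator\<close>)
    then have "2 * C1 * vol - (avg (indicator A) 0 t - T * vol) \<le> K"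
      by (simp add: K_def t_def ln_div algebra_simps)
    then have "\<epsilon> * (2 * C1 * vol - (avg (indicator A) 0 t - T * vol)) \<le> \<epsilon> * K"
      using \<epsilon> by (intro mult_left_mono) auto
    then have 1: "avg w 0 t - \<epsilon> * K \<le> avg w z t" using lo by simp
    have "(ln t + ln (4/5)) * Z \<le> avg w 0 t"
      unfolding Z_def by (rule avg_zero_ge[OF LP wt Wm]) (use t W in \<open>auto simp: w_def\<close>)
    then have 2: "(T + ln (4/5)) * Z \<le> avg w 0 t" by (simp add: t_def)
    have "avg w z (exp T) - avg w z (exp s) \<le> Z * (T - s)"
      unfolding Z_def by (rule avg_slope_le[OF wt rad]) (simp add: T_def)
    then show ?thesis using 1 2 by (simp add: t_def algebra_simps)
  qed
  have "((\<lambda>\<epsilon>. (s + ln (4/5)) * Z - \<epsilon> * K) \<longlongrightarrow> (s + ln (4/5)) * Z - 0 * K) (at_right 0)"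
    by (intro tendsto_intros)
  then have "(s + ln (4/5)) * Z - 0 * K \<le> avg w z (exp s)"
    by (rule tendsto_upperbound) (use key in \<open>auto simp: eventually_at_right_less eventually_at_filter\<close>)
  then show ?thesis by (simp add: Z_def)
qed

end

section \<open>Spline cutoff and the logarithmic slope\<close>

lemma DERIV_truncated_power:
  "((\<lambda>u. (max 0 u) ^ Suc (Suc m)) has_real_derivative real (Suc (Suc m)) * (max 0 u) ^ Suc m) (at u)"
proof -
  consider "u > 0" | "u < 0" | "u = 0" by linarith
  then show ?thesis
  proof cases
    case 1
    have "((\<lambda>u. u ^ Suc (Suc m)) has_real_derivative real (Suc (Suc m)) * u ^ Suc m) (at u)"
      using DERIV_pow[of "Suc (Suc m)" u UNIV] by simp
    then have "((\<lambda>u. (max 0 u) ^ Suc (Suc m)) has_real_derivative real (Suc (Suc m)) * u ^ Suc m) (at u)"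
      by (rule has_field_derivative_transform_within_open[where S = "{0<..}"]) (use 1 in auto)
    then show ?thesis using 1 by simp
  next
    case 2
    have "((\<lambda>u::real. 0) has_real_derivative 0) (at u)" by simp
    then have "((\<lambda>u. (max 0 u) ^ Suc (Suc m)) has_real_derivative 0) (at u)"
      by (rule has_field_derivative_transform_within_open[where S = "{..<0}"]) (use 2 in auto)
    then show ?thesis using 2 by simp
  next
    case 3
    have "((\<lambda>h. (max 0 h) ^ Suc (Suc m) / h) \<longlongrightarrow> 0) (at (0::real))"
    proof (rule Lim_null_comparison)
      show "\<forall>\<^sub>F h in at (0::real). norm ((max 0 h) ^ Suc (Suc m) / h) \<le> \<bar>h\<bar> ^ Suc m"
      proof (rule eventuallyI)
        fix h :: real
        show "norm ((max 0 h) ^ Suc (Suc m) / h) \<le> \<bar>h\<bar> ^ Suc m"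
        proof (cases "h > 0")
          case False
          then have "max 0 h = 0" by simp
          then show ?thesis by (simp del: power_Suc)
        qed (simp add: field_simps)
      qed
      have "((\<lambda>h::real. \<bar>h\<bar> ^ Suc m) \<longlongrightarrow> \<bar>0\<bar> ^ Suc m) (at 0)" by (intro tendsto_intros)
      then show "((\<lambda>h::real. \<bar>h\<bar> ^ Suc m) \<longlongrightarrow> 0) (at 0)" by simp
    qed
    then show ?thesis using 3 by (simp add: DERIV_def)
  qed
qed

text \<open>
  The quadratic cardinal B-spline with knots \<open>0, 1, 2, 3\<close>. A piecewise quadratic decay is the simplest
  one for which the cutoff has a Lipschitz second derivative.
\<close>

definition spline2 :: "real \<Rightarrow> real" where
  "spline2 u = ((max 0 u)\<^sup>2 - 3 * (max 0 (u - 1))\<^sup>2 + 3 * (max 0 (u - 2))\<^sup>2 - (max 0 (u - 3))\<^sup>2) / 2"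

definition spline1 :: "real \<Rightarrow> real" where
  "spline1 u = max 0 u - 3 * max 0 (u - 1) + 3 * max 0 (u - 2) - max 0 (u - 3)"

definition spline3 :: "real \<Rightarrow> real" where
  "spline3 u = ((max 0 u) ^ 3 - 3 * (max 0 (u - 1)) ^ 3 + 3 * (max 0 (u - 2)) ^ 3 - (max 0 (u - 3)) ^ 3) / 6"

lemma DERIV_truncated_power_shift:
  "((\<lambda>u. (max 0 (u - a)) ^ Suc (Suc m)) has_real_derivative real (Suc (Suc m)) * (max 0 (u - a)) ^ Suc m) (at u)"
proof -
  have "((\<lambda>u. u - a) has_real_derivative 1) (at u)" by (auto intro!: derivative_eq_intros)
  from DERIV_chain2[OF DERIV_truncated_power this] show ?thesis by simp
qed

lemma DERIV_spline3: "(spline3 has_real_derivative spline2 u) (at u)"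
proof -
  have p3: "((\<lambda>u. (max 0 (u - a)) ^ 3) has_real_derivative 3 * (max 0 (u - a))\<^sup>2) (at u)" for a
    using DERIV_truncated_power_shift[of a 1 u] by (simp add: numeral_3_eq_3 numeral_2_eq_2)
  have p3': "((\<lambda>u. (max 0 u) ^ 3) has_real_derivative 3 * (max 0 u)\<^sup>2) (at u)"
    using p3[of 0] by simp
  have "((\<lambda>u. ((max 0 u) ^ 3 - 3 * (max 0 (u - 1)) ^ 3 + 3 * (max 0 (u - 2)) ^ 3 - (max 0 (u - 3)) ^ 3) / 6)
    has_real_derivative (3 * (max 0 u)\<^sup>2 - 3 * (3 * (max 0 (u - 1))\<^sup>2) + 3 * (3 * (max 0 (u - 2))\<^sup>2) - 3 * (max 0 (u - 3))\<^sup>2) / 6) (at u)"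
    by (intro DERIV_cdivide DERIV_diff DERIV_add DERIV_cmult p3 p3')
  then show ?thesis unfolding spline3_def[abs_def] by (rule DERIV_cong) (simp add: spline2_def)
qed

lemma DERIV_spline2: "(spline2 has_real_derivative spline1 u) (at u)"
proof -
  have p2: "((\<lambda>u. (max 0 (u - a)) ^ 2) has_real_derivative 2 * max 0 (u - a)) (at u)" for a
    using DERIV_truncated_power_shift[of a 0 u] by (simp add: numeral_2_eq_2)
  have p2': "((\<lambda>u. (max 0 u) \<^sup>2) has_real_derivative 2 * max 0 u) (at u)"
    using p2[of 0] by simp
  have "((\<lambda>u. ((max 0 u) \<^sup>2 - 3 * (max 0 (u - 1)) \<^sup>2 + 3 * (max 0 (u - 2)) \<^sup>2 - (max 0 (u - 3)) \<^sup>2) / 2)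
    has_real_derivative (2 * max 0 u - 3 * (2 * max 0 (u - 1)) + 3 * (2 * max 0 (u - 2)) - 2 * max 0 (u - 3)) / 2) (at u)"
    by (intro DERIV_cdivide DERIV_diff DERIV_add DERIV_cmult p2 p2')
  then show ?thesis unfolding spline2_def[abs_def] by (rule DERIV_cong) (simp add: spline1_def)
qed

lemma spline2_ge:
  assumes u: "1 \<le> u" "u \<le> 2"
  shows "1/2 \<le> spline2 u"
proof -
  have m: "max 0 u = u" "max 0 (u - 1) = u - 1" "max 0 (u - 2) = 0" "max 0 (u - 3) = 0" using u by simp_all
  have "u\<^sup>2 - 3 * (u - 1)\<^sup>2 + 3 * 0\<^sup>2 - 0\<^sup>2 = 1 + 2 * ((u - 1) * (2 - u))"
    by (simp add: power2_eq_square algebra_simps)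
  then show ?thesis using u unfolding spline2_def m by simp
qed

lemma spline_zero: 
  "u \<le> 0 \<Longrightarrow> spline1 u = 0" "3 \<le> u \<Longrightarrow> spline1 u = 0"
  "u \<le> 0 \<Longrightarrow> spline2 u = 0" "3 \<le> u \<Longrightarrow> spline2 u = 0"
  "u \<le> 0 \<Longrightarrow> spline3 u = 0" "3 \<le> u \<Longrightarrow> spline3 u = 1"
proof -
  assume "u \<le> 0"
  then have m: "max 0 u = 0" "max 0 (u - 1) = 0" "max 0 (u - 2) = 0" "max 0 (u - 3) = 0" by simp_all
  show "spline1 u = 0" "spline2 u = 0" "spline3 u = 0"
    unfolding spline1_def spline2_def spline3_def m by simp_all
next
  assume "3 \<le> u"
  then have m: "max 0 u = u" "max 0 (u - 1) = u - 1" "max 0 (u - 2) = u - 2" "max 0 (u - 3) = u - 3" by simp_all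
  show "spline1 u = 0" unfolding spline1_def m by simp
  have "u\<^sup>2 - 3 * (u - 1)\<^sup>2 + 3 * (u - 2)\<^sup>2 - (u - 3)\<^sup>2 = 0"
    by (simp add: power2_eq_square algebra_simps)
  then show "spline2 u = 0" unfolding spline2_def m by simp
  have "u ^ 3 - 3 * (u - 1) ^ 3 + 3 * (u - 2) ^ 3 - (u - 3) ^ 3 = 6"
    by (simp add: power3_eq_cube algebra_simps)
  then show "spline3 u = 1" unfolding spline3_def m by simp
qed

lemma spline2_nonneg: "0 \<le> spline2 u"
proof -
  consider "u \<le> 0" | "0 \<le> u" "u \<le> 1" | "1 \<le> u" "u \<le> 2" | "2 \<le> u" "u \<le> 3" | "3 \<le> u" by linarith
  then show ?thesis
  proof cases
    case 1
    then show ?thesis by (simp add: spline_zero)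
  next
    case 2
    then have "max 0 u = u" "max 0 (u - 1) = 0" "max 0 (u - 2) = 0" "max 0 (u - 3) = 0" by simp_all
    then show ?thesis by (simp add: spline2_def)
  next
    case 3
    then show ?thesis using spline2_ge[of u] by simp
  next
    case 4
    then have m: "max 0 u = u" "max 0 (u - 1) = u - 1" "max 0 (u - 2) = u - 2" "max 0 (u - 3) = 0" by simp_all
    have "u\<^sup>2 - 3 * (u - 1)\<^sup>2 + 3 * (u - 2)\<^sup>2 - 0\<^sup>2 = (3 - u)\<^sup>2"
      by (simp add: power2_eq_square algebra_simps)
    then show ?thesis unfolding spline2_def m by simp
  next
    case 5
    then show ?thesis by (simp add: spline_zero)
  qed
qed

lemma spline1_Lipschitz: "\<bar>spline1 a - spline1 b\<bar> \<le> 8 * \<bar>a - b\<bar>"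
proof -
  have m: "\<bar>max 0 (a - c) - max 0 (b - c)\<bar> \<le> \<bar>a - b\<bar>" for c by (auto simp: max_def)
  have gen: "\<bar>(A - 3 * B + 3 * D - E) - (A' - 3 * B' + 3 * D' - E')\<bar> \<le> 8 * d"
    if "\<bar>A - A'\<bar> \<le> d" "\<bar>B - B'\<bar> \<le> d" "\<bar>D - D'\<bar> \<le> d" "\<bar>E - E'\<bar> \<le> d" for A A' B B' D D' E E' d :: real
    using that unfolding abs_le_iff by linarith
  show ?thesis unfolding spline1_def by (rule gen) (use m[of 0] m in auto)
qed

text \<open>
  The affine map that sends \<open>16 / 25\<close> to \<open>0\<close> and \<open>1\<close> to \<open>3\<close>. Its argument \<open>N\<close> is a squared norm, and
  \<open>16 / 25\<close> is the square of the inner radius \<open>4 / 5\<close> of the shell.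
\<close>

definition knot :: "real \<Rightarrow> real" where "knot N = (25 * N - 16) / 3"

text \<open>
  Equal to \<open>3 / 25\<close> up to \<open>16 / 25\<close> and to \<open>0\<close> from \<open>1\<close> on; the height \<open>3 / 25\<close> makes the derivative
  exactly \<open>- cutoff_k\<close>, the B-spline in the variable \<open>knot N\<close>.
\<close>

definition cutoff :: "real \<Rightarrow> real" where "cutoff N = 3/25 * (1 - spline3 (knot N))"
definition cutoff_k :: "real \<Rightarrow> real" where "cutoff_k N = spline2 (knot N)"
definition cutoff_k_deriv :: "real \<Rightarrow> real" where "cutoff_k_deriv N = 25/3 * spline1 (knot N)"

lemma DERIV_knot: "(knot has_real_derivative 25/3) (at N)"
  unfolding knot_def[abs_def] by (auto intro!: derivative_eq_intros)

lemma DERIV_cutoff: "(cutoff has_real_derivative - cutoff_k N) (at N)"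
proof -
  have "((\<lambda>N. 3/25 * (1 - spline3 (knot N))) has_real_derivative 3/25 * (0 - spline2 (knot N) * (25/3))) (at N)"
    by (intro DERIV_cmult DERIV_diff DERIV_const DERIV_chain2[OF DERIV_spline3 DERIV_knot])
  then show ?thesis by (simp add: cutoff_def[abs_def] cutoff_k_def)
qed

lemma DERIV_cutoff_k: "(cutoff_k has_real_derivative cutoff_k_deriv N) (at N)"
  unfolding cutoff_k_def[abs_def] cutoff_k_deriv_def
  using DERIV_chain2[OF DERIV_spline2 DERIV_knot, of N] by (simp add: mult.commute)

lemma cutoff_k_nonneg: "0 \<le> cutoff_k N" by (simp add: cutoff_k_def spline2_nonneg)
lemma cutoff_k_zero: "N \<le> 16/25 \<or> 1 \<le> N \<Longrightarrow> cutoff_k N = 0"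
  by (auto simp: cutoff_k_def knot_def spline_zero)
lemma cutoff_k_deriv_zero: "N \<le> 16/25 \<or> 1 \<le> N \<Longrightarrow> cutoff_k_deriv N = 0"
  by (auto simp: cutoff_k_deriv_def knot_def spline_zero)
lemma cutoff_plateau: "N \<le> 16/25 \<Longrightarrow> cutoff N = 3/25"
  by (simp add: cutoff_def knot_def spline_zero)
lemma cutoff_zero: "1 \<le> N \<Longrightarrow> cutoff N = 0"
  by (simp add: cutoff_def knot_def spline_zero)

lemma cutoff_decreasing: "a \<le> b \<Longrightarrow> cutoff b \<le> cutoff a"
proof (erule DERIV_nonpos_imp_nonincreasing)
  fix x show "\<exists>y. (cutoff has_real_derivative y) (at x) \<and> y \<le> 0"
    by (intro exI[of _ "- cutoff_k x"] conjI DERIV_cutoff) (simp add: cutoff_k_nonneg)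
qed

lemma cutoff_nonneg: "0 \<le> cutoff N"
  using cutoff_decreasing[of N "max N 1"] cutoff_zero[of "max N 1"] by auto

lemma cutoff_le: "cutoff N \<le> 3/25"
  using cutoff_decreasing[of "min N 0" N] cutoff_plateau[of "min N 0"] by auto

lemma cutoff_k_deriv_Lipschitz: "\<bar>cutoff_k_deriv a - cutoff_k_deriv b\<bar> \<le> 5000/9 * \<bar>a - b\<bar>"
proof -
  have "cutoff_k_deriv a - cutoff_k_deriv b = 25/3 * (spline1 (knot a) - spline1 (knot b))"
    by (simp add: cutoff_k_deriv_def algebra_simps)
  then have "\<bar>cutoff_k_deriv a - cutoff_k_deriv b\<bar> = 25/3 * \<bar>spline1 (knot a) - spline1 (knot b)\<bar>"
    by (simp only: abs_mult; simp)
  also have "\<dots> \<le> 25/3 * (8 * \<bar>knot a - knot b\<bar>)" by (intro mult_left_mono spline1_Lipschitz) auto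
  also have "\<bar>knot a - knot b\<bar> = 25/3 * \<bar>a - b\<bar>"
  proof -
    have "knot a - knot b = 25/3 * (a - b)" by (simp add: knot_def field_simps)
    then show ?thesis by (simp only: abs_mult; simp)
  qed
  finally show ?thesis by simp
qed

lemma cutoff_k_deriv_bound: "\<bar>cutoff_k_deriv N\<bar> \<le> 5000/9"
proof (cases "N \<le> 16/25 \<or> 1 \<le> N")
  case False
  then show ?thesis using cutoff_k_deriv_Lipschitz[of N 0] cutoff_k_deriv_zero[of 0] by auto
qed (simp add: cutoff_k_deriv_zero)

lemma cutoff_k_deriv_mult_bound: "\<bar>N * cutoff_k_deriv N\<bar> \<le> 5000/9"
proof (cases "N \<le> 16/25 \<or> 1 \<le> N")
  case False
  then have "\<bar>N\<bar> * \<bar>cutoff_k_deriv N\<bar> \<le> 1 * (5000/9)" using cutoff_k_deriv_bound by (intro mult_mono) auto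
  then show ?thesis by (simp add: abs_mult)
qed (simp add: cutoff_k_deriv_zero)

lemma cutoff_k_bound: "\<bar>cutoff_k N\<bar> \<le> 5000/9"
proof (cases "N \<le> 16/25 \<or> 1 \<le> N")
  case False
  have "\<exists>z. 0 < z \<and> z < N \<and> cutoff_k N - cutoff_k 0 = (N - 0) * cutoff_k_deriv z"
    using False by (intro MVT2) (auto intro!: DERIV_cutoff_k)
  then obtain z where "cutoff_k N = N * cutoff_k_deriv z" using cutoff_k_zero[of 0] by auto
  moreover have "\<bar>N\<bar> * \<bar>cutoff_k_deriv z\<bar> \<le> 1 * (5000/9)"
    using False cutoff_k_deriv_bound by (intro mult_mono) auto
  ultimately show ?thesis by (simp add: abs_mult)
qed (simp add: cutoff_k_zero)

lemma continuous_cutoff: "continuous_on UNIV cutoff" "continuous_on UNIV cutoff_k" "continuous_on UNIV cutoff_k_deriv"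
proof -
  show "continuous_on UNIV cutoff" "continuous_on UNIV cutoff_k"
    by (auto intro!: DERIV_continuous_on DERIV_subset[OF DERIV_cutoff] DERIV_subset[OF DERIV_cutoff_k])
  show "continuous_on UNIV cutoff_k_deriv"
    unfolding cutoff_k_deriv_def[abs_def] spline1_def knot_def by (auto intro!: continuous_intros)
qed

lemma cutoff_borel [measurable]:
  "cutoff \<in> borel_measurable borel" "cutoff_k \<in> borel_measurable borel" "cutoff_k_deriv \<in> borel_measurable borel"
  using continuous_cutoff by (auto intro: borel_measurable_continuous_onI)

lemma cutoff_Taylor: "\<exists>\<xi>. cutoff (N + h) = cutoff N - cutoff_k N * h - cutoff_k_deriv \<xi> * h\<^sup>2 / 2 \<and> \<bar>\<xi> - N\<bar> \<le> \<bar>h\<bar>"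
proof (cases "h = 0")
  case True then show ?thesis by (intro exI[of _ N]) simp
next
  case False
  define D where "D i = (if i = 0 then cutoff else if i = 1 then (\<lambda>x. - cutoff_k x) else (\<lambda>x. - cutoff_k_deriv x))" for i :: nat
  have "\<exists>t. (if N + h < N then N + h < t \<and> t < N else N < t \<and> t < N + h) \<and>
     cutoff (N + h) = (\<Sum>m<2. D m N / fact m * (N + h - N) ^ m) + D 2 t / fact 2 * (N + h - N) ^ 2"
  proof (rule Taylor)
    show "\<forall>m t. m < 2 \<and> min N (N + h) \<le> t \<and> t \<le> max N (N + h) \<longrightarrow> DERIV (D m) t :> D (Suc m) t"
    proof (intro allI impI)
      fix m :: nat and t :: real assume "m < 2 \<and> min N (N + h) \<le> t \<and> t \<le> max N (N + h)"
      then have "m = 0 \<or> m = 1" by auto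
      then show "DERIV (D m) t :> D (Suc m) t"
        using DERIV_cutoff[of t] DERIV_minus[OF DERIV_cutoff_k[of t]] by (auto simp: D_def)
    qed
  qed (use False in \<open>auto simp: D_def\<close>)
  then obtain t where t: "if N + h < N then N + h < t \<and> t < N else N < t \<and> t < N + h"
    "cutoff (N + h) = (\<Sum>m<2. D m N / fact m * (N + h - N) ^ m) + D 2 t / fact 2 * (N + h - N) ^ 2" by blast
  have "cutoff (N + h) = cutoff N - cutoff_k N * h - cutoff_k_deriv t * h\<^sup>2 / 2"
    using t(2) by (simp add: D_def numeral_2_eq_2)
  moreover have "\<bar>t - N\<bar> \<le> \<bar>h\<bar>" using t(1) by (auto split: if_splits)
  ultimately show ?thesis by blast
qed

lemma cutoff_Taylor_bound1: "\<bar>cutoff (N + h) - cutoff N + cutoff_k N * h\<bar> \<le> 5000/9 * h\<^sup>2"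
proof -
  obtain \<xi> where e: "cutoff (N + h) = cutoff N - cutoff_k N * h - cutoff_k_deriv \<xi> * h\<^sup>2 / 2" using cutoff_Taylor by blast
  have "cutoff (N + h) - cutoff N + cutoff_k N * h = - (cutoff_k_deriv \<xi> / 2) * h\<^sup>2" unfolding e by simp
  then have "\<bar>cutoff (N + h) - cutoff N + cutoff_k N * h\<bar> = \<bar>cutoff_k_deriv \<xi>\<bar> / 2 * h\<^sup>2" by (simp add: abs_mult)
  also have "\<dots> \<le> 5000/9 * h\<^sup>2" using cutoff_k_deriv_bound[of \<xi>] by (intro mult_right_mono) auto
  finally show ?thesis .
qed

lemma cutoff_Taylor_bound2: "\<bar>cutoff (N + h) - cutoff N + cutoff_k N * h + cutoff_k_deriv N * h\<^sup>2 / 2\<bar> \<le> 5000/9 * \<bar>h\<bar> ^ 3"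
proof -
  obtain \<xi> where e: "cutoff (N + h) = cutoff N - cutoff_k N * h - cutoff_k_deriv \<xi> * h\<^sup>2 / 2" and x: "\<bar>\<xi> - N\<bar> \<le> \<bar>h\<bar>"
    using cutoff_Taylor by blast
  have "cutoff (N + h) - cutoff N + cutoff_k N * h + cutoff_k_deriv N * h\<^sup>2 / 2 = ((cutoff_k_deriv N - cutoff_k_deriv \<xi>) / 2) * h\<^sup>2"
    unfolding e by (simp add: field_simps)
  then have "\<bar>cutoff (N + h) - cutoff N + cutoff_k N * h + cutoff_k_deriv N * h\<^sup>2 / 2\<bar> = \<bar>cutoff_k_deriv N - cutoff_k_deriv \<xi>\<bar> / 2 * h\<^sup>2"
    by (simp only: abs_mult; simp)
  also have "\<dots> \<le> (5000/9 * \<bar>h\<bar>) * h\<^sup>2"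
    using cutoff_k_deriv_Lipschitz[of N \<xi>] x abs_minus_commute[of N \<xi>] abs_ge_zero[of "cutoff_k_deriv N - cutoff_k_deriv \<xi>"]
    by (intro mult_right_mono zero_le_power2) argo
  also have "\<dots> = 5000/9 * \<bar>h\<bar> ^ 3" by (simp add: power3_eq_cube power2_eq_square)
  finally show ?thesis .
qed

text \<open>
  The weight is chosen such that \<open>- shell x\<close> times \<open>x\<close> is the gradient of \<open>cutoff (|x|\<^sup>2)\<close>. Therefore the
  derivative of a shell average in the logarithm of the radius is an integral against a Laplacian.
\<close>

definition shell :: "complex ^ 'n::finite \<Rightarrow> real" where
  "shell x = 2 * cutoff_k ((norm x)\<^sup>2)"

definition shell_mass :: "'n::finite itself \<Rightarrow> real" where
  "shell_mass _ = (\<integral>x. shell (x :: complex ^ 'n) \<partial>lborel)"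

text \<open>
  The Laplacian of \<open>cutoff (|x|\<^sup>2)\<close> on \<open>\<real>\<^sup>2\<^sup>n\<close>.
\<close>

definition unit_bump_laplacian :: "complex ^ 'n::finite \<Rightarrow> real" where
  "unit_bump_laplacian x = - 4 * (real CARD('n) * cutoff_k ((norm x)\<^sup>2) + (norm x)\<^sup>2 * cutoff_k_deriv ((norm x)\<^sup>2))"

lemma shell_radial: "shell (cis \<theta> *s x) = shell x"
  by (simp add: shell_def norm_vector_smult)

lemma shell_borel [measurable]: "shell \<in> borel_measurable borel"
  unfolding shell_def by measurable

lemma unit_bump_laplacian_borel [measurable]: "unit_bump_laplacian \<in> borel_measurable borel"
  unfolding unit_bump_laplacian_def by measurable

lemma shell_nonneg: "0 \<le> shell x" by (simp add: shell_def cutoff_k_nonneg)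

lemma one_le_norm_power2: "1 \<le> norm x \<Longrightarrow> 1 \<le> (norm x)\<^sup>2"
  by (simp add: one_le_power)

lemma weight_shell: "weight (shell :: complex ^ 'n::finite \<Rightarrow> real)"
  unfolding weight_def
proof (intro conjI)
  show "\<exists>M. \<forall>x. 0 \<le> shell x \<and> shell (x :: complex ^ 'n) \<le> M"
  proof (intro exI allI conjI)
    fix x :: "complex ^ 'n"
    show "shell x \<le> 10000/9" using cutoff_k_bound[of "(norm x)\<^sup>2"] by (auto simp: shell_def)
  qed (rule shell_nonneg)
  show "\<forall>x::complex ^ 'n. 2 \<le> norm x \<longrightarrow> shell x = 0"
    using one_le_norm_power2 by (auto simp: shell_def intro!: cutoff_k_zero)
qed measurable

lemma shell_mass_pos: "0 < shell_mass TYPE('n::finite)"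
proof -
  \<comment> \<open>a point in the middle of the shell, where the spline is at least \<open>1/2\<close>\<close>
  define a where "a = (axis undefined (complex_of_real 0.905) :: complex ^ 'n)"
  have na: "norm a = 0.905"
  proof -
    have "norm a = norm (complex_of_real 0.905)"
      unfolding a_def by (simp only: norm_eq_sqrt_inner[of "axis _ _"] inner_axis_axis) (simp only: norm_eq_sqrt_inner if_True simp_thms)
    then show ?thesis by (simp only: norm_of_real) simp
  qed
  have ge: "indicator (ball a 0.03) x \<le> shell x" for x
  proof (cases "x \<in> ball a 0.03")
    case True
    have "\<bar>norm x - norm a\<bar> < 0.03" using True norm_triangle_ineq3[of x a] by (auto simp: dist_norm norm_minus_commute)
    then have n: "0.875 \<le> norm x" "norm x \<le> 0.935" unfolding na abs_less_iff by auto
    have "0.875\<^sup>2 \<le> (norm x)\<^sup>2" "(norm x)\<^sup>2 \<le> 0.935\<^sup>2" using n by (auto intro!: power_mono)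
    then have "1/2 \<le> cutoff_k ((norm x)\<^sup>2)"
      unfolding cutoff_k_def by (intro spline2_ge) (auto simp: knot_def power2_eq_square)
    then show ?thesis using True by (simp add: shell_def)
  qed (simp add: shell_nonneg)
  have i: "integrable lborel (indicator (ball a 0.03) :: _ \<Rightarrow> real)"
    using emeasure_lborel_ball_finite[of a "0.03"] by (intro integrable_real_indicator) auto
  have "0 < measure lborel (ball a 0.03)"
    using content_ball_pos[of "0.03" a] by simp
  also have "\<dots> = (\<integral>x. indicator (ball a 0.03) x \<partial>lborel)" by simp
  also have "\<dots> \<le> shell_mass TYPE('n)"
    unfolding shell_mass_def by (intro integral_mono i weight_integrable weight_shell ge)
  finally show ?thesis .
qed

context Lelong_fn
begin

text \<open>
  The derivative of \<open>avg shell z (exp s)\<close> in \<open>s\<close>, at \<open>exp s = t\<close>; also, up to a power of \<open>t\<close>, the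
  Riesz mass of a bump of radius \<open>t\<close> about \<open>z\<close>.
\<close>

definition log_slope :: "complex ^ 'n \<Rightarrow> real \<Rightarrow> real" where
  "log_slope z t = (\<integral>x. v (z + t *\<^sub>R x) * unit_bump_laplacian x \<partial>lborel)"

text \<open>
  A dilation of the variable moves the difference quotient from the average, which depends on \<open>V\<close>, to
  the smooth weight. The derivative of \<open>e\<^sup>-\<^sup>2\<^sup>n\<^sup>h shell (e\<^sup>-\<^sup>h x)\<close> at \<open>h = 0\<close> is the Laplacian of the bump, and
  the difference quotients are uniformly bounded with support in the ball of radius \<open>2\<close>.
\<close>

lemma avg_difference_quotient_tendsto:
  "(\<lambda>m. (avg shell z (exp (s + 1 / real (m + 2))) - avg shell z (exp s)) / (1 / real (m + 2))) \<longlonglongrightarrow> log_slope z (exp s)"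
proof -
  define h where "h m = 1 / real (m + 2)" for m
  have h: "0 < h m" "h m \<le> 1/2" for m by (auto simp: h_def field_simps)
  have h0: "h \<longlonglongrightarrow> 0"
    unfolding h_def by real_asymp
  define n where "n = real CARD('n)"
  define G where "G N h = 2 * exp (- 2 * n * h) * cutoff_k (exp (- 2 * h) * N)" for N h
  define G' where "G' N h = 2 * exp (- 2 * n * h) * (- 2 * n * cutoff_k (exp (- 2 * h) * N) - 2 * (exp (- 2 * h) * N * cutoff_k_deriv (exp (- 2 * h) * N)))" for N h
  have DG: "((G N) has_real_derivative G' N h) (at h)" for N h
  proof -
    have e: "((\<lambda>h. exp (- 2 * h) * N) has_real_derivative - 2 * exp (- 2 * h) * N) (at h)"
      by (auto intro!: derivative_eq_intros)
    have "((\<lambda>h. cutoff_k (exp (- 2 * h) * N)) has_real_derivative cutoff_k_deriv (exp (- 2 * h) * N) * (- 2 * exp (- 2 * h) * N)) (at h)"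
      by (rule DERIV_chain2[OF DERIV_cutoff_k e])
    then show ?thesis unfolding G_def[abs_def] G'_def
      by (auto intro!: derivative_eq_intros simp: algebra_simps)
  qed
  define M where "M = 4 * (n + 1) * (5000/9)"
  have G'b: "\<bar>G' N k\<bar> \<le> M" if "0 \<le> k" for N k
  proof -
    have n0: "0 \<le> n" by (simp add: n_def)
    have 1: "exp (- 2 * n * k) \<le> 1" using that n0 by simp
    have "\<bar>- 2 * n * cutoff_k (exp (- 2 * k) * N) - 2 * (exp (- 2 * k) * N * cutoff_k_deriv (exp (- 2 * k) * N))\<bar>
       \<le> 2 * n * \<bar>cutoff_k (exp (- 2 * k) * N)\<bar> + 2 * \<bar>exp (- 2 * k) * N * cutoff_k_deriv (exp (- 2 * k) * N)\<bar>"
    proof -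
      have "\<bar>- 2 * n * P - 2 * Q\<bar> \<le> 2 * n * \<bar>P\<bar> + 2 * \<bar>Q\<bar>" for P Q :: real
      proof -
        have "\<bar>- 2 * n * P\<bar> = 2 * n * \<bar>P\<bar>" using n0 by (simp add: abs_mult)
        then show ?thesis by linarith
      qed
      then show ?thesis .
    qed
    also have "\<dots> \<le> 2 * n * (5000/9) + 2 * (5000/9)"
      using cutoff_k_bound cutoff_k_deriv_mult_bound n0 by (intro add_mono mult_left_mono) auto
    also have "\<dots> = 2 * (n + 1) * (5000/9)" by (simp add: algebra_simps)
    finally have 2: "\<bar>- 2 * n * cutoff_k (exp (- 2 * k) * N) - 2 * (exp (- 2 * k) * N * cutoff_k_deriv (exp (- 2 * k) * N))\<bar> \<le> 2 * (n + 1) * (5000/9)" .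
    have "\<bar>G' N k\<bar> = 2 * exp (- 2 * n * k) * \<bar>- 2 * n * cutoff_k (exp (- 2 * k) * N) - 2 * (exp (- 2 * k) * N * cutoff_k_deriv (exp (- 2 * k) * N))\<bar>"
      unfolding G'_def by (subst abs_mult) (simp only: abs_mult abs_exp_cancel abs_numeral)
    also have "\<dots> \<le> 2 * 1 * (2 * (n + 1) * (5000/9))"
    proof -
      have gen: "2 * e * X \<le> 2 * 1 * c" if "0 \<le> e" "e \<le> 1" "0 \<le> X" "X \<le> c" for e X c :: real
        using mult_mono[of "2 * e" 2 X c] that by simp
      show ?thesis by (rule gen[OF _ 1 _ 2]) (rule exp_ge_zero, rule abs_ge_zero)
    qed
    also have "\<dots> = M" by (simp add: M_def)
    finally show ?thesis .
  qed
  define q where "q m x = (G ((norm x)\<^sup>2) (h m) - G ((norm x)\<^sup>2) 0) / h m" for m and x :: "complex ^ 'n"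
  have q_borel[measurable]: "q m \<in> borel_measurable borel" for m
    unfolding q_def G_def by measurable
  have qb: "\<bar>q m x\<bar> \<le> M" for m x
  proof -
    obtain k where k: "0 < k" "k < h m" "G ((norm x)\<^sup>2) (h m) - G ((norm x)\<^sup>2) 0 = (h m - 0) * G' ((norm x)\<^sup>2) k"
      using MVT2[of 0 "h m" "G ((norm x)\<^sup>2)" "G' ((norm x)\<^sup>2)"] DG h(1)[of m] by blast
    then have "q m x = G' ((norm x)\<^sup>2) k" using h(1)[of m] by (simp add: q_def)
    then show ?thesis using G'b[of k] k by simp
  qed
  have Gz: "G ((norm x)\<^sup>2) k = 0" if x: "2 \<le> norm x" and k: "0 \<le> k" "k \<le> 1/2" for x :: "complex ^ 'n" and k
  proof -
    have "exp (2 * k) \<le> exp 1" using k by simp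
    also have "\<dots> \<le> 4" using exp_le by simp
    also have "(4::real) \<le> (norm x)\<^sup>2" using power_mono[OF x, of 2] by simp
    finally have "exp (- 2 * k) * exp (2 * k) \<le> exp (- 2 * k) * (norm x)\<^sup>2" by (intro mult_left_mono) auto
    then have "1 \<le> exp (- 2 * k) * (norm x)\<^sup>2" by (simp flip: exp_add)
    then show ?thesis by (simp add: G_def cutoff_k_zero)
  qed
  have qz: "q m x = 0" if "2 \<le> norm x" for m x
    using Gz[OF that, of "h m"] Gz[OF that, of 0] h[of m] by (simp add: q_def)
  have quot: "(avg shell z (exp (s + h m)) - avg shell z (exp s)) / h m = (\<integral>x. v (z + exp s *\<^sub>R x) * q m x \<partial>lborel)" for m
  proof -
    have iG: "integrable lborel (\<lambda>x. v (z + exp s *\<^sub>R x) * G ((norm x)\<^sup>2) k)" if k: "0 \<le> k" "k \<le> 1/2" for k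
    proof (rule v_affine_integrable[where M = "10000/9" and R = 2])
      fix x :: "complex ^ 'n"
      have "exp (- 2 * n * k) \<le> 1" using k by (simp add: n_def)
      then have "exp (- 2 * n * k) * \<bar>cutoff_k (exp (- 2 * k) * (norm x)\<^sup>2)\<bar> \<le> 1 * (5000/9)"
        using cutoff_k_bound by (intro mult_mono) auto
      then show "\<bar>G ((norm x)\<^sup>2) k\<bar> \<le> 10000/9" by (simp add: G_def abs_mult)
    qed (use Gz k in \<open>auto simp: G_def\<close>)
    have e: "avg shell z (exp (s + k)) = (\<integral>x. v (z + exp s *\<^sub>R x) * G ((norm x)\<^sup>2) k \<partial>lborel)" if k: "0 \<le> k" "k \<le> 1/2" for k
    proof -
      have ek: "exp (- 2 * k) * (norm (exp k *\<^sub>R x))\<^sup>2 = (norm x)\<^sup>2" for x :: "complex ^ 'n"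
        by (simp add: power_mult_distrib exp_minus exp_double[symmetric])
      have "(\<integral>x. v (z + exp s *\<^sub>R x) * G ((norm x)\<^sup>2) k \<partial>lborel)
         = \<bar>exp k\<bar> ^ DIM(complex ^ 'n) * (\<integral>x. v (z + exp s *\<^sub>R (0 + exp k *\<^sub>R x)) * G ((norm (0 + exp k *\<^sub>R x))\<^sup>2) k \<partial>lborel)"
        by (rule lborel_affine_integral(2)[OF iG[OF k]]) simp
      also have "\<dots> = \<bar>exp k\<bar> ^ DIM(complex ^ 'n) * (\<integral>x. exp (- 2 * n * k) * (v (z + exp (s + k) *\<^sub>R x) * shell x) \<partial>lborel)"
      proof -
        have "G ((norm (0 + exp k *\<^sub>R x))\<^sup>2) k = exp (- 2 * n * k) * shell x" for x :: "complex ^ 'n"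
          using ek[of x] by (simp add: G_def shell_def)
        then show ?thesis by (simp add: exp_add mult_ac)
      qed
      also have "\<dots> = (exp k ^ (2 * CARD('n)) * exp (- 2 * n * k)) * avg shell z (exp (s + k))"
        by (simp add: avg_def) (simp add: mult.commute)
      also have "exp k ^ (2 * CARD('n)) * exp (- 2 * n * k) = 1"
        by (simp add: n_def exp_of_nat_mult[symmetric] mult_ac flip: exp_add)
      finally show ?thesis by simp
    qed
    have "avg shell z (exp (s + h m)) - avg shell z (exp s) = (\<integral>x. v (z + exp s *\<^sub>R x) * G ((norm x)\<^sup>2) (h m) - v (z + exp s *\<^sub>R x) * G ((norm x)\<^sup>2) 0 \<partial>lborel)"
      using e[of "h m"] e[of 0] iG[of "h m"] iG[of 0] h[of m] by simp
    also have "\<dots> = (\<integral>x. h m * (v (z + exp s *\<^sub>R x) * q m x) \<partial>lborel)"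
      using h(1)[of m] by (intro Bochner_Integration.integral_cong) (auto simp: q_def field_simps)
    finally show ?thesis using h(1)[of m] by simp
  qed
  have "(\<lambda>m. \<integral>x. v (z + exp s *\<^sub>R x) * q m x \<partial>lborel) \<longlonglongrightarrow> (\<integral>x. v (z + exp s *\<^sub>R x) * unit_bump_laplacian x \<partial>lborel)"
  proof (rule integral_dominated_convergence[where w = "\<lambda>x. \<bar>v (z + exp s *\<^sub>R x) * (M * indicator (ball 0 2) x)\<bar>"])
    have M0: "0 \<le> M" by (simp add: M_def n_def)
    show "integrable lborel (\<lambda>x. \<bar>v (z + exp s *\<^sub>R x) * (M * indicator (ball 0 2) x)\<bar>)"
      using M0 by (intro integrable_abs v_affine_integrable[where M = M and R = 2]) (auto split: split_indicator)
    show "AE x in lborel. norm (v (z + exp s *\<^sub>R x) * q m x) \<le> \<bar>v (z + exp s *\<^sub>R x) * (M * indicator (ball 0 2) x)\<bar>" for m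
    proof (rule AE_I2)
      fix x :: "complex ^ 'n"
      show "norm (v (z + exp s *\<^sub>R x) * q m x) \<le> \<bar>v (z + exp s *\<^sub>R x) * (M * indicator (ball 0 2) x)\<bar>"
        using qb[of m x] qz[of x m] M0 by (auto simp: abs_mult split: split_indicator intro!: mult_left_mono)
    qed
    show "AE x in lborel. (\<lambda>m. v (z + exp s *\<^sub>R x) * q m x) \<longlonglongrightarrow> v (z + exp s *\<^sub>R x) * unit_bump_laplacian x"
    proof (rule AE_I2, rule tendsto_mult_left)
      fix x :: "complex ^ 'n"
      have l: "unit_bump_laplacian x = G' ((norm x)\<^sup>2) 0" by (simp add: unit_bump_laplacian_def G'_def n_def)
      have "((\<lambda>k. (G ((norm x)\<^sup>2) (0 + k) - G ((norm x)\<^sup>2) 0) / k) \<longlongrightarrow> G' ((norm x)\<^sup>2) 0) (at 0)"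
        using DG[of "(norm x)\<^sup>2" 0] unfolding DERIV_def .
      moreover have "filterlim h (at 0) sequentially"
        unfolding filterlim_at using h0 h(1) by (auto intro!: always_eventually simp: less_imp_neq[symmetric])
      ultimately have "((\<lambda>m. (G ((norm x)\<^sup>2) (0 + h m) - G ((norm x)\<^sup>2) 0) / h m) \<longlonglongrightarrow> G' ((norm x)\<^sup>2) 0)"
        by (rule filterlim_compose)
      then show "(\<lambda>m. q m x) \<longlonglongrightarrow> unit_bump_laplacian x" by (simp add: q_def l)
    qed
  qed measurable
  then show ?thesis unfolding log_slope_def quot[symmetric] h_def .
qed

lemma log_slope_le_shell_mass: "log_slope z (exp s) \<le> shell_mass TYPE('n)"
proof (rule LIMSEQ_le_const2[OF avg_difference_quotient_tendsto])
  show "\<exists>N. \<forall>m\<ge>N. (avg shell z (exp (s + 1 / real (m + 2))) - avg shell z (exp s)) / (1 / real (m + 2)) \<le> shell_mass TYPE('n)"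
  proof (intro exI allI impI)
    fix m :: nat
    have "avg shell z (exp (s + 1 / real (m + 2))) - avg shell z (exp s) \<le> shell_mass TYPE('n) * (s + 1 / real (m + 2) - s)"
      unfolding shell_mass_def by (rule avg_slope_le[OF weight_shell shell_radial]) simp
    then show "(avg shell z (exp (s + 1 / real (m + 2))) - avg shell z (exp s)) / (1 / real (m + 2)) \<le> shell_mass TYPE('n)"
      by (subst pos_divide_le_eq) auto
  qed
qed

text \<open>
  A convex function stays above its tangent at the right end point.
\<close>

lemma avg_difference_le_log_slope:
  assumes s: "s' < s"
  shows "avg shell z (exp s) - avg shell z (exp s') \<le> (s - s') * log_slope z (exp s)"
proof -
  define g where "g s = avg shell z (exp s)" for s
  have cv: "convex_on UNIV g" unfolding g_def by (rule avg_log_convex[OF weight_shell shell_radial])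
  have "(g s - g s') / (s - s') \<le> log_slope z (exp s)"
  proof (rule LIMSEQ_le_const[OF avg_difference_quotient_tendsto])
    show "\<exists>N. \<forall>m\<ge>N. (g s - g s') / (s - s') \<le> (avg shell z (exp (s + 1 / real (m + 2))) - avg shell z (exp s)) / (1 / real (m + 2))"
    proof (intro exI allI impI)
      fix m :: nat
      define t where "t = s + 1 / real (m + 2)"
      have t: "s < t" by (simp add: t_def)
      have flip: "(a - b) / (c - d) = (b - a) / (d - c)" for a b c d :: real
        using minus_divide_divide[of "b - a" "d - c"] by simp
      have "(g s' - g s) / (s' - s) \<le> (g s - g t) / (s - t)"
        using convex_on_slope_le[OF cv, of s' t s] s t by simp
      then have "(g s - g s') / (s - s') \<le> (g t - g s) / (t - s)"
        unfolding flip[of "g s'"] flip[of "g s" "g t"] .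
      then show "(g s - g s') / (s - s') \<le> (avg shell z (exp (s + 1 / real (m + 2))) - avg shell z (exp s)) / (1 / real (m + 2))"
        by (simp add: g_def t_def)
    qed
  qed
  then show ?thesis using s by (simp add: g_def pos_divide_le_eq mult.commute)
qed

text \<open>
  The radius \<open>4 / 5\<close> enters because the logarithm is at least \<open>ln (4 / 5)\<close> on the shell.
\<close>

lemma shell_avg_ge:
  assumes LP: "ereal_integral FS_measure (Robin_proj V) = 0"
  shows "(s + ln (4/5)) * shell_mass TYPE('n) \<le> avg shell z (exp s)"
proof -
  define W where "W r = 2 * cutoff_k ((max 0 r)\<^sup>2)" for r :: real
  have sh: "(\<lambda>x :: complex ^ 'n. W (norm x)) = shell" by (auto simp: W_def shell_def fun_eq_iff)
  have "(s + ln (4/5)) * (\<integral>x. W (norm (x :: complex ^ 'n)) \<partial>lborel) \<le> avg (\<lambda>x. W (norm x)) z (exp s)"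
  proof (rule avg_ge[OF LP])
    show "continuous_on UNIV W" unfolding W_def
      by (intro continuous_intros continuous_on_compose2[OF continuous_cutoff(2)]) auto
    show "0 \<le> W r" for r by (simp add: W_def cutoff_k_nonneg)
    show "W r = 0" if "r < 4/5" for r
    proof -
      have "(max 0 r)\<^sup>2 \<le> (4/5)\<^sup>2" using that by (intro power_mono) auto
      then show ?thesis by (simp add: W_def cutoff_k_zero power2_eq_square)
    qed
    show "W r = 0" if "1 < r" for r
    proof -
      have "1\<^sup>2 \<le> (max 0 r)\<^sup>2" using that by (intro power_mono) auto
      then show ?thesis by (simp add: W_def cutoff_k_zero)
    qed
  qed
  then show ?thesis unfolding sh shell_mass_def by (simp add: shell_def)
qed

end

section \<open>Smooth bumps and circle averages\<close>

lemma integral_circ: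
  fixes f :: "real \<Rightarrow> real"
  assumes f: "continuous_on UNIV f" and F: "\<And>x. (F has_real_derivative f x) (at x)"
  shows "integrable circ f" and "(\<integral>\<theta>. f \<theta> \<partial>circ) = (F (2 * pi) - F 0) / (2 * pi)"
proof -
  have "(f has_integral (F (2*pi) - F 0)) {0..2*pi}"
    by (rule fundamental_theorem_of_calculus)
       (auto intro: has_field_derivative_at_within F simp flip: has_real_derivative_iff_has_vector_derivative)
  from circ_integral_of_has_integral[OF f this]
  show "integrable circ f" "(\<integral>\<theta>. f \<theta> \<partial>circ) = (F (2 * pi) - F 0) / (2 * pi)" .
qed

lemma inner_cis: "x \<bullet> cis \<theta> = Re x * cos \<theta> + Im x * sin \<theta>"
  by (simp add: inner_complex_def)

lemma circ_mean_inner: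
  "integrable circ (\<lambda>\<theta>. x \<bullet> cis \<theta>)" "(\<integral>\<theta>. x \<bullet> cis \<theta> \<partial>circ) = 0"
proof -
  have d: "((\<lambda>\<theta>. Re x * sin \<theta> - Im x * cos \<theta>) has_real_derivative (x \<bullet> cis \<theta>)) (at \<theta>)" for \<theta>
    unfolding inner_cis by (auto intro!: derivative_eq_intros)
  have c: "continuous_on UNIV (\<lambda>\<theta>. x \<bullet> cis \<theta>)" by (intro continuous_intros)
  show "integrable circ (\<lambda>\<theta>. x \<bullet> cis \<theta>)" "(\<integral>\<theta>. x \<bullet> cis \<theta> \<partial>circ) = 0"
    using integral_circ[OF c d] by auto
qed

lemma circ_mean_inner_power2:
  "integrable circ (\<lambda>\<theta>. (x \<bullet> cis \<theta>)\<^sup>2)" "(\<integral>\<theta>. (x \<bullet> cis \<theta>)\<^sup>2 \<partial>circ) = (cmod x)\<^sup>2 / 2"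
proof -
  define F where "F \<theta> = ((Re x)\<^sup>2 + (Im x)\<^sup>2) / 2 * \<theta> + ((Re x)\<^sup>2 - (Im x)\<^sup>2) / 2 * (sin \<theta> * cos \<theta>) + Re x * Im x * (sin \<theta>)\<^sup>2" for \<theta>
  have d: "(F has_real_derivative ((x \<bullet> cis \<theta>)\<^sup>2)) (at \<theta>)" for \<theta>
  proof -
    have "(F has_real_derivative (((Re x)\<^sup>2 + (Im x)\<^sup>2) / 2 + ((Re x)\<^sup>2 - (Im x)\<^sup>2) / 2 * (cos \<theta> * cos \<theta> - sin \<theta> * sin \<theta>) + Re x * Im x * (2 * sin \<theta> * cos \<theta>))) (at \<theta>)"
      unfolding F_def[abs_def] by (auto intro!: derivative_eq_intros simp: field_simps)
    moreover have "((Re x)\<^sup>2 + (Im x)\<^sup>2) / 2 + ((Re x)\<^sup>2 - (Im x)\<^sup>2) / 2 * (cos \<theta> * cos \<theta> - sin \<theta> * sin \<theta>) + Re x * Im x * (2 * sin \<theta> * cos \<theta>) = (x \<bullet> cis \<theta>)\<^sup>2"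
    proof -
      have sc: "sin \<theta> * sin \<theta> = 1 - cos \<theta> * cos \<theta>" using sin_cos_squared_add[of \<theta>] by (simp add: power2_eq_square)
      have alg: "(a\<^sup>2 + b\<^sup>2) / 2 + (a\<^sup>2 - b\<^sup>2) / 2 * (c * c - S) + a * b * (2 * s * c) = (a * c + b * s)\<^sup>2"
        if "S = 1 - c * c" "s * s = S" for a b c s S :: real
      proof -
        have "(a * c + b * s)\<^sup>2 = a\<^sup>2 * (c * c) + b\<^sup>2 * (s * s) + a * b * (2 * s * c)"
          by (simp add: power2_eq_square algebra_simps)
        also have "\<dots> = a\<^sup>2 * (c * c) + b\<^sup>2 * (1 - c * c) + a * b * (2 * s * c)" using that by simp
        also have "\<dots> = (a\<^sup>2 + b\<^sup>2) / 2 + (a\<^sup>2 - b\<^sup>2) / 2 * (c * c - S) + a * b * (2 * s * c)"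
          unfolding that(1) by (simp add: field_simps)
        finally show ?thesis by simp
      qed
      show ?thesis unfolding inner_cis by (rule alg[OF sc refl])
    qed
    ultimately show ?thesis by simp
  qed
  have c: "continuous_on UNIV (\<lambda>\<theta>. (x \<bullet> cis \<theta>)\<^sup>2)" by (intro continuous_intros)
  have "F (2 * pi) - F 0 = (cmod x)\<^sup>2 * pi"
    by (simp add: F_def cmod_power2)
  then show "integrable circ (\<lambda>\<theta>. (x \<bullet> cis \<theta>)\<^sup>2)" "(\<integral>\<theta>. (x \<bullet> cis \<theta>)\<^sup>2 \<partial>circ) = (cmod x)\<^sup>2 / 2"
    using integral_circ[OF c d] by auto
qed

lemma circ_integrable_bounded:
  fixes f :: "real \<Rightarrow> real"
  assumes "f \<in> borel_measurable borel" "\<And>\<theta>. \<bar>f \<theta>\<bar> \<le> M"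
  shows "integrable circ f"
proof -
  interpret finite_measure circ by (rule finite_measure_circ)
  have "f \<in> borel_measurable circ" using assms(1) by simp
  then show ?thesis using assms(2) by (intro integrable_const_bound[where B = M]) (auto intro!: AE_I2)
qed

lemma circ_integral_const [simp]: "(\<integral>\<theta>. c \<partial>circ) = (c::real)"
proof -
  have "measure circ UNIV = 1" using prob_space_circ by (simp add: measure_def)
  then show ?thesis by (simp add: space_uniform_measure)
qed

lemma circ_integral_bound:
  fixes f :: "real \<Rightarrow> real"
  assumes f: "f \<in> borel_measurable borel" "\<And>\<theta>. \<bar>f \<theta>\<bar> \<le> M"
  shows "\<bar>\<integral>\<theta>. f \<theta> \<partial>circ\<bar> \<le> M"
proof -
  interpret finite_measure circ by (rule finite_measure_circ)
  have "\<bar>\<integral>\<theta>. f \<theta> \<partial>circ\<bar> \<le> (\<integral>\<theta>. \<bar>f \<theta>\<bar> \<partial>circ)" by (rule integral_abs_bound)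
  also have "\<dots> \<le> (\<integral>\<theta>. M \<partial>circ)"
    using circ_integrable_bounded[OF f] f(2) by (intro integral_mono) auto
  finally show ?thesis by simp
qed

definition circ_avg :: "(complex ^ 'n::finite \<Rightarrow> real) \<Rightarrow> complex ^ 'n \<Rightarrow> complex ^ 'n \<Rightarrow> real" where
  "circ_avg \<phi> b y = (\<integral>\<theta>. \<phi> (y + cis \<theta> *s b) \<partial>circ)"

lemma circ_avg_borel [measurable]:
  assumes [measurable]: "\<phi> \<in> borel_measurable borel"
  shows "circ_avg \<phi> b \<in> borel_measurable borel"
proof -
  interpret finite_measure circ by (rule finite_measure_circ)
  have "sets (borel \<Otimes>\<^sub>M circ) = sets (borel \<Otimes>\<^sub>M (borel :: real measure))"
    by (intro sets_pair_measure_cong) auto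
  then have "(\<lambda>(y, \<theta>). \<phi> (y + cis \<theta> *s b)) \<in> borel_measurable (borel \<Otimes>\<^sub>M circ)"
    by (simp cong: measurable_cong_sets)
  then show ?thesis unfolding circ_avg_def[abs_def] by (rule borel_measurable_lebesgue_integral)
qed

lemma circ_avg_bound:
  assumes [measurable]: "\<phi> \<in> borel_measurable borel" and M: "\<And>x. \<bar>\<phi> x\<bar> \<le> M"
  shows "\<bar>circ_avg \<phi> b y\<bar> \<le> M"
  unfolding circ_avg_def by (rule circ_integral_bound) (use M in auto)

lemma circ_avg_zero:
  assumes supp: "\<And>x. R \<le> norm x \<Longrightarrow> \<phi> x = 0" and y: "R + norm b \<le> norm y"
  shows "circ_avg \<phi> b y = 0"
proof -
  have "\<phi> (y + cis \<theta> *s b) = 0" for \<theta>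
  proof (rule supp)
    have "norm y - norm (cis \<theta> *s b) \<le> norm (y + cis \<theta> *s b)" by (rule norm_diff_ineq)
    then show "R \<le> norm (y + cis \<theta> *s b)" using y by (simp add: norm_vector_smult)
  qed
  then show ?thesis by (simp add: circ_avg_def)
qed

lemma ennreal_circ_avg:
  assumes [measurable]: "\<phi> \<in> borel_measurable borel" and M: "\<And>x. 0 \<le> \<phi> x" "\<And>x. \<bar>\<phi> x\<bar> \<le> M"
  shows "(\<integral>\<^sup>+\<theta>. ennreal (\<phi> (y + cis \<theta> *s b)) \<partial>circ) = ennreal (circ_avg \<phi> b y)"
  unfolding circ_avg_def
  by (rule nn_integral_eq_integral) (use M in \<open>auto intro!: circ_integrable_bounded\<close>)

lemma circ_avg_nonneg: "(\<And>x. 0 \<le> \<phi> x) \<Longrightarrow> 0 \<le> circ_avg \<phi> b y"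
  unfolding circ_avg_def by (intro integral_nonneg_AE) auto

context Lelong_fn
begin

text \<open>
  The weak form of subharmonicity: by Tonelli's theorem the average over circles moves from the test
  function \<open>\<phi>\<close> to \<open>B - V\<close>, where it can only decrease the values. The constant \<open>B\<close> drops out because
  averaging preserves the integral of \<open>\<phi>\<close>.
\<close>

lemma integral_circ_avg_ge:
  assumes \<phi>[measurable]: "\<phi> \<in> borel_measurable borel" and M: "\<And>x. 0 \<le> \<phi> x" "\<And>x. \<bar>\<phi> x\<bar> \<le> M" and supp: "\<And>x. R \<le> norm x \<Longrightarrow> \<phi> x = 0"
  shows "(\<integral>y. v y * \<phi> y \<partial>lborel) \<le> (\<integral>y. v y * circ_avg \<phi> b y \<partial>lborel)"
proof -
  define R' where "R' = max 1 (R + norm b)"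
  define B where "B = ln R' + C"
  have VB: "V y \<le> ereal B" if "norm y \<le> R'" for y
    unfolding B_def using that by (intro V_le) (auto simp: R'_def)
  have t: "y - cis \<theta> *s b = y + cis \<theta> *s (- b)" for y \<theta> by (simp add: vec_eq_iff)
  \<comment> \<open>Tonelli and translation invariance move the average from the test function to the potential\<close>
  have swap: "(\<integral>\<^sup>+y. h y * ennreal (circ_avg \<phi> b y) \<partial>lborel) = (\<integral>\<^sup>+y. (\<integral>\<^sup>+\<theta>. h (y + cis \<theta> *s (- b)) \<partial>circ) * ennreal (\<phi> y) \<partial>lborel)"
    if h[measurable]: "h \<in> borel_measurable borel" for h :: "complex ^ 'n \<Rightarrow> ennreal"
  proof -
    have "(\<integral>\<^sup>+y. h y * ennreal (circ_avg \<phi> b y) \<partial>lborel) = (\<integral>\<^sup>+y. (\<integral>\<^sup>+\<theta>. h y * ennreal (\<phi> (y + cis \<theta> *s b)) \<partial>circ) \<partial>lborel)"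
      unfolding ennreal_circ_avg[OF \<phi> M, symmetric]
      by (intro nn_integral_cong nn_integral_cmult[symmetric]) (simp cong: measurable_cong_sets)
    also have "\<dots> = (\<integral>\<^sup>+\<theta>. (\<integral>\<^sup>+y. h y * ennreal (\<phi> (y + cis \<theta> *s b)) \<partial>lborel) \<partial>circ)"
      by (rule circ_Tonelli[OF sigma_finite_lborel, symmetric]) measurable
    also have "\<dots> = (\<integral>\<^sup>+\<theta>. (\<integral>\<^sup>+y. h (y + cis \<theta> *s (- b)) * ennreal (\<phi> y) \<partial>lborel) \<partial>circ)"
    proof (rule nn_integral_cong)
      fix \<theta>
      have "(\<integral>\<^sup>+y. h y * ennreal (\<phi> (y + cis \<theta> *s b)) \<partial>lborel) = (\<integral>\<^sup>+y. h (- (cis \<theta> *s b) + y) * ennreal (\<phi> (- (cis \<theta> *s b) + y + cis \<theta> *s b)) \<partial>lborel)"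
        by (rule nn_integral_lborel_translate[symmetric]) measurable
      then show "(\<integral>\<^sup>+y. h y * ennreal (\<phi> (y + cis \<theta> *s b)) \<partial>lborel) = (\<integral>\<^sup>+y. h (y + cis \<theta> *s (- b)) * ennreal (\<phi> y) \<partial>lborel)"
        by (simp add: t[symmetric])
    qed
    also have "\<dots> = (\<integral>\<^sup>+y. (\<integral>\<^sup>+\<theta>. h (y + cis \<theta> *s (- b)) * ennreal (\<phi> y) \<partial>circ) \<partial>lborel)"
      by (rule circ_Tonelli[OF sigma_finite_lborel]) measurable
    also have "\<dots> = (\<integral>\<^sup>+y. (\<integral>\<^sup>+\<theta>. h (y + cis \<theta> *s (- b)) \<partial>circ) * ennreal (\<phi> y) \<partial>lborel)"
      by (intro nn_integral_cong nn_integral_multc) (simp cong: measurable_cong_sets)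
    finally show ?thesis .
  qed
  define T where "T = circ_avg \<phi> b"
  have T[measurable]: "T \<in> borel_measurable borel" unfolding T_def by measurable
  have TM: "0 \<le> T x" "\<bar>T x\<bar> \<le> M" for x unfolding T_def by (auto intro!: circ_avg_nonneg circ_avg_bound M)
  have Tz: "T y = 0" if "R' \<le> norm y" for y
    unfolding T_def by (rule circ_avg_zero[OF supp]) (use that in \<open>auto simp: R'_def\<close>)
  have \<phi>z: "\<phi> y = 0" if "R' \<le> norm y" for y
  proof (rule supp)
    have "R + norm b \<le> norm y" using that by (simp add: R'_def)
    then show "R \<le> norm y" using norm_ge_zero[of b] by linarith
  qed
  have real: "(\<integral>\<^sup>+y. defect B y * ennreal (g y) \<partial>lborel) = ennreal (B * (\<integral>y. g y \<partial>lborel) - (\<integral>y. v y * g y \<partial>lborel))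
     \<and> (\<integral>y. v y * g y \<partial>lborel) \<le> B * (\<integral>y. g y \<partial>lborel) \<and> (\<integral>\<^sup>+y. ennreal (g y) \<partial>lborel) = ennreal (\<integral>y. g y \<partial>lborel)"
    if g[measurable]: "g \<in> borel_measurable borel" and gM: "\<And>x. 0 \<le> g x" "\<And>x. \<bar>g x\<bar> \<le> M" and gz: "\<And>y. R' \<le> norm y \<Longrightarrow> g y = 0" for g
  proof -
    have ig: "integrable lborel g" by (rule bounded_support_integrable[OF g gM(2) gz])
    have iv: "integrable lborel (\<lambda>y. v y * g y)" by (rule v_weight_integrable[OF g gM(2) gz])
    have nn: "AE y in lborel. 0 \<le> B * g y - v y * g y \<and> defect B y * ennreal (g y) = ennreal (B * g y - v y * g y)"
      using AE_V_eq
    proof eventually_elim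
      case (elim y)
      show ?case
      proof (cases "norm y < R'")
        case True
        then have le: "v y \<le> B" using VB[of y] elim by simp
        then have "0 \<le> (B - v y) * g y" using gM by simp
        moreover have "defect B y * ennreal (g y) = ennreal ((B - v y) * g y)"
          using le gM by (simp add: defect_def elim ennreal_mult)
        ultimately show ?thesis by (simp add: left_diff_distrib)
      next
        case False then show ?thesis using gz[of y] by simp
      qed
    qed
    have i: "integrable lborel (\<lambda>y. B * g y - v y * g y)" using ig iv by auto
    have "(\<integral>\<^sup>+y. defect B y * ennreal (g y) \<partial>lborel) = (\<integral>\<^sup>+y. ennreal (B * g y - v y * g y) \<partial>lborel)"
      using nn by (intro nn_integral_cong_AE) auto
    also have "\<dots> = ennreal (\<integral>y. B * g y - v y * g y \<partial>lborel)"
      using nn by (intro nn_integral_eq_integral[OF i]) auto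
    finally have 1: "(\<integral>\<^sup>+y. defect B y * ennreal (g y) \<partial>lborel) = ennreal (B * (\<integral>y. g y \<partial>lborel) - (\<integral>y. v y * g y \<partial>lborel))"
      using ig iv by simp
    have "0 \<le> (\<integral>y. B * g y - v y * g y \<partial>lborel)" using nn by (intro integral_nonneg_AE) auto
    then have 2: "(\<integral>y. v y * g y \<partial>lborel) \<le> B * (\<integral>y. g y \<partial>lborel)" using ig iv by simp
    have "(\<integral>\<^sup>+y. ennreal (g y) \<partial>lborel) = ennreal (\<integral>y. g y \<partial>lborel)"
      using gM by (intro nn_integral_eq_integral[OF ig]) auto
    with 1 2 show ?thesis by blast
  qed
  have "ennreal (\<integral>y. T y \<partial>lborel) = (\<integral>\<^sup>+y. 1 * ennreal (T y) \<partial>lborel)"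
    using real[OF T TM Tz] by simp
  also have "\<dots> = (\<integral>\<^sup>+y. ennreal (\<phi> y) \<partial>lborel)" unfolding T_def by (subst swap) auto
  also have "\<dots> = ennreal (\<integral>y. \<phi> y \<partial>lborel)" using real[OF \<phi> M \<phi>z] by simp
  finally have int_eq: "(\<integral>y. T y \<partial>lborel) = (\<integral>y. \<phi> y \<partial>lborel)"
    using TM M by (simp add: ennreal_inj integral_nonneg_AE)
  have "(\<integral>\<^sup>+y. defect B y * ennreal (T y) \<partial>lborel) = (\<integral>\<^sup>+y. (\<integral>\<^sup>+\<theta>. defect B (y + cis \<theta> *s (- b)) \<partial>circ) * ennreal (\<phi> y) \<partial>lborel)"
    unfolding T_def by (rule swap) measurable
  also have "\<dots> \<le> (\<integral>\<^sup>+y. defect B y * ennreal (\<phi> y) \<partial>lborel)"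
  proof (rule nn_integral_mono)
    fix y :: "complex ^ 'n"
    show "(\<integral>\<^sup>+\<theta>. defect B (y + cis \<theta> *s (- b)) \<partial>circ) * ennreal (\<phi> y) \<le> defect B y * ennreal (\<phi> y)"
    proof (cases "norm y < R")
      case True
      have "(\<integral>\<^sup>+\<theta>. defect B (y + cis \<theta> *s (- b)) \<partial>circ) \<le> defect B y"
      proof (rule supermean[OF VB])
        fix \<theta>
        show "norm (y + cis \<theta> *s - b) \<le> R'"
          using norm_triangle_ineq[of y "cis \<theta> *s (- b)"] True by (simp add: norm_vector_smult R'_def)
      qed
      then show ?thesis by (rule mult_right_mono) simp
    next
      case False then show ?thesis using supp[of y] by simp
    qed
  qed
  finally have "ennreal (B * (\<integral>y. T y \<partial>lborel) - (\<integral>y. v y * T y \<partial>lborel)) \<le> ennreal (B * (\<integral>y. \<phi> y \<partial>lborel) - (\<integral>y. v y * \<phi> y \<partial>lborel))"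
    using real[OF T TM Tz] real[OF \<phi> M \<phi>z] by simp
  then have "B * (\<integral>y. T y \<partial>lborel) - (\<integral>y. v y * T y \<partial>lborel) \<le> B * (\<integral>y. \<phi> y \<partial>lborel) - (\<integral>y. v y * \<phi> y \<partial>lborel)"
    using real[OF \<phi> M \<phi>z] by (subst (asm) ennreal_le_iff) auto
  then have "(\<integral>y. v y * \<phi> y \<partial>lborel) \<le> (\<integral>y. v y * T y \<partial>lborel)" unfolding int_eq by simp
  then show ?thesis by (simp add: T_def)
qed

end

definition bump :: "complex ^ 'n::finite \<Rightarrow> real \<Rightarrow> complex ^ 'n \<Rightarrow> real" where
  "bump z t y = cutoff ((norm (y - z))\<^sup>2 / t\<^sup>2)"

lemma bump_borel [measurable]: "bump z t \<in> borel_measurable borel"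
  unfolding bump_def by measurable

lemma bump_bounds: "0 \<le> bump z t y" "bump z t y \<le> 3/25" "\<bar>bump z t y\<bar> \<le> 3/25"
  using cutoff_nonneg cutoff_le by (auto simp: bump_def)

lemma bump_zero: 
  assumes "0 < t" "t \<le> norm (y - z)"
  shows "bump z t y = 0"
proof -
  have "t\<^sup>2 \<le> (norm (y - z))\<^sup>2" using assms by (intro power_mono) auto
  then show ?thesis unfolding bump_def using assms by (intro cutoff_zero) simp
qed

lemma bump_plateau: 
  assumes "0 < t" "norm (y - z) \<le> 4/5 * t"
  shows "bump z t y = 3/25"
proof -
  have "(norm (y - z))\<^sup>2 \<le> (4/5 * t)\<^sup>2" using assms by (intro power_mono) auto
  then have "(norm (y - z))\<^sup>2 / t\<^sup>2 \<le> 16/25" using assms by (simp add: divide_le_eq power_mult_distrib power2_eq_square)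
  then show ?thesis unfolding bump_def by (rule cutoff_plateau)
qed

text \<open>
  Along the circle the squared norm changes by \<open>t\<^sup>2 H\<close> with \<open>|H| \<le> h\<close>, so Taylor's formula for the
  cutoff reduces everything to the means of \<open>H\<close> and \<open>H\<^sup>2\<close>.
\<close>

lemma circ_avg_bump:
  fixes y z :: "complex ^ 'n::finite" and j :: 'n
  assumes t: "0 < t" and e: "0 < e"
  defines "N \<equiv> (norm (y - z))\<^sup>2 / t\<^sup>2"
    and "a \<equiv> cmod ((y - z) $ j)" and "h \<equiv> (2 * e * norm (y - z) + e\<^sup>2) / t\<^sup>2"
  shows "\<bar>circ_avg (bump z t) (axis j (of_real e)) y - bump z t y\<bar> \<le> 5000/9 * (e\<^sup>2 / t\<^sup>2) + 5000/9 * h\<^sup>2"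
    and "\<bar>circ_avg (bump z t) (axis j (of_real e)) y - bump z t y + cutoff_k N * (e\<^sup>2 / t\<^sup>2)
       + cutoff_k_deriv N * ((2 * e\<^sup>2 * a\<^sup>2 + e ^ 4) / t ^ 4) / 2\<bar> \<le> 5000/9 * h ^ 3"
proof -
  define x where "x = y - z"
  define c where "c \<theta> = x $ j \<bullet> cis \<theta>" for \<theta>
  define H where "H \<theta> = (2 * e * c \<theta> + e\<^sup>2) / t\<^sup>2" for \<theta>
  have cH[measurable]: "c \<in> borel_measurable borel" "H \<in> borel_measurable borel"
    unfolding H_def c_def by measurable
  have bH: "bump z t (y + cis \<theta> *s axis j (of_real e)) = cutoff (N + H \<theta>)" for \<theta>
  proof -
    have "y + cis \<theta> *s axis j (of_real e) - z = x + e *\<^sub>R axis j (cis \<theta>)"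
      by (auto simp: x_def vec_eq_iff axis_def scaleR_conv_of_real[where 'a = complex])
    then have "(norm (y + cis \<theta> *s axis j (of_real e) - z))\<^sup>2 = (norm x)\<^sup>2 + 2 * e * c \<theta> + e\<^sup>2"
      by (simp only: norm_add_axis_power2) (simp add: c_def)
    then show ?thesis by (simp add: bump_def N_def H_def x_def add_divide_distrib add.assoc)
  qed
  have cb: "\<bar>c \<theta>\<bar> \<le> norm x" for \<theta>
  proof -
    have "\<bar>c \<theta>\<bar> \<le> norm (x $ j) * norm (cis \<theta>)" unfolding c_def by (rule Cauchy_Schwarz_ineq2)
    also have "\<dots> \<le> norm x" using Finite_Cartesian_Product.norm_nth_le[of x j] by simp
    finally show ?thesis .
  qed
  have h0: "0 \<le> h" using e t by (simp add: h_def)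
  have Hh: "\<bar>H \<theta>\<bar> \<le> h" for \<theta>
  proof -
    have "\<bar>2 * e * c \<theta> + e\<^sup>2\<bar> \<le> \<bar>2 * e * c \<theta>\<bar> + \<bar>e\<^sup>2\<bar>" by (rule abs_triangle_ineq)
    also have "\<dots> \<le> 2 * e * norm x + e\<^sup>2" using cb[of \<theta>] e by (simp add: abs_mult)
    finally show ?thesis unfolding H_def h_def x_def using t by (simp add: abs_divide divide_right_mono)
  qed
  have H2h: "(H \<theta>)\<^sup>2 \<le> h\<^sup>2" for \<theta> using Hh[of \<theta>] h0 by (simp add: abs_le_square_iff[symmetric])
  have iH: "integrable circ H" by (rule circ_integrable_bounded[OF cH(2) Hh])
  have iH2: "integrable circ (\<lambda>\<theta>. (H \<theta>)\<^sup>2)" by (rule circ_integrable_bounded[where M = "h\<^sup>2"]) (use H2h in auto)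
  have iP: "integrable circ (\<lambda>\<theta>. cutoff (N + H \<theta>))"
    by (rule circ_integrable_bounded[where M = "3/25"]) (use cutoff_nonneg cutoff_le in auto)
  interpret finite_measure circ by (rule finite_measure_circ)
  have mH: "(\<integral>\<theta>. H \<theta> \<partial>circ) = e\<^sup>2 / t\<^sup>2"
    unfolding H_def c_def using circ_mean_inner[of "x $ j"] by simp
  have H2: "(H \<theta>)\<^sup>2 = (4 * e\<^sup>2 / t ^ 4) * (c \<theta>)\<^sup>2 + (4 * e ^ 3 / t ^ 4) * c \<theta> + e ^ 4 / t ^ 4" for \<theta>
  proof -
    have "(2 * e * c \<theta> + e\<^sup>2)\<^sup>2 = 4 * e\<^sup>2 * (c \<theta>)\<^sup>2 + 4 * e ^ 3 * c \<theta> + e ^ 4"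
      by (simp add: power2_eq_square power3_eq_cube power4_eq_xxxx algebra_simps)
    moreover have "(t\<^sup>2)\<^sup>2 = t ^ 4" by (simp add: power_mult[symmetric])
    ultimately show ?thesis unfolding H_def power_divide by (simp add: add_divide_distrib)
  qed
  have mH2: "(\<integral>\<theta>. (H \<theta>)\<^sup>2 \<partial>circ) = (2 * e\<^sup>2 * a\<^sup>2 + e ^ 4) / t ^ 4"
    unfolding H2 c_def using circ_mean_inner[of "x $ j"] circ_mean_inner_power2[of "x $ j"]
    by (simp add: a_def x_def add_divide_distrib)
  have cav: "circ_avg (bump z t) (axis j (of_real e)) y = (\<integral>\<theta>. cutoff (N + H \<theta>) \<partial>circ)"
    by (simp add: circ_avg_def bH)
  have bz: "bump z t y = cutoff N" by (simp add: bump_def N_def)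
  have "\<bar>\<integral>\<theta>. cutoff (N + H \<theta>) - cutoff N + cutoff_k N * H \<theta> \<partial>circ\<bar> \<le> 5000/9 * h\<^sup>2"
  proof (rule circ_integral_bound)
    fix \<theta>
    show "\<bar>cutoff (N + H \<theta>) - cutoff N + cutoff_k N * H \<theta>\<bar> \<le> 5000/9 * h\<^sup>2"
      using cutoff_Taylor_bound1[of N "H \<theta>"] H2h[of \<theta>] by linarith
  qed measurable
  moreover have "(\<integral>\<theta>. cutoff (N + H \<theta>) - cutoff N + cutoff_k N * H \<theta> \<partial>circ)
    = circ_avg (bump z t) (axis j (of_real e)) y - bump z t y + cutoff_k N * (e\<^sup>2 / t\<^sup>2)"
    using iP iH by (simp add: cav bz mH)
  moreover have "\<bar>cutoff_k N * (e\<^sup>2 / t\<^sup>2)\<bar> \<le> 5000/9 * (e\<^sup>2 / t\<^sup>2)"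
  proof -
    have q: "0 \<le> e\<^sup>2 / t\<^sup>2" by simp
    show ?thesis unfolding abs_mult abs_of_nonneg[OF q] by (rule mult_right_mono[OF cutoff_k_bound q])
  qed
  ultimately show "\<bar>circ_avg (bump z t) (axis j (of_real e)) y - bump z t y\<bar> \<le> 5000/9 * (e\<^sup>2 / t\<^sup>2) + 5000/9 * h\<^sup>2"
    by linarith
  have "\<bar>\<integral>\<theta>. cutoff (N + H \<theta>) - cutoff N + cutoff_k N * H \<theta> + cutoff_k_deriv N / 2 * (H \<theta>)\<^sup>2 \<partial>circ\<bar> \<le> 5000/9 * h ^ 3"
  proof (rule circ_integral_bound)
    fix \<theta>
    have "\<bar>H \<theta>\<bar> ^ 3 \<le> h ^ 3" using Hh[of \<theta>] by (intro power_mono) auto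
    then show "\<bar>cutoff (N + H \<theta>) - cutoff N + cutoff_k N * H \<theta> + cutoff_k_deriv N / 2 * (H \<theta>)\<^sup>2\<bar> \<le> 5000/9 * h ^ 3"
      using cutoff_Taylor_bound2[of N "H \<theta>"] by simp
  qed measurable
  moreover have "(\<integral>\<theta>. cutoff (N + H \<theta>) - cutoff N + cutoff_k N * H \<theta> + cutoff_k_deriv N / 2 * (H \<theta>)\<^sup>2 \<partial>circ)
    = circ_avg (bump z t) (axis j (of_real e)) y - bump z t y + cutoff_k N * (e\<^sup>2 / t\<^sup>2) + cutoff_k_deriv N * ((2 * e\<^sup>2 * a\<^sup>2 + e ^ 4) / t ^ 4) / 2"
    using iP iH iH2 by (simp add: cav bz mH mH2)
  ultimately show "\<bar>circ_avg (bump z t) (axis j (of_real e)) y - bump z t y + cutoff_k N * (e\<^sup>2 / t\<^sup>2)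
       + cutoff_k_deriv N * ((2 * e\<^sup>2 * a\<^sup>2 + e ^ 4) / t ^ 4) / 2\<bar> \<le> 5000/9 * h ^ 3"
    by simp
qed

section \<open>Superadditivity of the logarithmic slope\<close>

lemma unit_bump_laplacian_bound: "\<bar>unit_bump_laplacian (x :: complex ^ 'n::finite)\<bar> \<le> 4 * (real CARD('n) + 1) * (5000/9)"
proof -
  define n where "n = real CARD('n)"
  have n0: "0 \<le> n" by (simp add: n_def)
  define k where "k = cutoff_k ((norm x)\<^sup>2)"
  define d where "d = (norm x)\<^sup>2 * cutoff_k_deriv ((norm x)\<^sup>2)"
  have "\<bar>n * k\<bar> \<le> n * (5000/9)" unfolding abs_mult k_def abs_of_nonneg[OF n0] by (rule mult_left_mono[OF cutoff_k_bound n0])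
  moreover have "\<bar>d\<bar> \<le> 5000/9" unfolding d_def by (rule cutoff_k_deriv_mult_bound)
  moreover have "unit_bump_laplacian x = - 4 * (n * k + d)" by (simp add: unit_bump_laplacian_def n_def k_def d_def)
  moreover have "\<bar>- 4 * (X + Y)\<bar> \<le> 4 * (A + B)" if "\<bar>X\<bar> \<le> A" "\<bar>Y\<bar> \<le> B" for X Y A B :: real
  proof -
    have "\<bar>X + Y\<bar> \<le> A + B" using that by linarith
    then show ?thesis by (simp add: abs_mult)
  qed
  ultimately have "\<bar>unit_bump_laplacian x\<bar> \<le> 4 * (n * (5000/9) + 5000/9)" by presburger
  then show ?thesis by (simp add: n_def algebra_simps)
qed

lemma unit_bump_laplacian_zero: "1 \<le> norm x \<Longrightarrow> unit_bump_laplacian x = 0"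
  using one_le_norm_power2[of x] by (simp add: unit_bump_laplacian_def cutoff_k_zero cutoff_k_deriv_zero)

context Lelong_fn
begin

text \<open>
  The integral of \<open>V\<close> against the second-order difference that replaces the Laplacian of a bump: averages
  over circles of radius \<open>1 / (m + 1)\<close> in the coordinate directions, minus the bump itself.
\<close>

definition bump_circle_laplacian :: "complex ^ 'n \<Rightarrow> real \<Rightarrow> nat \<Rightarrow> real" where
  "bump_circle_laplacian z t m = (\<Sum>j\<in>UNIV. \<integral>y. v y * circ_avg (bump z t) (axis j (of_real (1 / real (Suc m)))) y - v y * bump z t y \<partial>lborel)
     / (1 / real (Suc m))\<^sup>2"

lemma bump_zero_norm:
  assumes t: "0 < t" and y: "norm z + t \<le> norm y"
  shows "bump z t y = 0"
  using norm_triangle_ineq2[of y z] y by (intro bump_zero t) linarith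

lemma v_bump_integrable:
  assumes t: "0 < t"
  shows "integrable lborel (\<lambda>y. v y * bump z t y)"
    and "integrable lborel (\<lambda>y. v y * circ_avg (bump z t) b y)"
proof -
  show "integrable lborel (\<lambda>y. v y * bump z t y)"
    by (rule v_weight_integrable[OF bump_borel bump_bounds(3) bump_zero_norm[OF t]])
  show "integrable lborel (\<lambda>y. v y * circ_avg (bump z t) b y)"
  proof (rule v_weight_integrable[where M = "3/25"])
    show "\<bar>circ_avg (bump z t) b y\<bar> \<le> 3/25" for y by (rule circ_avg_bound[OF bump_borel bump_bounds(3)])
    show "circ_avg (bump z t) b y = 0" if "(norm z + t) + norm b \<le> norm y" for y
      by (rule circ_avg_zero[OF bump_zero_norm[OF t] that])
  qed measurable
qed

text \<open>
  The sum over the coordinate directions of the circle differences, divided by the square of the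
  radius, tends to a quarter of the Laplacian of the bump. This passes to the integrals by dominated
  convergence, and rescaling to the unit ball gives the powers of \<open>t\<close>.
\<close>

lemma bump_circle_laplacian_tendsto:
  assumes t: "0 < t"
  shows "bump_circle_laplacian z t \<longlonglongrightarrow> t ^ (2 * CARD('n)) / (4 * t\<^sup>2) * log_slope z t"
proof -
  define e where "e m = 1 / real (Suc m)" for m
  have e: "0 < e m" "e m \<le> 1" for m by (auto simp: e_def field_simps)
  have e0: "e \<longlonglongrightarrow> 0" unfolding e_def by real_asymp
  define A where "A j m y = (circ_avg (bump z t) (axis j (of_real (e m))) y - bump z t y) / (e m)\<^sup>2" for j :: 'n and m and y :: "complex ^ 'n"
  define Q where "Q m y = (\<Sum>j\<in>UNIV. A j m y)" for m and y :: "complex ^ 'n"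
  have [measurable]: "A j m \<in> borel_measurable borel" for j m unfolding A_def by measurable
  have [measurable]: "Q m \<in> borel_measurable borel" for m unfolding Q_def by measurable
  have vA: "integrable lborel (\<lambda>y. v y * A j m y)" for j m
  proof -
    have "integrable lborel (\<lambda>y. (v y * circ_avg (bump z t) (axis j (of_real (e m))) y - v y * bump z t y) / (e m)\<^sup>2)"
      using v_bump_integrable[OF t] by (intro integrable_divide Bochner_Integration.integrable_diff)
    then show ?thesis by (simp add: A_def right_diff_distrib)
  qed
  have dQ: "bump_circle_laplacian z t m = (\<integral>y. v y * Q m y \<partial>lborel)" for m
  proof -
    have "(\<integral>y. v y * Q m y \<partial>lborel) = (\<Sum>j\<in>UNIV. \<integral>y. v y * A j m y \<partial>lborel)"
      unfolding Q_def sum_distrib_left by (rule Bochner_Integration.integral_sum) (rule vA)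
    also have "\<dots> = (\<Sum>j\<in>UNIV. (\<integral>y. v y * circ_avg (bump z t) (axis j (of_real (e m))) y - v y * bump z t y \<partial>lborel) / (e m)\<^sup>2)"
    proof (rule sum.cong[OF refl])
      fix j
      have "(\<integral>y. v y * A j m y \<partial>lborel) = (\<integral>y. (v y * circ_avg (bump z t) (axis j (of_real (e m))) y - v y * bump z t y) / (e m)\<^sup>2 \<partial>lborel)"
        by (intro Bochner_Integration.integral_cong) (auto simp: A_def right_diff_distrib)
      then show "(\<integral>y. v y * A j m y \<partial>lborel) = (\<integral>y. v y * circ_avg (bump z t) (axis j (of_real (e m))) y - v y * bump z t y \<partial>lborel) / (e m)\<^sup>2"
        by simp
    qed
    also have "\<dots> = bump_circle_laplacian z t m" unfolding bump_circle_laplacian_def e_def sum_divide_distrib ..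
    finally show ?thesis by simp
  qed
  define R0 where "R0 = norm z + t + 1"
  define MA where "MA = 5000/9 * (1 / t\<^sup>2) + 5000/9 * ((2 * (R0 + norm z) + 1) / t\<^sup>2)\<^sup>2"
  have Az: "A j m y = 0" if "R0 \<le> norm y" for j m y
  proof -
    have "circ_avg (bump z t) (axis j (of_real (e m))) y = 0"
    proof (rule circ_avg_zero[OF bump_zero_norm[OF t]])
      have "norm (axis j (complex_of_real (e m))) = e m"
        using e[of m] unfolding norm_eq_sqrt_inner[of "axis j (complex_of_real (e m))"] inner_axis_axis by (simp add: inner_complex_def real_sqrt_mult_self)
      then show "(norm z + t) + norm (axis j (complex_of_real (e m)) :: complex ^ 'n) \<le> norm y"
        using that e[of m] by (simp add: R0_def)
    qed
    moreover have "bump z t y = 0" using that by (intro bump_zero_norm t) (simp add: R0_def)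
    ultimately show ?thesis by (simp add: A_def)
  qed
  have Ab: "\<bar>A j m y\<bar> \<le> MA" if "norm y < R0" for j m y
  proof -
    have x: "norm (y - z) \<le> R0 + norm z" using that norm_triangle_ineq4[of y z] by linarith
    define h where "h = (2 * e m * norm (y - z) + (e m)\<^sup>2) / t\<^sup>2"
    have "h = e m * ((2 * norm (y - z) + e m) / t\<^sup>2)" by (simp add: h_def power2_eq_square algebra_simps)
    then have h2: "h\<^sup>2 = (e m)\<^sup>2 * ((2 * norm (y - z) + e m) / t\<^sup>2)\<^sup>2" by (simp only: power_mult_distrib)
    have "\<bar>circ_avg (bump z t) (axis j (of_real (e m))) y - bump z t y\<bar> \<le> 5000/9 * ((e m)\<^sup>2 / t\<^sup>2) + 5000/9 * h\<^sup>2"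
      unfolding h_def by (rule circ_avg_bump(1)[OF t e(1)])
    also have "\<dots> = (e m)\<^sup>2 * (5000/9 * (1 / t\<^sup>2) + 5000/9 * ((2 * norm (y - z) + e m) / t\<^sup>2)\<^sup>2)"
      unfolding h2 by (simp add: algebra_simps)
    also have "\<dots> \<le> (e m)\<^sup>2 * MA"
    proof -
      have "((2 * norm (y - z) + e m) / t\<^sup>2)\<^sup>2 \<le> ((2 * (R0 + norm z) + 1) / t\<^sup>2)\<^sup>2"
        using x e[of m] t by (intro power_mono divide_right_mono divide_nonneg_nonneg add_mono mult_left_mono) auto
      then show ?thesis unfolding MA_def by (intro mult_left_mono add_mono) auto
    qed
    finally show ?thesis using e(1)[of m] by (simp add: A_def abs_divide pos_divide_le_eq mult.commute)
  qed
  have "(\<lambda>m. \<integral>y. v y * Q m y \<partial>lborel) \<longlonglongrightarrow> (\<integral>y. v y * (unit_bump_laplacian (inverse t *\<^sub>R (y - z)) / (4 * t\<^sup>2)) \<partial>lborel)"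
  proof (rule integral_dominated_convergence[where w = "\<lambda>y. \<bar>v y * (real CARD('n) * MA * indicator (ball 0 R0) y)\<bar>"])
    have MA0: "0 \<le> MA" by (simp add: MA_def)
    show "integrable lborel (\<lambda>y. \<bar>v y * (real CARD('n) * MA * indicator (ball 0 R0) y)\<bar>)"
      using MA0 by (intro integrable_abs v_weight_integrable[where M = "real CARD('n) * MA" and R = R0]) (auto split: split_indicator)
    show "AE y in lborel. norm (v y * Q m y) \<le> \<bar>v y * (real CARD('n) * MA * indicator (ball 0 R0) y)\<bar>" for m
    proof (rule AE_I2)
      fix y :: "complex ^ 'n"
      have "\<bar>Q m y\<bar> \<le> real CARD('n) * MA * indicator (ball 0 R0) y"
      proof (cases "norm y < R0")
        case True
        have "\<bar>Q m y\<bar> \<le> (\<Sum>j\<in>UNIV. \<bar>A j m y\<bar>)" unfolding Q_def by (rule sum_abs)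
        also have "\<dots> \<le> (\<Sum>j\<in>(UNIV :: 'n set). MA)" by (intro sum_mono Ab True)
        finally show ?thesis using True by simp
      next
        case False
        then show ?thesis using Az by (simp add: Q_def)
      qed
      then have "\<bar>v y\<bar> * \<bar>Q m y\<bar> \<le> \<bar>v y\<bar> * \<bar>real CARD('n) * MA * indicator (ball 0 R0) y\<bar>"
        by (intro mult_left_mono) auto
      then show "norm (v y * Q m y) \<le> \<bar>v y * (real CARD('n) * MA * indicator (ball 0 R0) y)\<bar>"
        by (simp add: abs_mult)
    qed
    show "AE y in lborel. (\<lambda>m. v y * Q m y) \<longlonglongrightarrow> v y * (unit_bump_laplacian (inverse t *\<^sub>R (y - z)) / (4 * t\<^sup>2))"
    proof (rule AE_I2, rule tendsto_mult_left)
      fix y :: "complex ^ 'n"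
      define x where "x = y - z"
      define N where "N = (norm x)\<^sup>2 / t\<^sup>2"
      define a where "a j = cmod (x $ j)" for j
      have lim: "(\<lambda>m. A j m y) \<longlonglongrightarrow> - cutoff_k N / t\<^sup>2 - cutoff_k_deriv N * (a j)\<^sup>2 / t ^ 4" for j
      proof -
        define B where "B m = A j m y + (cutoff_k N / t\<^sup>2 + cutoff_k_deriv N * (2 * (a j)\<^sup>2 + (e m)\<^sup>2) / t ^ 4 / 2)" for m
        have "B \<longlonglongrightarrow> 0"
        proof (rule Lim_null_comparison)
          show "\<forall>\<^sub>F m in sequentially. norm (B m) \<le> 5000/9 * (e m * ((2 * norm x + e m) / t\<^sup>2) ^ 3)"
          proof (rule always_eventually, rule allI)
            fix m
            define h where "h = (2 * e m * norm x + (e m)\<^sup>2) / t\<^sup>2"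
            define D where "D = circ_avg (bump z t) (axis j (of_real (e m))) y - bump z t y"
            have he: "h = e m * ((2 * norm x + e m) / t\<^sup>2)" by (simp add: h_def power2_eq_square algebra_simps)
            have "\<bar>D + cutoff_k N * ((e m)\<^sup>2 / t\<^sup>2) + cutoff_k_deriv N * ((2 * (e m)\<^sup>2 * (a j)\<^sup>2 + (e m) ^ 4) / t ^ 4) / 2\<bar> \<le> 5000/9 * h ^ 3"
              using circ_avg_bump(2)[OF t e(1)[of m], where z = z and y = y and j = j] unfolding D_def h_def N_def a_def x_def .
            moreover have "D + cutoff_k N * ((e m)\<^sup>2 / t\<^sup>2) + cutoff_k_deriv N * ((2 * (e m)\<^sup>2 * (a j)\<^sup>2 + (e m) ^ 4) / t ^ 4) / 2 = (e m)\<^sup>2 * B m"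
            proof -
              have "D = (e m)\<^sup>2 * A j m y" using e(1)[of m] by (simp add: A_def D_def)
              moreover have "(e m) ^ 4 = (e m)\<^sup>2 * (e m)\<^sup>2" by (simp add: power4_eq_xxxx power2_eq_square)
              ultimately show ?thesis by (simp add: B_def algebra_simps add_divide_distrib)
            qed
            moreover have "h ^ 3 = (e m)\<^sup>2 * (e m * ((2 * norm x + e m) / t\<^sup>2) ^ 3)"
              unfolding he by (simp add: power_mult_distrib power3_eq_cube power2_eq_square)
            ultimately have "(e m)\<^sup>2 * \<bar>B m\<bar> \<le> (e m)\<^sup>2 * (5000/9 * (e m * ((2 * norm x + e m) / t\<^sup>2) ^ 3))"
              by (simp add: abs_mult)
            then show "norm (B m) \<le> 5000/9 * (e m * ((2 * norm x + e m) / t\<^sup>2) ^ 3)"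
              using e(1)[of m] by (subst (asm) mult_le_cancel_left_pos) auto
          qed
          have "(\<lambda>m. 5000/9 * (e m * ((2 * norm x + e m) / t\<^sup>2) ^ 3)) \<longlonglongrightarrow> 5000/9 * (0 * ((2 * norm x + 0) / t\<^sup>2) ^ 3)"
            using t by (intro tendsto_intros e0) auto
          then show "(\<lambda>m. 5000/9 * (e m * ((2 * norm x + e m) / t\<^sup>2) ^ 3)) \<longlonglongrightarrow> 0" by simp
        qed
        moreover have "(\<lambda>m. cutoff_k N / t\<^sup>2 + cutoff_k_deriv N * (2 * (a j)\<^sup>2 + (e m)\<^sup>2) / t ^ 4 / 2) \<longlonglongrightarrow> cutoff_k N / t\<^sup>2 + cutoff_k_deriv N * (2 * (a j)\<^sup>2 + 0\<^sup>2) / t ^ 4 / 2"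
          using t by (intro tendsto_intros e0) auto
        ultimately have "(\<lambda>m. B m - (cutoff_k N / t\<^sup>2 + cutoff_k_deriv N * (2 * (a j)\<^sup>2 + (e m)\<^sup>2) / t ^ 4 / 2)) \<longlonglongrightarrow> 0 - (cutoff_k N / t\<^sup>2 + cutoff_k_deriv N * (2 * (a j)\<^sup>2 + 0\<^sup>2) / t ^ 4 / 2)"
          by (rule tendsto_diff)
        moreover have "(\<lambda>m. B m - (cutoff_k N / t\<^sup>2 + cutoff_k_deriv N * (2 * (a j)\<^sup>2 + (e m)\<^sup>2) / t ^ 4 / 2)) = (\<lambda>m. A j m y)"
          by (simp add: B_def)
        ultimately show ?thesis by simp
      qed
      have "(\<lambda>m. Q m y) \<longlonglongrightarrow> (\<Sum>j\<in>UNIV. - cutoff_k N / t\<^sup>2 - cutoff_k_deriv N * (a j)\<^sup>2 / t ^ 4)"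
        unfolding Q_def by (intro tendsto_sum lim)
      moreover have "(\<Sum>j\<in>UNIV. - cutoff_k N / t\<^sup>2 - cutoff_k_deriv N * (a j)\<^sup>2 / t ^ 4) = unit_bump_laplacian (inverse t *\<^sub>R (y - z)) / (4 * t\<^sup>2)"
      proof -
        have nx: "(norm (inverse t *\<^sub>R (y - z)))\<^sup>2 = N"
          using t unfolding norm_scaleR power_mult_distrib by (simp add: N_def x_def field_simps)
        have "(\<Sum>j\<in>UNIV. - cutoff_k N / t\<^sup>2 - cutoff_k_deriv N * (a j)\<^sup>2 / t ^ 4) = - (real CARD('n) * cutoff_k N / t\<^sup>2) - cutoff_k_deriv N * (\<Sum>j\<in>UNIV. (a j)\<^sup>2) / t ^ 4"
          by (simp add: sum_subtractf sum_distrib_left sum_divide_distrib)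
        also have "(\<Sum>j\<in>UNIV. (a j)\<^sup>2) = N * t\<^sup>2"
          using t by (simp add: a_def power2_norm_vec[symmetric] N_def)
        also have "cutoff_k_deriv N * (N * t\<^sup>2) / t ^ 4 = N * cutoff_k_deriv N / t\<^sup>2"
          using t by (simp add: power4_eq_xxxx power2_eq_square)
        also have "- (real CARD('n) * cutoff_k N / t\<^sup>2) - N * cutoff_k_deriv N / t\<^sup>2 = unit_bump_laplacian (inverse t *\<^sub>R (y - z)) / (4 * t\<^sup>2)"
          unfolding unit_bump_laplacian_def nx using t by (simp add: field_simps)
        finally show ?thesis .
      qed
      ultimately show "(\<lambda>m. Q m y) \<longlonglongrightarrow> unit_bump_laplacian (inverse t *\<^sub>R (y - z)) / (4 * t\<^sup>2)" by simp
    qed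
  qed measurable
  moreover have "(\<integral>y. v y * (unit_bump_laplacian (inverse t *\<^sub>R (y - z)) / (4 * t\<^sup>2)) \<partial>lborel) = t ^ (2 * CARD('n)) / (4 * t\<^sup>2) * log_slope z t"
  proof -
    define L where "L = 4 * (real CARD('n) + 1) * (5000/9)"
    have i: "integrable lborel (\<lambda>y. v y * (unit_bump_laplacian (inverse t *\<^sub>R (y - z)) / (4 * t\<^sup>2)))"
    proof (rule v_weight_integrable[where M = "L / (4 * t\<^sup>2)" and R = "norm z + t"])
      fix y :: "complex ^ 'n"
      show "\<bar>unit_bump_laplacian (inverse t *\<^sub>R (y - z)) / (4 * t\<^sup>2)\<bar> \<le> L / (4 * t\<^sup>2)"
        unfolding abs_divide L_def using unit_bump_laplacian_bound[of "inverse t *\<^sub>R (y - z)"] t by (intro frac_le) auto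
      show "unit_bump_laplacian (inverse t *\<^sub>R (y - z)) / (4 * t\<^sup>2) = 0" if "norm z + t \<le> norm y"
      proof -
        have "t \<le> norm (y - z)" using that norm_triangle_ineq2[of y z] by linarith
        then have "inverse t * t \<le> inverse t * norm (y - z)" using t by (intro mult_left_mono) auto
        also have "\<dots> = norm (inverse t *\<^sub>R (y - z))" using t by (simp only: norm_scaleR) simp
        finally have "1 \<le> norm (inverse t *\<^sub>R (y - z))" using t by simp
        then show ?thesis by (simp add: unit_bump_laplacian_zero)
      qed
    qed measurable
    have "(\<integral>y. v y * (unit_bump_laplacian (inverse t *\<^sub>R (y - z)) / (4 * t\<^sup>2)) \<partial>lborel)
      = \<bar>t\<bar> ^ DIM(complex ^ 'n) * (\<integral>x. v (z + t *\<^sub>R x) * (unit_bump_laplacian (inverse t *\<^sub>R (z + t *\<^sub>R x - z)) / (4 * t\<^sup>2)) \<partial>lborel)"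
      by (rule lborel_affine_integral(2)[OF i]) (use t in simp)
    also have "\<dots> = t ^ (2 * CARD('n)) * (\<integral>x. v (z + t *\<^sub>R x) * unit_bump_laplacian x / (4 * t\<^sup>2) \<partial>lborel)"
      using t by (simp add: mult.commute)
    also have "\<dots> = t ^ (2 * CARD('n)) / (4 * t\<^sup>2) * log_slope z t"
      by (simp add: log_slope_def)
    finally show ?thesis .
  qed
  moreover have "bump_circle_laplacian z t = (\<lambda>m. \<integral>y. v y * Q m y \<partial>lborel)" by (rule ext) (rule dQ)
  ultimately show ?thesis by (simp only:)
qed

text \<open>
  The large bump minus the sum of the bumps of the disjoint balls is a nonnegative test function: in
  the union of the balls the large bump is on its plateau, of the common height \<open>3 / 25\<close>, which is why
  its radius is \<open>5 / 4\<close> times \<open>R\<close>. The weak form of subharmonicity, applied to this function, is the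
  inequality in the limit.
\<close>

lemma log_slope_superadditive:
  fixes z :: "'i \<Rightarrow> complex ^ 'n" and t :: "'i \<Rightarrow> real"
  assumes I: "finite I" and t: "\<And>i. i \<in> I \<Longrightarrow> 0 < t i" and disj: "disjoint_family_on (\<lambda>i. ball (z i) (t i)) I"
    and R: "0 < R" "\<And>i. i \<in> I \<Longrightarrow> norm (z i) + t i \<le> R"
  shows "(\<Sum>i\<in>I. (t i) ^ (2 * CARD('n)) / (t i)\<^sup>2 * log_slope (z i) (t i))
    \<le> (5/4 * R) ^ (2 * CARD('n)) / (5/4 * R)\<^sup>2 * log_slope 0 (5/4 * R)"
proof -
  define R' where "R' = 5/4 * R"
  have R': "0 < R'" using R by (simp add: R'_def)
  define \<phi> where "\<phi> y = bump 0 R' y - (\<Sum>i\<in>I. bump (z i) (t i) y)" for y :: "complex ^ 'n"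
  have [measurable]: "\<phi> \<in> borel_measurable borel" unfolding \<phi>_def by measurable
  have \<phi>0: "0 \<le> \<phi> y" for y
  proof (cases "\<exists>i\<in>I. y \<in> ball (z i) (t i)")
    case False
    then have "bump (z i) (t i) y = 0" if "i \<in> I" for i
      using that t[OF that] by (intro bump_zero) (auto simp: dist_norm norm_minus_commute not_less)
    then show ?thesis by (simp add: \<phi>_def bump_bounds)
  next
    case True
    then obtain k where k: "k \<in> I" "y \<in> ball (z k) (t k)" by blast
    have "bump (z i) (t i) y = 0" if "i \<in> I - {k}" for i
    proof -
      have "y \<notin> ball (z i) (t i)" using disj k that unfolding disjoint_family_on_def by blast
      then show ?thesis using that t[of i] by (intro bump_zero) (auto simp: dist_norm norm_minus_commute not_less)
    qed
    then have "(\<Sum>i\<in>I. bump (z i) (t i) y) = bump (z k) (t k) y"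
      using I k by (subst sum.remove[of _ k]) auto
    also have "\<dots> \<le> 3/25" by (rule bump_bounds)
    also have "3/25 = bump 0 R' y"
    proof -
      have "norm y \<le> norm (z k) + norm (y - z k)" using norm_triangle_ineq[of "z k" "y - z k"] by simp
      then have "norm y \<le> R" using k R(2)[of k] by (simp add: dist_norm norm_minus_commute)
      then show ?thesis using R' by (intro bump_plateau[symmetric]) (auto simp: R'_def)
    qed
    finally show ?thesis by (simp add: \<phi>_def)
  qed
  have \<phi>M: "\<bar>\<phi> y\<bar> \<le> 3/25" for y
  proof -
    have "0 \<le> (\<Sum>i\<in>I. bump (z i) (t i) y)" by (intro sum_nonneg bump_bounds)
    then have "\<phi> y \<le> bump 0 R' y" by (simp add: \<phi>_def)
    then show ?thesis using \<phi>0[of y] bump_bounds(2)[of 0 R' y] by simp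
  qed
  have \<phi>z: "\<phi> y = 0" if "R' \<le> norm y" for y
  proof -
    have "bump 0 R' y = 0" using that R' by (intro bump_zero) auto
    moreover have "0 \<le> (\<Sum>i\<in>I. bump (z i) (t i) y)" by (intro sum_nonneg bump_bounds)
    ultimately show ?thesis using \<phi>0[of y] by (simp add: \<phi>_def)
  qed
  have ib: "integrable circ (\<lambda>\<theta>. bump a r (y + cis \<theta> *s b))" for a r y b
    by (rule circ_integrable_bounded[where M = "3/25"]) (use bump_bounds in auto)
  have lin: "circ_avg \<phi> b y = circ_avg (bump 0 R') b y - (\<Sum>i\<in>I. circ_avg (bump (z i) (t i)) b y)" for b y
    unfolding circ_avg_def \<phi>_def by (simp add: ib Bochner_Integration.integral_diff Bochner_Integration.integral_sum Bochner_Integration.integrable_sum)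
  have main: "(\<Sum>i\<in>I. bump_circle_laplacian (z i) (t i) m) \<le> bump_circle_laplacian 0 R' m" for m
  proof -
    define e where "e = 1 / real (Suc m)"
    define G where "G a r j = (\<integral>y. v y * circ_avg (bump a r) (axis j (of_real e)) y - v y * bump a r y \<partial>lborel)" for a r and j :: 'n
    have dG: "bump_circle_laplacian a r m = (\<Sum>j\<in>UNIV. G a r j) / e\<^sup>2" for a r by (simp add: bump_circle_laplacian_def G_def e_def)
    have "(\<Sum>i\<in>I. G (z i) (t i) j) \<le> G 0 R' j" for j
    proof -
      define b where "b = (axis j (of_real e) :: complex ^ 'n)"
      have "(\<integral>y. v y * \<phi> y \<partial>lborel) \<le> (\<integral>y. v y * circ_avg \<phi> b y \<partial>lborel)"
        by (rule integral_circ_avg_ge[OF _ \<phi>0 \<phi>M \<phi>z]) measurable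
      moreover have "(\<integral>y. v y * \<phi> y \<partial>lborel) = (\<integral>y. v y * bump 0 R' y \<partial>lborel) - (\<Sum>i\<in>I. \<integral>y. v y * bump (z i) (t i) y \<partial>lborel)"
        unfolding \<phi>_def right_diff_distrib sum_distrib_left
        using v_bump_integrable(1)[OF R'] v_bump_integrable(1)[OF t]
        by (subst Bochner_Integration.integral_diff) (auto simp: Bochner_Integration.integral_sum)
      moreover have "(\<integral>y. v y * circ_avg \<phi> b y \<partial>lborel) = (\<integral>y. v y * circ_avg (bump 0 R') b y \<partial>lborel) - (\<Sum>i\<in>I. \<integral>y. v y * circ_avg (bump (z i) (t i)) b y \<partial>lborel)"
        unfolding lin right_diff_distrib sum_distrib_left
        using v_bump_integrable(2)[OF R'] v_bump_integrable(2)[OF t]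
        by (subst Bochner_Integration.integral_diff) (auto simp: Bochner_Integration.integral_sum)
      moreover have "G 0 R' j = (\<integral>y. v y * circ_avg (bump 0 R') b y \<partial>lborel) - (\<integral>y. v y * bump 0 R' y \<partial>lborel)"
        unfolding G_def b_def using v_bump_integrable[OF R'] by (intro Bochner_Integration.integral_diff)
      moreover have "(\<Sum>i\<in>I. G (z i) (t i) j) = (\<Sum>i\<in>I. \<integral>y. v y * circ_avg (bump (z i) (t i)) b y \<partial>lborel) - (\<Sum>i\<in>I. \<integral>y. v y * bump (z i) (t i) y \<partial>lborel)"
        unfolding sum_subtractf[symmetric] G_def b_def
        using v_bump_integrable[OF t] by (intro sum.cong refl Bochner_Integration.integral_diff) auto
      ultimately show ?thesis by linarith
    qed
    then have "(\<Sum>j\<in>UNIV. \<Sum>i\<in>I. G (z i) (t i) j) / e\<^sup>2 \<le> (\<Sum>j\<in>UNIV. G 0 R' j) / e\<^sup>2"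
      by (intro divide_right_mono sum_mono) auto
    then show ?thesis unfolding dG by (subst (asm) sum.swap) (simp add: sum_divide_distrib)
  qed
  have "(\<Sum>i\<in>I. (t i) ^ (2 * CARD('n)) / (4 * (t i)\<^sup>2) * log_slope (z i) (t i)) \<le> R' ^ (2 * CARD('n)) / (4 * R'\<^sup>2) * log_slope 0 R'"
    by (rule LIMSEQ_le[OF tendsto_sum[OF bump_circle_laplacian_tendsto[OF t]] bump_circle_laplacian_tendsto[OF R']]) (use main in auto)
  then have "4 * (\<Sum>i\<in>I. (t i) ^ (2 * CARD('n)) / (4 * (t i)\<^sup>2) * log_slope (z i) (t i)) \<le> 4 * (R' ^ (2 * CARD('n)) / (4 * R'\<^sup>2) * log_slope 0 R')"
    by simp
  then show ?thesis unfolding R'_def[symmetric] by (simp add: sum_distrib_left)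
qed

end

section \<open>Greedy covering and the exceptional set\<close>

text \<open>
  A pair \<open>(z, k)\<close> stands for the ball of centre \<open>z\<close> and radius \<open>t k\<close>.
\<close>

definition disjoint_balls :: "(nat \<Rightarrow> real) \<Rightarrow> ('a::metric_space \<times> nat) set \<Rightarrow> bool" where
  "disjoint_balls t S \<longleftrightarrow> (\<forall>p\<in>S. \<forall>q\<in>S. p \<noteq> q \<longrightarrow> ball (fst p) (t (snd p)) \<inter> ball (fst q) (t (snd q)) = {})"

lemma disjoint_balls_chain_Union:
  assumes "\<And>S T. S \<in> \<C> \<Longrightarrow> T \<in> \<C> \<Longrightarrow> S \<subseteq> T \<or> T \<subseteq> S" "\<And>S. S \<in> \<C> \<Longrightarrow> disjoint_balls t S"
  shows "disjoint_balls t (\<Union>\<C>)"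
  unfolding disjoint_balls_def
proof (intro ballI impI)
  fix p q assume "p \<in> \<Union>\<C>" "q \<in> \<Union>\<C>" and pq: "p \<noteq> q"
  then obtain S T where "S \<in> \<C>" "T \<in> \<C>" "p \<in> S" "q \<in> T" by blast
  then obtain U where "U \<in> \<C>" "p \<in> U" "q \<in> U" using assms(1) by blast
  then show "ball (fst p) (t (snd p)) \<inter> ball (fst q) (t (snd q)) = {}"
    using assms(2) pq unfolding disjoint_balls_def by blast
qed

lemma maximal_disjoint_balls:
  fixes E :: "'a::metric_space set"
  assumes t: "0 < t k" and T: "disjoint_balls t T"
  shows "\<exists>M. T \<subseteq> M \<and> M \<subseteq> T \<union> E \<times> {k} \<and> disjoint_balls t M \<and>
     (\<forall>z\<in>E. \<exists>q\<in>M. ball z (t k) \<inter> ball (fst q) (t (snd q)) \<noteq> {})"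
proof -
  define \<A> where "\<A> = {M. T \<subseteq> M \<and> M \<subseteq> T \<union> E \<times> {k} \<and> disjoint_balls t M}"
  have "\<exists>M\<in>\<A>. \<forall>X\<in>\<A>. M \<subseteq> X \<longrightarrow> X = M"
  proof (rule subset_Zorn_nonempty)
    show "\<A> \<noteq> {}" using T unfolding \<A>_def by blast
    fix \<C> assume \<C>: "\<C> \<noteq> {}" "subset.chain \<A> \<C>"
    have "disjoint_balls t (\<Union>\<C>)"
    proof (rule disjoint_balls_chain_Union)
      show "S \<subseteq> U \<or> U \<subseteq> S" if "S \<in> \<C>" "U \<in> \<C>" for S U
        using \<C>(2) that unfolding subset_chain_def by blast
      show "disjoint_balls t S" if "S \<in> \<C>" for S
        using \<C>(2) that unfolding subset_chain_def \<A>_def by blast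
    qed
    moreover have "T \<subseteq> \<Union>\<C>" "\<Union>\<C> \<subseteq> T \<union> E \<times> {k}"
      using \<C> unfolding subset_chain_def \<A>_def by blast+
    ultimately show "\<Union>\<C> \<in> \<A>" unfolding \<A>_def by blast
  qed
  then obtain M where MA: "M \<in> \<A>" and max: "\<And>X. X \<in> \<A> \<Longrightarrow> M \<subseteq> X \<Longrightarrow> X = M" by blast
  then have M: "T \<subseteq> M" "M \<subseteq> T \<union> E \<times> {k}" "disjoint_balls t M" by (auto simp: \<A>_def)
  have "\<exists>q\<in>M. ball z (t k) \<inter> ball (fst q) (t (snd q)) \<noteq> {}" if z: "z \<in> E" for z
  proof (rule ccontr)
    assume no: "\<not> ?thesis"
    have "disjoint_balls t (insert (z, k) M)"
      using M(3) no unfolding disjoint_balls_def by (auto simp: Int_commute)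
    then have "insert (z, k) M = M" using M z by (intro max) (auto simp: \<A>_def)
    then have "(z, k) \<in> M" by blast
    moreover have "ball z (t k) \<inter> ball (fst (z, k)) (t (snd (z, k))) \<noteq> {}" using t by auto
    ultimately show False using no by blast
  qed
  with M show ?thesis by blast
qed

text \<open>
  The family is enlarged scale by scale, each time to a maximal disjoint one. By maximality a ball of
  scale \<open>k\<close> meets a chosen ball of scale at most \<open>k\<close>. When \<open>t\<close> decreases the chosen ball is at least as
  large, and its double contains the centre of the other one.
\<close>

lemma greedy_disjoint_balls:
  fixes E :: "nat \<Rightarrow> 'a::metric_space set"
  assumes t: "\<And>k. 0 < t k"
  shows "\<exists>S. S \<subseteq> {(z, k). z \<in> E k} \<and> disjoint_balls t S \<and>
     (\<forall>k. \<forall>z\<in>E k. \<exists>(z', k')\<in>S. k' \<le> k \<and> dist z' z < t k' + t k)"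
proof -
  define P where "P k T \<longleftrightarrow> T \<subseteq> {(z, i). z \<in> E i \<and> i < k} \<and> disjoint_balls t T" for k T
  define Q where "Q k T M \<longleftrightarrow> T \<subseteq> M \<and> (\<forall>z\<in>E k. \<exists>q\<in>M. ball z (t k) \<inter> ball (fst q) (t (snd q)) \<noteq> {})" for k T M
  have "\<exists>f. \<forall>k. P k (f k) \<and> Q k (f k) (f (Suc k))"
  proof (rule dependent_nat_choice)
    show "\<exists>T. P 0 T" by (auto simp: P_def disjoint_balls_def)
    fix T k assume PT: "P k T"
    then obtain M where M: "T \<subseteq> M" "M \<subseteq> T \<union> E k \<times> {k}" "disjoint_balls t M"
      "\<forall>z\<in>E k. \<exists>q\<in>M. ball z (t k) \<inter> ball (fst q) (t (snd q)) \<noteq> {}"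
      using maximal_disjoint_balls[of t k T "E k"] t by (auto simp: P_def)
    have "M \<subseteq> {(z, i). z \<in> E i \<and> i < Suc k}"
    proof
      fix p assume "p \<in> M"
      then have "p \<in> T \<or> p \<in> E k \<times> {k}" using M(2) by blast
      then show "p \<in> {(z, i). z \<in> E i \<and> i < Suc k}" using PT by (auto simp: P_def)
    qed
    then show "\<exists>M. P (Suc k) M \<and> Q k T M" using M by (auto simp: P_def Q_def)
  qed
  then obtain f where f: "\<And>k. P k (f k)" "\<And>k. Q k (f k) (f (Suc k))" by blast
  have mono: "f i \<subseteq> f j" if "i \<le> j" for i j
    using that by (rule lift_Suc_mono_le[rotated]) (use f(2) in \<open>auto simp: Q_def\<close>)
  define S where "S = (\<Union>k. f k)"
  have "S \<subseteq> {(z, k). z \<in> E k}" using f(1) by (fastforce simp: S_def P_def)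
  moreover have "disjoint_balls t S"
    unfolding S_def
  proof (rule disjoint_balls_chain_Union)
    show "A \<subseteq> B \<or> B \<subseteq> A" if "A \<in> range f" "B \<in> range f" for A B
      using that mono by (metis imageE nat_le_linear)
    show "disjoint_balls t A" if "A \<in> range f" for A using that f(1) by (auto simp: P_def)
  qed
  moreover have "\<exists>(z', k')\<in>S. k' \<le> k \<and> dist z' z < t k' + t k" if z: "z \<in> E k" for k z
  proof -
    obtain q where q: "q \<in> f (Suc k)" "ball z (t k) \<inter> ball (fst q) (t (snd q)) \<noteq> {}"
      using f(2)[of k] z unfolding Q_def by blast
    obtain z' k' where q': "q = (z', k')" by (cases q)
    have "k' \<le> k" using f(1)[of "Suc k"] q(1) q' by (auto simp: P_def)
    moreover obtain y where "dist z y < t k" "dist z' y < t k'" using q(2) q' by auto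
    then have "dist z' z < t k' + t k" using dist_triangle2[of z' z y] by linarith
    moreover have "(z', k') \<in> S" using q q' by (auto simp: S_def)
    ultimately show ?thesis by blast
  qed
  ultimately show ?thesis by blast
qed

lemma countable_disjoint_balls:
  fixes S :: "('a::euclidean_space \<times> nat) set"
  assumes t: "\<And>k. 0 < t k" and S: "disjoint_balls t S"
  shows "countable S"
proof -
  define b where "b p = ball (fst p) (t (snd p))" for p :: "'a \<times> nat"
  have ne: "b p \<noteq> {}" for p using t[of "snd p"] by (simp add: b_def)
  have "countable (b ` S)"
  proof (rule countable_disjoint_open_subsets)
    show "pairwise disjnt (b ` S)"
      unfolding pairwise_def
    proof (intro ballI impI)
      fix A B assume AB: "A \<in> b ` S" "B \<in> b ` S" "A \<noteq> B"
      then obtain p q where pq: "p \<in> S" "q \<in> S" "A = b p" "B = b q" by blast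
      then have "p \<noteq> q" using AB(3) by blast
      then show "disjnt A B" using S pq unfolding disjoint_balls_def disjnt_def b_def by blast
    qed
  qed (auto simp: b_def)
  moreover have "inj_on b S"
  proof (rule inj_onI, rule ccontr)
    fix p q assume "p \<in> S" "q \<in> S" "b p = b q" "p \<noteq> q"
    then have "b p \<inter> b q = {}" using S unfolding disjoint_balls_def b_def by blast
    then show False using \<open>b p = b q\<close> ne[of p] by simp
  qed
  ultimately show ?thesis by (rule countable_image_inj_on)
qed

lemma two_powr_minus_less_1: "0 < \<alpha> \<Longrightarrow> 2 powr (- \<alpha>) < (1::real)"
  using powr_less_mono[of "- \<alpha>" 0 "2::real"] by simp

text \<open>
  With \<open>x = \<alpha> ln 2\<close> this is \<open>1 + x < e\<^sup>x\<close>. It says that passing from continuous to dyadic scales costs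
  less than a factor \<open>2\<^sup>\<alpha>\<close>.
\<close>

lemma scale_constant_less:
  assumes a: "0 < (\<alpha>::real)"
  shows "\<alpha> * ln 2 * 2 powr (- \<alpha>) < 1 - 2 powr (- \<alpha>)"
proof -
  define x where "x = \<alpha> * ln 2"
  have x: "0 < x" using a by (simp add: x_def)
  have e: "2 powr (- \<alpha>) = exp (- x)" by (simp add: powr_def x_def)
  have "1 + x < (1 + x / 2)\<^sup>2" using x by (simp add: power2_eq_square field_simps)
  also have "\<dots> \<le> (exp (x / 2))\<^sup>2" using x exp_ge_add_one_self[of "x/2"] by (intro power_mono) auto
  also have "\<dots> = exp x" by (simp add: exp_double[symmetric])
  finally have "(1 + x) * exp (- x) < exp x * exp (- x)" by (intro mult_strict_right_mono) auto
  then have "(1 + x) * exp (- x) < 1" by (simp flip: exp_add)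
  then show ?thesis unfolding e x_def[symmetric] by (simp add: algebra_simps)
qed

context Lelong_fn
begin

text \<open>
  The drops of the average from scale to scale are at most \<open>Z (1 - q) q\<^sup>k\<close> with \<open>q = 2\<^sup>-\<^sup>\<alpha>\<close>, in total at
  most \<open>Z\<close>. By upper semicontinuity the averages at small scales are at most \<open>c Z\<close> for each
  \<open>c > V z\<close>.
\<close>

lemma V_ge_of_small_log_slopes:
  assumes LP: "ereal_integral FS_measure (Robin_proj V) = 0"
    and \<alpha>: "0 < \<alpha>" and T: "0 < T"
    and small: "\<And>k. log_slope z (T / 2 ^ k) \<le> shell_mass TYPE('n) * ((1 - 2 powr (- \<alpha>)) / ln 2) * 2 powr (- \<alpha> * real k)"
  shows "V z \<ge> ereal (ln T + ln (4/5) - 1)"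
proof (rule ccontr)
  define Z where "Z = shell_mass TYPE('n)"
  have Z: "0 < Z" by (simp add: Z_def shell_mass_pos)
  define q where "q = 2 powr (- \<alpha>)"
  have q: "0 < q" "q < 1" using \<alpha> by (auto simp: q_def two_powr_minus_less_1)
  define g where "g k = avg shell z (T / 2 ^ k)" for k :: nat
  have step: "g k - g (Suc k) \<le> Z * ((1 - q) * q ^ k)" for k
  proof -
    define s where "s = ln (T / 2 ^ k)"
    have s: "exp s = T / 2 ^ k" using T by (simp add: s_def)
    have s': "exp (s - ln 2) = T / 2 ^ Suc k" by (simp add: exp_diff s)
    have "g k - g (Suc k) \<le> (s - (s - ln 2)) * log_slope z (exp s)"
      unfolding g_def s[symmetric] s'[symmetric] by (rule avg_difference_le_log_slope) simp
    also have "\<dots> = ln 2 * log_slope z (T / 2 ^ k)" by (simp add: s)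
    also have "\<dots> \<le> ln 2 * (Z * ((1 - q) / ln 2) * 2 powr (- \<alpha> * real k))"
      using small[of k] by (intro mult_left_mono) (auto simp: Z_def q_def)
    also have "2 powr (- \<alpha> * real k) = q ^ k" using powr_realpow[OF q(1), of k] by (simp add: q_def powr_powr)
    also have "ln 2 * (Z * ((1 - q) / ln 2) * q ^ k) = Z * ((1 - q) * q ^ k)" by simp
    finally show ?thesis .
  qed
  have tele: "g 0 - Z \<le> g K" for K
  proof -
    have "g 0 - g K = (\<Sum>k<K. g k - g (Suc k))" by (simp add: sum_lessThan_telescope')
    also have "\<dots> \<le> (\<Sum>k<K. Z * ((1 - q) * q ^ k))" by (intro sum_mono step)
    also have "\<dots> = Z * ((1 - q) * (\<Sum>k<K. q ^ k))" by (simp add: sum_distrib_left)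
    also have "(1 - q) * (\<Sum>k<K. q ^ k) = 1 - q ^ K" using q by (simp add: sum_gp_strict)
    also have "Z * (1 - q ^ K) \<le> Z * 1" using Z q by (intro mult_left_mono) auto
    finally show ?thesis by simp
  qed
  have g0: "(ln T + ln (4/5)) * Z \<le> g 0"
    using shell_avg_ge[OF LP, of "ln T" z] T by (simp add: Z_def g_def)
  assume "\<not> V z \<ge> ereal (ln T + ln (4/5) - 1)"
  then obtain c where c: "V z < ereal c" "c < ln T + ln (4/5) - 1"
    using ereal_dense2[of "V z" "ereal (ln T + ln (4/5) - 1)"] by (auto simp: not_le)
  obtain d where d: "0 < d" "ball z d \<subseteq> {y. V y < ereal c}"
    using usc[of "ereal c"] c(1) unfolding open_contains_ball by blast
  obtain K where K: "(1/2) ^ K < d / (2 * T)"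
    using real_arch_pow_inv[of "d / (2 * T)" "1/2"] d T by auto
  define t where "t = T / 2 ^ K"
  have t: "0 < t" "2 * t < d" using K T by (auto simp: t_def power_one_over field_simps)
  obtain M where sh: "\<And>x :: complex ^ 'n. 0 \<le> shell x" "\<And>x :: complex ^ 'n. \<bar>shell x\<bar> \<le> M" "\<And>x :: complex ^ 'n. 2 \<le> norm x \<Longrightarrow> shell x = 0"
    using weightD[OF weight_shell] by metis
  have "g K \<le> (\<integral>x. c * shell (x :: complex ^ 'n) \<partial>lborel)"
    unfolding g_def avg_def t_def[symmetric]
  proof (rule integral_mono_AE)
    show "integrable lborel (\<lambda>x. v (z + t *\<^sub>R x) * shell x)"
      by (rule v_affine_integrable[OF shell_borel sh(2,3) t(1)])
    show "integrable lborel (\<lambda>x :: complex ^ 'n. c * shell x)"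
      by (intro integrable_mult_right weight_integrable weight_shell)
    show "AE x in lborel. v (z + t *\<^sub>R x) * shell x \<le> c * shell x"
      using AE_V_affine[of t z, OF less_imp_neq[OF t(1), symmetric]]
    proof eventually_elim
      case (elim x)
      show ?case
      proof (cases "norm x < 2")
        case True
        have "t * norm x \<le> t * 2" using True t by (intro mult_left_mono) auto
        moreover have "norm (t *\<^sub>R x) = t * norm x" using t by simp
        ultimately have "norm (t *\<^sub>R x) < d" using t by linarith
        then have "z + t *\<^sub>R x \<in> ball z d" by (simp add: dist_norm)
        then have "v (z + t *\<^sub>R x) \<le> c" using d(2) elim by auto
        then show ?thesis using sh(1) by (intro mult_right_mono) auto
      next
        case False then show ?thesis using sh(3)[of x] by simp
      qed
    qed
  qed
  also have "\<dots> = c * Z" by (simp add: Z_def shell_mass_def)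
  also have "\<dots> < (ln T + ln (4/5) - 1) * Z" using c(2) Z by (intro mult_strict_right_mono)
  also have "\<dots> \<le> g 0 - Z" using g0 by (simp add: algebra_simps)
  finally show False using tele[of K] by simp
qed

text \<open>
  The radii are doubled: a chosen ball of radius \<open>\<tau>\<close> has \<open>2 \<tau> \<le> \<eta> / 2\<close>, and if its double meets the ball
  of radius \<open>R\<close> about \<open>0\<close>, then it lies in the ball of radius \<open>R + 3 \<tau> \<le> R + \<eta>\<close>. The factors \<open>2\<close> from
  doubling and \<open>5 / 4\<close> from the large bump combine to \<open>5 / 2\<close>, and the remaining factor
  \<open>2\<^sup>-\<^sup>\<alpha> / c0 < 1 / \<alpha>\<close> comes from the choice of the slopes.
\<close>

lemma exceptional_covering:
  assumes LP: "ereal_integral FS_measure (Robin_proj V) = 0"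
    and \<alpha>: "0 < \<alpha>" and \<eta>: "0 < \<eta>"
  shows "\<exists>(J :: nat set) (c :: nat \<Rightarrow> complex ^ 'n) (r :: nat \<Rightarrow> real).
            (\<forall>j\<in>J. 0 < r j \<and> r j < \<eta>) \<and>
            (\<forall>z. z \<notin> (\<Union>j\<in>J. ball (c j) (r j)) \<longrightarrow> V z \<ge> ereal (- ln (5 * exp 1 / \<eta>))) \<and>
            (\<forall>R>0. (\<Sum>\<^sub>\<infinity>j\<in>{j\<in>J. ball (c j) (r j) \<inter> ball 0 R \<noteq> {}}.
                       ennreal (r j powr (2 * real CARD('n) - 2 + \<alpha>)))
                    < ennreal (5 ^ (2 * CARD('n) - 2) * (R + \<eta>) ^ (2 * CARD('n) - 2)
                               * \<eta> powr \<alpha> / \<alpha>))"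
proof -
  define n where "n = 2 * CARD('n) - 2"
  have Cpos: "0 < CARD('n)" by simp
  have n2: "2 * CARD('n) = n + 2" using Cpos unfolding n_def by linarith
  have rn: "2 * real CARD('n) - 2 = real n"
  proof -
    have "real (2 * CARD('n)) = real (n + 2)" by (simp only: n2)
    then show ?thesis by simp
  qed
  define Z where "Z = shell_mass TYPE('n)"
  have Z: "0 < Z" by (simp add: Z_def shell_mass_pos)
  \<comment> \<open>the largest scale: \<open>ln T + ln (4/5) = ln (\<eta> / 5)\<close>\<close>
  define T where "T = \<eta> / 4"
  have T: "0 < T" using \<eta> by (simp add: T_def)
  define t where "t k = T / 2 ^ k" for k :: nat
  have t: "0 < t k" "t k \<le> T" for k using T by (auto simp: t_def field_simps)
  have tmono: "t k \<le> t k'" if "k' \<le> k" for k k'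
    unfolding t_def using that T by (intro divide_left_mono power_increasing) auto
  \<comment> \<open>the drop over one dyadic scale is at most \<open>ln 2\<close> times the slope, so these slopes add up to a drop of \<open>1\<close>\<close>
  define c0 where "c0 = (1 - 2 powr (- \<alpha>)) / ln 2"
  have c0: "0 < c0" using \<alpha> by (simp add: c0_def two_powr_minus_less_1)
  define E where "E k = {z. log_slope z (t k) > Z * c0 * 2 powr (- \<alpha> * real k)}" for k :: nat
  obtain S where S: "S \<subseteq> {(z, k). z \<in> E k}" "disjoint_balls t S"
    "\<And>k z. z \<in> E k \<Longrightarrow> \<exists>(z', k')\<in>S. k' \<le> k \<and> dist z' z < t k' + t k"
    using greedy_disjoint_balls[of t E] t by blast
  have cS: "countable S" by (rule countable_disjoint_balls[OF t(1) S(2)])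
  define h where "h = to_nat_on S"
  have hinj: "inj_on h S" unfolding h_def using cS by (rule inj_on_to_nat_on)
  define J where "J = h ` S"
  define g where "g = inv_into S h"
  have gS: "g j \<in> S" if "j \<in> J" for j using that by (auto simp: g_def J_def intro: inv_into_into)
  have gh: "g (h p) = p" if "p \<in> S" for p using that hinj by (simp add: g_def)
  have ginj: "inj_on g J" by (rule inj_onI) (metis J_def gh imageE)
  define c where "c j = fst (g j)" for j
  define \<tau> where "\<tau> j = t (snd (g j))" for j
  define r where "r j = 2 * \<tau> j" for j
  have \<tau>: "0 < \<tau> j" "\<tau> j \<le> T" for j using t by (auto simp: \<tau>_def)
  have r\<eta>: "0 < r j \<and> r j < \<eta>" for j using \<tau>[of j] \<eta> by (simp add: r_def T_def)
  have good: "V z \<ge> ereal (- ln (5 * exp 1 / \<eta>))" if z: "z \<notin> (\<Union>j\<in>J. ball (c j) (r j))" for z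
  proof -
    have "z \<notin> E k" for k
    proof
      assume "z \<in> E k"
      then obtain z' k' where p: "(z', k') \<in> S" "k' \<le> k" "dist z' z < t k' + t k" using S(3) by blast
      have "h (z', k') \<in> J" using p by (simp add: J_def)
      moreover have "z \<in> ball (c (h (z', k'))) (r (h (z', k')))"
        using p(3) tmono[OF p(2)] by (simp add: c_def r_def \<tau>_def gh[OF p(1)])
      ultimately show False using z by blast
    qed
    then have "log_slope z (T / 2 ^ k) \<le> shell_mass TYPE('n) * ((1 - 2 powr (- \<alpha>)) / ln 2) * 2 powr (- \<alpha> * real k)" for k
      by (simp add: E_def t_def Z_def c0_def not_less)
    from V_ge_of_small_log_slopes[OF LP \<alpha> T this]
    have "V z \<ge> ereal (ln T + ln (4/5) - 1)" .
    also have "ln T + ln (4/5) - 1 = - ln (5 * exp 1 / \<eta>)"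
    proof -
      have "ln T + ln (4/5) = ln (\<eta> / 5)" using \<eta> by (simp add: T_def flip: ln_mult_pos)
      moreover have "ln (5 * exp 1 / \<eta>) = - ln (\<eta> / 5) + 1"
        using \<eta> by (simp add: ln_div ln_mult_pos)
      ultimately show ?thesis by simp
    qed
    finally show ?thesis .
  qed
  have sum_less: "(\<Sum>\<^sub>\<infinity>j\<in>{j\<in>J. ball (c j) (r j) \<inter> ball 0 R \<noteq> {}}. ennreal (r j powr (2 * real CARD('n) - 2 + \<alpha>)))
      < ennreal (5 ^ (2 * CARD('n) - 2) * (R + \<eta>) ^ (2 * CARD('n) - 2) * \<eta> powr \<alpha> / \<alpha>)" if R: "0 < R" for R
  proof -
    define JR where "JR = {j\<in>J. ball (c j) (r j) \<inter> ball 0 R \<noteq> {}}"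
    define A where "A = 2 ^ n * (\<eta> / 2) powr \<alpha> / c0 * (5/4 * (R + \<eta>)) ^ n"
    have fin: "(\<Sum>j\<in>F. r j powr (real n + \<alpha>)) \<le> A" if F: "finite F" "F \<subseteq> JR" for F
    proof -
      have term_le: "r j powr (real n + \<alpha>) \<le> 2 ^ n * (\<eta> / 2) powr \<alpha> / (c0 * Z) * (\<tau> j ^ (2 * CARD('n)) / (\<tau> j)\<^sup>2 * log_slope (c j) (\<tau> j))"
        if j: "j \<in> F" for j
      proof -
        define k where "k = snd (g j)"
        have "(c j, k) \<in> S" using gS[of j] j F by (simp add: c_def k_def JR_def subset_iff)
        then have "c j \<in> E k" using S(1) by blast
        then have sl: "Z * c0 * 2 powr (- \<alpha> * real k) \<le> log_slope (c j) (\<tau> j)" by (simp add: E_def \<tau>_def k_def)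
        have rj: "r j = \<eta> / 2 * 2 powr (- real k)"
        proof -
          have "2 powr (- real k) = 1 / 2 ^ k" by (simp add: powr_minus powr_realpow divide_inverse)
          moreover have "r j = 2 * (\<eta> / 4 / 2 ^ k)" by (simp only: r_def \<tau>_def k_def t_def T_def)
          ultimately show ?thesis by simp
        qed
        have "r j powr (real n + \<alpha>) = r j ^ n * r j powr \<alpha>"
          using r\<eta>[of j] by (simp add: powr_add powr_realpow)
        also have "r j powr \<alpha> = (\<eta> / 2) powr \<alpha> * 2 powr (- \<alpha> * real k)"
          unfolding rj using \<eta> by (subst powr_mult) (simp_all add: powr_powr mult.commute)
        also have "r j ^ n = 2 ^ n * (\<tau> j ^ (2 * CARD('n)) / (\<tau> j)\<^sup>2)"
        proof -
          have "\<tau> j ^ (2 * CARD('n)) / (\<tau> j)\<^sup>2 = \<tau> j ^ n"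
            using \<tau>(1)[of j] by (simp only: n2 power_add) simp
          then show ?thesis by (simp add: r_def power_mult_distrib)
        qed
        finally have "r j powr (real n + \<alpha>) = 2 ^ n * (\<tau> j ^ (2 * CARD('n)) / (\<tau> j)\<^sup>2) * ((\<eta> / 2) powr \<alpha> * 2 powr (- \<alpha> * real k))" .
        have e: "r j powr (real n + \<alpha>) = 2 ^ n * (\<eta> / 2) powr \<alpha> / (c0 * Z) * (\<tau> j ^ (2 * CARD('n)) / (\<tau> j)\<^sup>2 * (Z * c0 * 2 powr (- \<alpha> * real k)))"
        proof -
          have "(a * b) * (x * w) = a * x / (d * y) * (b * (y * d * w))" if "d \<noteq> 0" "y \<noteq> 0" for a b x w d y :: real
            using that by (simp add: field_simps)
          then show ?thesis using Z c0 \<open>r j powr (real n + \<alpha>) = 2 ^ n * (\<tau> j ^ (2 * CARD('n)) / (\<tau> j)\<^sup>2) * ((\<eta> / 2) powr \<alpha> * 2 powr (- \<alpha> * real k))\<close>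
            by (metis less_irrefl)
        qed
        show ?thesis unfolding e using sl Z c0 by (intro mult_left_mono) auto
      qed
      have "(\<Sum>j\<in>F. \<tau> j ^ (2 * CARD('n)) / (\<tau> j)\<^sup>2 * log_slope (c j) (\<tau> j))
         \<le> (5/4 * (R + \<eta>)) ^ (2 * CARD('n)) / (5/4 * (R + \<eta>))\<^sup>2 * log_slope 0 (5/4 * (R + \<eta>))"
      proof (rule log_slope_superadditive[OF F(1)])
        show "disjoint_family_on (\<lambda>j. ball (c j) (\<tau> j)) F"
          unfolding disjoint_family_on_def
        proof (intro ballI impI)
          fix i j assume ij: "i \<in> F" "j \<in> F" "i \<noteq> j"
          then have J: "i \<in> J" "j \<in> J" using F by (auto simp: JR_def)
          then have "g i \<noteq> g j" using ginj ij by (auto dest: inj_onD)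
          then show "ball (c i) (\<tau> i) \<inter> ball (c j) (\<tau> j) = {}"
            using S(2) gS[OF J(1)] gS[OF J(2)] unfolding disjoint_balls_def c_def \<tau>_def by blast
        qed
        fix j assume "j \<in> F"
        then have "ball (c j) (r j) \<inter> ball 0 R \<noteq> {}" using F by (auto simp: JR_def)
        then obtain y where y: "dist (c j) y < r j" "norm y < R" by auto
        have "norm (c j) \<le> norm y + dist (c j) y"
          using norm_triangle_ineq[of y "c j - y"] by (simp add: dist_norm)
        then show "norm (c j) + \<tau> j \<le> R + \<eta>" using y \<tau>[of j] \<eta> unfolding r_def T_def by linarith
      qed (use \<tau> R \<eta> in auto)
      also have "\<dots> \<le> (5/4 * (R + \<eta>)) ^ n * Z"
      proof -
        have R': "0 < 5/4 * (R + \<eta>)" using R \<eta> by simp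
        have "log_slope 0 (5/4 * (R + \<eta>)) \<le> Z"
          using log_slope_le_shell_mass[of 0 "ln (5/4 * (R + \<eta>))"] R' unfolding Z_def by (simp only: exp_ln)
        moreover have "(5/4 * (R + \<eta>)) ^ (2 * CARD('n)) / (5/4 * (R + \<eta>))\<^sup>2 = (5/4 * (R + \<eta>)) ^ n"
          using R' by (simp only: n2 power_add) simp
        ultimately show ?thesis using R' by (simp only:) (intro mult_left_mono, auto)
      qed
      finally have mass: "(\<Sum>j\<in>F. \<tau> j ^ (2 * CARD('n)) / (\<tau> j)\<^sup>2 * log_slope (c j) (\<tau> j)) \<le> (5/4 * (R + \<eta>)) ^ n * Z" .
      have "(\<Sum>j\<in>F. r j powr (real n + \<alpha>)) \<le> 2 ^ n * (\<eta> / 2) powr \<alpha> / (c0 * Z) * (\<Sum>j\<in>F. \<tau> j ^ (2 * CARD('n)) / (\<tau> j)\<^sup>2 * log_slope (c j) (\<tau> j))"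
        unfolding sum_distrib_left by (intro sum_mono term_le)
      also have "\<dots> \<le> 2 ^ n * (\<eta> / 2) powr \<alpha> / (c0 * Z) * ((5/4 * (R + \<eta>)) ^ n * Z)"
        using mass Z c0 by (intro mult_left_mono) auto
      also have "\<dots> = A" using Z by (simp add: A_def)
      finally show ?thesis .
    qed
    have "(\<Sum>\<^sub>\<infinity>j\<in>JR. ennreal (r j powr (real n + \<alpha>))) \<le> ennreal A"
    proof (rule infsum_le_finite_sums)
      show "(\<lambda>j. ennreal (r j powr (real n + \<alpha>))) summable_on JR"
        by (rule nonneg_summable_on_complete) simp
      fix F assume F: "finite F" "F \<subseteq> JR"
      have "(\<Sum>j\<in>F. ennreal (r j powr (real n + \<alpha>))) = ennreal (\<Sum>j\<in>F. r j powr (real n + \<alpha>))"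
        by (rule sum_ennreal) simp
      also have "\<dots> \<le> ennreal A" by (rule ennreal_leI[OF fin[OF F]])
      finally show "(\<Sum>j\<in>F. ennreal (r j powr (real n + \<alpha>))) \<le> ennreal A" .
    qed
    also have "ennreal A < ennreal (5 ^ n * (R + \<eta>) ^ n * \<eta> powr \<alpha> / \<alpha>)"
    proof (rule ennreal_lessI)
      show "0 < 5 ^ n * (R + \<eta>) ^ n * \<eta> powr \<alpha> / \<alpha>" using R \<eta> \<alpha> by simp
      have "\<alpha> * ln 2 * 2 powr (- \<alpha>) < 1 - 2 powr (- \<alpha>)" by (rule scale_constant_less[OF \<alpha>])
      then have cc: "2 powr (- \<alpha>) / c0 < 1 / \<alpha>"
        using \<alpha> c0 by (simp add: c0_def field_simps)
      have "A = (2 * (5/4 * (R + \<eta>))) ^ n * \<eta> powr \<alpha> * (2 powr (- \<alpha>) / c0)"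
      proof -
        have pw: "(\<eta> / 2) powr \<alpha> = \<eta> powr \<alpha> * 2 powr (- \<alpha>)"
          using \<eta> powr_divide[of \<eta> 2 \<alpha>] powr_minus_divide[of 2 \<alpha>] by simp
        have gen: "a * (b * x) / d * y = (a * y) * b * (x / d)" for a b x d y :: real by (simp add: divide_inverse mult_ac)
        show ?thesis unfolding A_def pw power_mult_distrib[of 2] by (rule gen)
      qed
      also have "\<dots> \<le> (5 * (R + \<eta>)) ^ n * \<eta> powr \<alpha> * (2 powr (- \<alpha>) / c0)"
        using R \<eta> c0 by (intro mult_right_mono power_mono) auto
      also have "\<dots> < (5 * (R + \<eta>)) ^ n * \<eta> powr \<alpha> * (1 / \<alpha>)"
        using R \<eta> cc by (intro mult_strict_left_mono) auto
      also have "\<dots> = 5 ^ n * (R + \<eta>) ^ n * \<eta> powr \<alpha> / \<alpha>"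
        by (simp only: power_mult_distrib times_divide_eq_right mult_1_right)
      finally show "A < 5 ^ n * (R + \<eta>) ^ n * \<eta> powr \<alpha> / \<alpha>" .
    qed
    finally show ?thesis unfolding JR_def[symmetric] rn n_def[symmetric] .
  qed
  show ?thesis
    using r\<eta> good sum_less by (intro exI[of _ J] exI[of _ c] exI[of _ r]) blast
qed

end

lemma Lelong_imp_Lelong_fn:
  assumes "V \<in> Lelong"
  shows "\<exists>C. Lelong_fn V C"
proof -
  from assms obtain C where C: "\<And>z. V z \<le> ereal (ln (max 1 (norm z)) + C)" and "V \<in> PSH"
    unfolding Lelong_def by blast
  then have "plurisubharmonic V" "\<exists>z. V z \<noteq> -\<infinity>" by (auto simp: PSH_def)
  then have "Lelong_fn V C"
    using C unfolding plurisubharmonic_def by unfold_locales auto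
  then show ?thesis ..
qed

theorem theorem4p2:
  fixes V :: "complex ^ 'n::finite \<Rightarrow> ereal" and \<alpha> \<eta> :: real
  assumes "0 < \<alpha>" "\<alpha> \<le> 2" "0 < \<eta>" "\<eta> < 5"
    and "V \<in> Log_potentials"
  shows "(\<exists>(J :: nat set) (c :: nat \<Rightarrow> complex ^ 'n) (r :: nat \<Rightarrow> real).
            (\<forall>j\<in>J. 0 < r j \<and> r j < \<eta>) \<and>
            (\<forall>z. z \<notin> (\<Union>j\<in>J. ball (c j) (r j)) \<longrightarrow> V z \<ge> ereal (- ln (5 * exp 1 / \<eta>))) \<and>
            (\<forall>R>0. (\<Sum>\<^sub>\<infinity>j\<in>{j\<in>J. ball (c j) (r j) \<inter> ball 0 R \<noteq> {}}.
                       ennreal (r j powr (2 * real CARD('n) - 2 + \<alpha>)))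
                    < ennreal (5 ^ (2 * CARD('n) - 2) * (R + \<eta>) ^ (2 * CARD('n) - 2)
                               * \<eta> powr \<alpha> / \<alpha>)))
       \<and> {z. \<not> V z \<ge> ereal (- ln (5 * exp 1 / \<eta>))} \<in> sets borel
       \<and> (\<forall>R>0. Hausdorff_content (2 * real CARD('n) - 2 + \<alpha>) (ereal \<eta>)
                   ({z. \<not> V z \<ge> ereal (- ln (5 * exp 1 / \<eta>))} \<inter> ball 0 R)
                 < ennreal (5 ^ (2 * CARD('n) - 2) * (R + \<eta>) ^ (2 * CARD('n) - 2)
                            * \<eta> powr \<alpha> / \<alpha>))"
    (is "?cover \<and> ?E \<in> sets borel \<and> ?content")
proof (intro conjI)
  have V: "V \<in> Lelong" and LP: "ereal_integral FS_measure (Robin_proj V) = 0"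
    using assms(5) by (auto simp: Log_potentials_def Lelong_star_def)
  obtain C where "Lelong_fn V C" using Lelong_imp_Lelong_fn[OF V] by blast
  then interpret Lelong_fn V C .
  show cover: ?cover by (rule exceptional_covering[OF LP assms(1,3)])
  have "?E = {z. V z < ereal (- ln (5 * exp 1 / \<eta>))}" by (simp add: not_le)
  then show "?E \<in> sets borel" using usc by simp
  show ?content
  proof (intro allI impI)
    fix R :: real assume R: "0 < R"
    obtain J :: "nat set" and c :: "nat \<Rightarrow> complex ^ 'n" and r :: "nat \<Rightarrow> real" where
      J: "\<forall>j\<in>J. 0 < r j \<and> r j < \<eta>"
      and good: "\<forall>z. z \<notin> (\<Union>j\<in>J. ball (c j) (r j)) \<longrightarrow> V z \<ge> ereal (- ln (5 * exp 1 / \<eta>))"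
      and less: "\<forall>R>0. (\<Sum>\<^sub>\<infinity>j\<in>{j\<in>J. ball (c j) (r j) \<inter> ball 0 R \<noteq> {}}.
                       ennreal (r j powr (2 * real CARD('n) - 2 + \<alpha>)))
                    < ennreal (5 ^ (2 * CARD('n) - 2) * (R + \<eta>) ^ (2 * CARD('n) - 2)
                               * \<eta> powr \<alpha> / \<alpha>)"
      using cover by blast
    define JR where "JR = {j\<in>J. ball (c j) (r j) \<inter> ball 0 R \<noteq> {}}"
    have cov: "?E \<inter> ball 0 R \<subseteq> (\<Union>j\<in>JR. ball (c j) (r j))"
    proof
      fix z assume z: "z \<in> ?E \<inter> ball 0 R"
      then obtain j where "j \<in> J" "z \<in> ball (c j) (r j)" using good by blast
      then have "j \<in> JR" using z unfolding JR_def by blast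
      then show "z \<in> (\<Union>j\<in>JR. ball (c j) (r j))" using \<open>z \<in> ball (c j) (r j)\<close> by blast
    qed
    have "Hausdorff_content (2 * real CARD('n) - 2 + \<alpha>) (ereal \<eta>) (?E \<inter> ball 0 R)
       \<le> (\<Sum>\<^sub>\<infinity>j\<in>JR. ennreal (r j powr (2 * real CARD('n) - 2 + \<alpha>)))"
      unfolding Hausdorff_content_def
    proof (rule Inf_lower, rule CollectI, intro exI conjI)
      show "\<forall>j\<in>JR. 0 < r j \<and> ereal (r j) \<le> ereal \<eta>" using J by (auto simp: JR_def less_imp_le)
      show "?E \<inter> ball 0 R \<subseteq> (\<Union>j\<in>JR. ball (c j) (r j))" by (rule cov)
    qed (rule refl)
    also have "\<dots> < ennreal (5 ^ (2 * CARD('n) - 2) * (R + \<eta>) ^ (2 * CARD('n) - 2) * \<eta> powr \<alpha> / \<alpha>)"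
      using less R unfolding JR_def by blast
    finally show "Hausdorff_content (2 * real CARD('n) - 2 + \<alpha>) (ereal \<eta>) (?E \<inter> ball 0 R)
      < ennreal (5 ^ (2 * CARD('n) - 2) * (R + \<eta>) ^ (2 * CARD('n) - 2) * \<eta> powr \<alpha> / \<alpha>)" .
  qed
qed

end
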